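(* Let $\mathcal{A}=\mathcal{A}_n^{\bar q,\Lambda}(\mathbb{K})$ with no $q_k$ a root of unity. Every $\mathbb{K}$-algebra automorphism $h$ of $\mathcal{A}[t]=\mathcal{A}\otimes_{\mathbb{K}}\mathbb{K}[t]$ is triangular: there are $g\in\mathrm{Aut}_{\mathbb{K}}(\mathcal{A})$, $c\in\mathbb{K}^*$ and $r\in\mathbb{K}$ with $h|_{\mathcal{A}}=g$ and $h(t)=ct+r$; conversely every such data defines an automorphism. Thus $\mathrm{Aut}_{\mathbb{K}}(\mathcal{A}[t])=\begin{pmatrix}\mathrm{Aut}_{\mathbb{K}}(\mathcal{A}) & \mathbb{K}\\ 0 & \mathbb{K}^*\end{pmatrix}$. Moreover, if $\mathbb{K}$ has characteristic $0$, then the only locally nilpotent $\mathbb{K}$-derivation of $\mathcal{A}$ is $0$.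
   Context: Let $\mathbb{K}$ be a field, $n\ge 1$, $\bar q=(q_1,\dots,q_n)\in(\mathbb{K}^* )^n$, and $\Lambda=(\lambda_{ij})$ an $n\times n$ matrix over $\mathbb{K}^*$ with $\lambda_{ij}=\lambda_{ji}^{-1}$, $\lambda_{ii}=1$. $\mathcal{A}_n^{\bar q,\Lambda}(\mathbb{K})$ is the $\mathbb{K}$-algebra generated by $x_1,y_1,\dots,x_n,y_n$ with relations: for $1\le i<j\le n$, $x_ix_j=\lambda_{ij}x_jx_i$, $y_jy_i=\lambda_{ji}y_iy_j$, $x_iy_j=\lambda_{ji}y_jx_i$, $x_jy_i=\lambda_{ij}y_ix_j$; and $x_iy_i-q_iy_ix_i=1$ for all $i$. The matrix notation denotes the group of pairs $(g, (c,r))$ acting by $a\mapsto g(a)$ for $a\in\mathcal{A}$ and $t\mapsto ct+r$. A derivation $\partial$ is locally nilpotent if for each $a$ some power $\partial^k(a)=0$. *)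

theory Defs
  imports "HOL-Algebra.QuotRing" "HOL-Algebra.UnivPoly" "HOL-Library.Poly_Mapping"
begin

datatype gen = X nat | Y nat

definition gens :: "nat \<Rightarrow> gen set" where
  "gens n = {X i | i. 1 \<le> i \<and> i \<le> n} \<union> {Y i | i. 1 \<le> i \<and> i \<le> n}"

type_synonym 'k fa = "gen list \<Rightarrow>\<^sub>0 'k"

definition fa_mult :: "'k::comm_ring_1 fa \<Rightarrow> 'k fa \<Rightarrow> 'k fa" where
  "fa_mult p q = (\<Sum>u\<in>Poly_Mapping.keys p. \<Sum>v\<in>Poly_Mapping.keys q. Poly_Mapping.single (u @ v) (Poly_Mapping.lookup p u * Poly_Mapping.lookup q v))"

definition free_alg :: "nat \<Rightarrow> ('k::comm_ring_1 fa) ring" where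
  "free_alg n = \<lparr>carrier = {p. \<forall>w\<in>Poly_Mapping.keys p. set w \<subseteq> gens n},
                 mult = fa_mult, one = Poly_Mapping.single [] 1, zero = 0, add = (+)\<rparr>"

definition fa_sc :: "'k::comm_ring_1 \<Rightarrow> 'k fa" where
  "fa_sc c = Poly_Mapping.single [] c"

definition fa_gen :: "gen \<Rightarrow> 'k::comm_ring_1 fa" where
  "fa_gen g = Poly_Mapping.single [g] 1"

definition fa_x :: "nat \<Rightarrow> 'k::comm_ring_1 fa" where "fa_x i = fa_gen (X i)"
definition fa_y :: "nat \<Rightarrow> 'k::comm_ring_1 fa" where "fa_y i = fa_gen (Y i)"

definition qwa_rels :: "nat \<Rightarrow> (nat \<Rightarrow> 'k) \<Rightarrow> (nat \<Rightarrow> nat \<Rightarrow> 'k) \<Rightarrow> ('k::comm_ring_1 fa) set" where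
  "qwa_rels n q lam =
     {fa_mult (fa_x i) (fa_x j) - fa_mult (fa_sc (lam i j)) (fa_mult (fa_x j) (fa_x i))
        | i j. 1 \<le> i \<and> i < j \<and> j \<le> n}
   \<union> {fa_mult (fa_y j) (fa_y i) - fa_mult (fa_sc (lam j i)) (fa_mult (fa_y i) (fa_y j))
        | i j. 1 \<le> i \<and> i < j \<and> j \<le> n}
   \<union> {fa_mult (fa_x i) (fa_y j) - fa_mult (fa_sc (lam j i)) (fa_mult (fa_y j) (fa_x i))
        | i j. 1 \<le> i \<and> i < j \<and> j \<le> n}
   \<union> {fa_mult (fa_x j) (fa_y i) - fa_mult (fa_sc (lam i j)) (fa_mult (fa_y i) (fa_x j))
        | i j. 1 \<le> i \<and> i < j \<and> j \<le> n}
   \<union> {fa_mult (fa_x i) (fa_y i) - fa_mult (fa_sc (q i)) (fa_mult (fa_y i) (fa_x i)) - fa_sc 1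
        | i. 1 \<le> i \<and> i \<le> n}"

definition qwa :: "nat \<Rightarrow> (nat \<Rightarrow> 'k) \<Rightarrow> (nat \<Rightarrow> nat \<Rightarrow> 'k) \<Rightarrow> ('k::comm_ring_1 fa set) ring" where
  "qwa n q lam = free_alg n Quot (genideal (free_alg n) (qwa_rels n q lam))"

definition qwa_sc :: "nat \<Rightarrow> (nat \<Rightarrow> 'k) \<Rightarrow> (nat \<Rightarrow> nat \<Rightarrow> 'k) \<Rightarrow> 'k \<Rightarrow> ('k::comm_ring_1) fa set" where
  "qwa_sc n q lam c = genideal (free_alg n) (qwa_rels n q lam) +>\<^bsub>free_alg n\<^esub> fa_sc c"

definition alg_aut :: "('a, 'm) ring_scheme \<Rightarrow> ('k \<Rightarrow> 'a) \<Rightarrow> ('a \<Rightarrow> 'a) set" where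
  "alg_aut R iota = {h. h \<in> ring_iso R R \<and>
      (\<forall>c a. a \<in> carrier R \<longrightarrow> h (iota c \<otimes>\<^bsub>R\<^esub> a) = iota c \<otimes>\<^bsub>R\<^esub> h a)}"

definition alg_derivation :: "('a, 'm) ring_scheme \<Rightarrow> ('k \<Rightarrow> 'a) \<Rightarrow> ('a \<Rightarrow> 'a) \<Rightarrow> bool" where
  "alg_derivation R iota d \<longleftrightarrow>
     d \<in> carrier R \<rightarrow> carrier R \<and>
     (\<forall>a\<in>carrier R. \<forall>b\<in>carrier R. d (a \<oplus>\<^bsub>R\<^esub> b) = d a \<oplus>\<^bsub>R\<^esub> d b) \<and>
     (\<forall>a\<in>carrier R. \<forall>b\<in>carrier R.
        d (a \<otimes>\<^bsub>R\<^esub> b) = (d a \<otimes>\<^bsub>R\<^esub> b) \<oplus>\<^bsub>R\<^esub> (a \<otimes>\<^bsub>R\<^esub> d b)) \<and>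
     (\<forall>c. \<forall>a\<in>carrier R. d (iota c \<otimes>\<^bsub>R\<^esub> a) = iota c \<otimes>\<^bsub>R\<^esub> d a)"

definition locally_nilpotent :: "('a, 'm) ring_scheme \<Rightarrow> ('a \<Rightarrow> 'a) \<Rightarrow> bool" where
  "locally_nilpotent R d \<longleftrightarrow> (\<forall>a\<in>carrier R. \<exists>k. (d ^^ k) a = \<zero>\<^bsub>R\<^esub>)"

end

theory Submission
  imports Defs
begin

text \<open>
  The algebra embeds into the quantum torus with generators \<open>x\<^sub>i, z\<^sub>i\<close>, where
  \<open>z\<^sub>i = x\<^sub>i y\<^sub>i - y\<^sub>i x\<^sub>i = 1 + (q\<^sub>i - 1) y\<^sub>i x\<^sub>i\<close>, by sending \<open>y\<^sub>i\<close> to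
  \<open>(q\<^sub>i - 1)\<inverse> (z\<^sub>i - 1) x\<^sub>i\<inverse>\<close>: the ordered monomials span, and their images have pairwise
  distinct leading exponents. Leading terms in the torus show that \<open>A\<close> is a domain and that two
  nonzero elements \<open>u, u'\<close> inducing the same twist (\<open>u a = a' u\<close> and \<open>u' a = a' u'\<close> for all \<open>a\<close>)
  are proportional, since no \<open>q\<^sub>i\<close> is a root of unity. In particular the centre of \<open>A[t]\<close> is \<open>K[t]\<close>.

  Let \<open>h\<close> be an automorphism of \<open>A[t]\<close>. Each \<open>z\<^sub>i\<close> is normal, hence so is \<open>h z\<^sub>i\<close>; all its
  coefficients induce the same twist, so \<open>h z\<^sub>i = f(t) w\<close> with \<open>w \<in> A\<close>. Then \<open>h\<inverse> f\<close> is a central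
  factor of \<open>z\<^sub>i\<close>, hence a scalar, and \<open>h z\<^sub>i \<in> A\<close>. As \<open>y\<^sub>i x\<^sub>i\<close> is a linear function of \<open>z\<^sub>i\<close>,
  degrees in \<open>t\<close> force \<open>h x\<^sub>i, h y\<^sub>i \<in> A\<close>. If \<open>d\<close> is a locally nilpotent derivation, applying this to the
  automorphism \<open>exp (t d)\<close> gives \<open>d = 0\<close>.
\<close>

section \<open>Polynomials over a noncommutative ring\<close>

text \<open>The obstacle is that \<open>A\<close> is given by generators and relations, so neither
  zero divisors nor commutation can be read off, and the relation
  \<open>x_i y_i - q_i y_i x_i = 1\<close> is inhomogeneous. With \<open>z_i\<close> in place of
  \<open>y_i\<close> all relations become commutations up to a scalar, and these can be computed on
  monomials. Normal elements carry the argument because normality, unlike membership in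
  \<open>A\<close>, is visibly preserved by an automorphism of \<open>A[t]\<close>. Central elements
  would not do: those of \<open>A\<close> are scalars and say nothing about the generators. All
  coefficients of \<open>h z_i\<close> induce the same twist for a reason of degree: if
  \<open>u a = b u\<close> with \<open>a\<close> in \<open>A\<close>, then \<open>b\<close> has
  degree \<open>0\<close> in \<open>t\<close>, so one element of \<open>A\<close> serves every
  coefficient of \<open>u\<close>. The arguments about \<open>t\<close> use four properties of
  \<open>A\<close> only, collected in \<open>rigid_algebra\<close>; the torus serves to establish
  them.\<close>

context UP_ring
begin

lemma coeff_mult_const:
  assumes "p \<in> carrier P" "a \<in> carrier R"
  shows "coeff P (p \<otimes>\<^bsub>P\<^esub> monom P a 0) n = coeff P p n \<otimes> a"
proof -
  have "coeff P (p \<otimes>\<^bsub>P\<^esub> monom P a 0) n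
      = (\<Oplus>i\<in>{..n}. if n = i then coeff P p i \<otimes> a else \<zero>)"
    using assms by (simp, intro R.finsum_cong') auto
  also have "\<dots> = coeff P p n \<otimes> a"
    using assms by (subst R.finsum_singleton) auto
  finally show ?thesis .
qed

lemma coeff_const_mult:
  assumes "p \<in> carrier P" "a \<in> carrier R"
  shows "coeff P (monom P a 0 \<otimes>\<^bsub>P\<^esub> p) n = a \<otimes> coeff P p n"
  using assms by (simp only: monom_mult_is_smult coeff_smult)

lemma ex_poly_coeff:
  assumes "\<And>n. f n \<in> carrier R" "\<And>n. n > N \<Longrightarrow> f n = \<zero>"
  shows "\<exists>p\<in>carrier P. \<forall>n. coeff P p n = f n"
proof (intro bexI allI)
  have "f \<in> up R" using assms by (intro mem_upI exI[of _ N] bound.intro) auto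
  then show "f \<in> carrier P" "coeff P f n = f n" for n by (simp_all add: P_def UP_def)
qed

lemma UP_induct [consumes 1, case_names monom add]:
  assumes "p \<in> carrier P"
    and "\<And>a n. a \<in> carrier R \<Longrightarrow> Q (monom P a n)"
    and "\<And>p q. p \<in> carrier P \<Longrightarrow> q \<in> carrier P \<Longrightarrow> Q p \<Longrightarrow> Q q \<Longrightarrow> Q (p \<oplus>\<^bsub>P\<^esub> q)"
  shows "Q p"
proof -
  have "Q (\<Oplus>\<^bsub>P\<^esub>i\<in>{..k}. monom P (coeff P p i) i)" for k :: nat
  proof (induction k)
    case 0
    have "(\<Oplus>\<^bsub>P\<^esub>i\<in>{..0}. monom P (coeff P p i) i) = monom P (coeff P p 0) 0"
      using assms(1) by (subst P.finsum_0) auto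
    then show ?case using assms(1,2) by auto
  next
    case (Suc k)
    have "(\<Oplus>\<^bsub>P\<^esub>i\<in>{..Suc k}. monom P (coeff P p i) i)
       = monom P (coeff P p (Suc k)) (Suc k) \<oplus>\<^bsub>P\<^esub> (\<Oplus>\<^bsub>P\<^esub>i\<in>{..k}. monom P (coeff P p i) i)"
      using assms(1) by (subst P.finsum_Suc) auto
    with Suc show ?case using assms by (auto intro!: P.finsum_closed)
  qed
  then show ?thesis using up_repr[OF assms(1)] by metis
qed

lemma const_iff_deg_0:
  assumes "p \<in> carrier P"
  shows "deg R p = 0 \<longleftrightarrow> (\<exists>a\<in>carrier R. p = monom P a 0)"
  using assms deg_zero_impl_monom[OF assms] by (metis coeff_closed deg_const)

lemma const_inj: "a \<in> carrier R \<Longrightarrow> b \<in> carrier R \<Longrightarrow> monom P a 0 = monom P b 0 \<Longrightarrow> a = b"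
  by (metis (full_types) coeff_monom)

lemma const_mult:
  "a \<in> carrier R \<Longrightarrow> b \<in> carrier R \<Longrightarrow> monom P a 0 \<otimes>\<^bsub>P\<^esub> monom P b 0 = monom P (a \<otimes> b) 0"
  using monom_mult[of a b 0 0] by simp

abbreviation indet where "indet \<equiv> monom P \<one> 1"

lemma indet_pow: "indet [^]\<^bsub>P\<^esub> (n::nat) = monom P \<one> n"
proof (induction n)
  case (Suc n)
  then show ?case using monom_one_Suc[of n] by simp
qed simp

lemma const_mult_monom:
  "a \<in> carrier R \<Longrightarrow> b \<in> carrier R \<Longrightarrow> monom P a 0 \<otimes>\<^bsub>P\<^esub> monom P b n = monom P (a \<otimes> b) n"
  using monom_mult[of a b 0 n] by simp

lemma indet_central: "p \<in> carrier P \<Longrightarrow> indet \<otimes>\<^bsub>P\<^esub> p = p \<otimes>\<^bsub>P\<^esub> indet"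
proof (induction rule: UP_induct)
  case (monom a n)
  then show ?case using monom_mult[of \<one> a 1 n] monom_mult[of a \<one> n 1] by simp
qed (simp add: P.l_distr P.r_distr)

lemma coeff_indet_mult:
  assumes "p \<in> carrier P"
  shows "coeff P (indet \<otimes>\<^bsub>P\<^esub> p) 0 = \<zero>" "coeff P (indet \<otimes>\<^bsub>P\<^esub> p) (Suc n) = coeff P p n"
  using assms coeff_monom_mult[of \<one> p 1 n] by simp_all

lemma indet_dvd:
  assumes "p \<in> carrier P" "coeff P p 0 = \<zero>"
  shows "\<exists>q\<in>carrier P. p = indet \<otimes>\<^bsub>P\<^esub> q \<and> (\<forall>n. coeff P q n = coeff P p (Suc n))"
proof -
  obtain q where q: "q \<in> carrier P" "\<And>n. coeff P q n = coeff P p (Suc n)"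
    using ex_poly_coeff[of "\<lambda>n. coeff P p (Suc n)" "deg R p"] assms by (auto simp: deg_aboveD)
  have "p = indet \<otimes>\<^bsub>P\<^esub> q"
  proof (rule up_eqI)
    fix n show "coeff P p n = coeff P (indet \<otimes>\<^bsub>P\<^esub> q) n"
      by (cases n) (use q assms coeff_indet_mult[of q] in \<open>simp_all del: coeff_mult\<close>)
  qed (use q assms in auto)
  with q show ?thesis by blast
qed

end

text \<open>The variable of \<open>P\<close> commutes with every coefficient, so evaluation at
  \<open>s\<close> can be multiplicative only if \<open>s\<close> commutes with the image of
  \<open>R\<close>; this hypothesis stands in for commutativity of \<open>S\<close>.
  Multiplicativity is checked on two monomials and extended by additivity, one factor at a
  time.\<close>

lemma (in UP_ring) eval_hom_exists:
  fixes S (structure)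
  assumes S: "ring S" and phi: "\<phi> \<in> ring_hom R S" and s: "s \<in> carrier S"
    and comm: "\<And>a. a \<in> carrier R \<Longrightarrow> \<phi> a \<otimes>\<^bsub>S\<^esub> s = s \<otimes>\<^bsub>S\<^esub> \<phi> a"
  shows "\<exists>H\<in>ring_hom P S. \<forall>a\<in>carrier R. \<forall>n. H (monom P a n) = \<phi> a \<otimes>\<^bsub>S\<^esub> s [^]\<^bsub>S\<^esub> n"
proof -
  interpret S: ring S by (rule S)
  note phi_closed [simp] = ring_hom_closed[OF phi]
  note [simp] = s
  have phi_zero: "\<phi> \<zero> = \<zero>\<^bsub>S\<^esub>"
    by (rule ring_hom_zero[OF phi R.ring_axioms S])
  define H where "H p = (\<Oplus>\<^bsub>S\<^esub>i\<in>{..deg R p}. \<phi> (coeff P p i) \<otimes>\<^bsub>S\<^esub> s [^]\<^bsub>S\<^esub> i)" for p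
  have H_le: "H p = (\<Oplus>\<^bsub>S\<^esub>i\<in>{..N}. \<phi> (coeff P p i) \<otimes>\<^bsub>S\<^esub> s [^]\<^bsub>S\<^esub> i)"
    if "p \<in> carrier P" "deg R p \<le> N" for p N
    unfolding H_def using that deg_aboveD phi_zero
    by (intro S.add.finprod_mono_neutral_cong_left) auto
  have H_closed [simp]: "H p \<in> carrier S" if "p \<in> carrier P" for p
    unfolding H_def using that by (intro S.finsum_closed) auto
  have H_add: "H (p \<oplus>\<^bsub>P\<^esub> p') = H p \<oplus>\<^bsub>S\<^esub> H p'" if "p \<in> carrier P" "p' \<in> carrier P" for p p'
  proof -
    define N where "N = max (deg R p) (deg R p')"
    have "deg R (p \<oplus>\<^bsub>P\<^esub> p') \<le> N" using deg_add that by (simp add: N_def)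
    then have "H (p \<oplus>\<^bsub>P\<^esub> p') = (\<Oplus>\<^bsub>S\<^esub>i\<in>{..N}. \<phi> (coeff P (p \<oplus>\<^bsub>P\<^esub> p') i) \<otimes>\<^bsub>S\<^esub> s [^]\<^bsub>S\<^esub> i)"
      by (intro H_le) (use that in auto)
    also have "\<dots> = (\<Oplus>\<^bsub>S\<^esub>i\<in>{..N}. \<phi> (coeff P p i) \<otimes>\<^bsub>S\<^esub> s [^]\<^bsub>S\<^esub> i \<oplus>\<^bsub>S\<^esub> \<phi> (coeff P p' i) \<otimes>\<^bsub>S\<^esub> s [^]\<^bsub>S\<^esub> i)"
      using that by (intro S.finsum_cong') (auto simp: ring_hom_add[OF phi] S.l_distr)
    also have "\<dots> = H p \<oplus>\<^bsub>S\<^esub> H p'"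
      using that by (subst S.finsum_addf) (auto simp: H_le[of _ N] N_def)
    finally show ?thesis .
  qed
  have H_monom: "H (monom P a n) = \<phi> a \<otimes>\<^bsub>S\<^esub> s [^]\<^bsub>S\<^esub> n" if "a \<in> carrier R" for a n
  proof -
    have "H (monom P a n) = (\<Oplus>\<^bsub>S\<^esub>i\<in>{..n}. \<phi> (coeff P (monom P a n) i) \<otimes>\<^bsub>S\<^esub> s [^]\<^bsub>S\<^esub> i)"
      using that by (intro H_le) (auto intro: deg_monom_le)
    also have "\<dots> = (\<Oplus>\<^bsub>S\<^esub>i\<in>{..n}. if n = i then \<phi> a \<otimes>\<^bsub>S\<^esub> s [^]\<^bsub>S\<^esub> i else \<zero>\<^bsub>S\<^esub>)"
      using that by (intro S.finsum_cong') (auto simp: phi_zero)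
    also have "\<dots> = \<phi> a \<otimes>\<^bsub>S\<^esub> s [^]\<^bsub>S\<^esub> n"
      using that by (subst S.finsum_singleton) auto
    finally show ?thesis .
  qed
  have comm_pow: "s [^]\<^bsub>S\<^esub> (n::nat) \<otimes>\<^bsub>S\<^esub> \<phi> a = \<phi> a \<otimes>\<^bsub>S\<^esub> s [^]\<^bsub>S\<^esub> n" if "a \<in> carrier R" for a n
  proof (induction n)
    case (Suc n)
    have "s [^]\<^bsub>S\<^esub> Suc n \<otimes>\<^bsub>S\<^esub> \<phi> a = s [^]\<^bsub>S\<^esub> n \<otimes>\<^bsub>S\<^esub> (\<phi> a \<otimes>\<^bsub>S\<^esub> s)"
      using that by (simp add: S.m_assoc comm)
    also have "\<dots> = \<phi> a \<otimes>\<^bsub>S\<^esub> s [^]\<^bsub>S\<^esub> Suc n"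
      using that Suc by (simp add: S.m_assoc[symmetric])
    finally show ?case .
  qed (use that in simp)
  have H_mult_monom: "H (monom P a m \<otimes>\<^bsub>P\<^esub> monom P b n) = H (monom P a m) \<otimes>\<^bsub>S\<^esub> H (monom P b n)"
    if "a \<in> carrier R" "b \<in> carrier R" for a b m n
  proof -
    have "H (monom P a m) \<otimes>\<^bsub>S\<^esub> H (monom P b n)
        = \<phi> a \<otimes>\<^bsub>S\<^esub> ((s [^]\<^bsub>S\<^esub> m \<otimes>\<^bsub>S\<^esub> \<phi> b) \<otimes>\<^bsub>S\<^esub> s [^]\<^bsub>S\<^esub> n)"
      using that by (simp add: H_monom S.m_assoc)
    also have "\<dots> = (\<phi> a \<otimes>\<^bsub>S\<^esub> \<phi> b) \<otimes>\<^bsub>S\<^esub> (s [^]\<^bsub>S\<^esub> m \<otimes>\<^bsub>S\<^esub> s [^]\<^bsub>S\<^esub> n)"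
      using that by (simp add: comm_pow S.m_assoc)
    also have "\<dots> = H (monom P a m \<otimes>\<^bsub>P\<^esub> monom P b n)"
      using that H_monom[of "a \<otimes> b" "m + n"]
      by (simp add: S.nat_pow_mult ring_hom_mult[OF phi])
    finally show ?thesis by simp
  qed
  have H_mult1: "H (monom P a m \<otimes>\<^bsub>P\<^esub> p) = H (monom P a m) \<otimes>\<^bsub>S\<^esub> H p"
    if "a \<in> carrier R" "p \<in> carrier P" for a m p
    using that(2)
  proof (induction rule: UP_induct)
    case (monom b n) then show ?case using that H_mult_monom by blast
  next
    case (add p q) then show ?case using that by (simp add: P.r_distr H_add S.r_distr)
  qed
  have H_mult: "H (p \<otimes>\<^bsub>P\<^esub> p') = H p \<otimes>\<^bsub>S\<^esub> H p'" if "p \<in> carrier P" "p' \<in> carrier P" for p p'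
    using that(1)
  proof (induction rule: UP_induct)
    case (monom b n) then show ?case using that H_mult1 by blast
  next
    case (add p q) then show ?case using that by (simp add: P.l_distr H_add S.l_distr)
  qed
  have "H \<one>\<^bsub>P\<^esub> = \<one>\<^bsub>S\<^esub>" using H_monom[of \<one> 0] by (simp add: ring_hom_one[OF phi])
  then have "H \<in> ring_hom P S"
    by (intro ring_hom_memI) (simp_all add: H_add H_mult)
  with H_monom show ?thesis by blast
qed

lemma (in UP_ring) hom_eqI:
  assumes "H \<in> ring_hom P S" "H' \<in> ring_hom P S"
    and "\<And>a. a \<in> carrier R \<Longrightarrow> H (monom P a 0) = H' (monom P a 0)" "H indet = H' indet"
    and "p \<in> carrier P"
  shows "H p = H' p"
  using assms(5)
proof (induction rule: UP_induct)
  case (monom a n)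
  have pow: "H (monom P \<one> n) = H' (monom P \<one> n)"
  proof (induction n)
    case 0 then show ?case using assms(3) by blast
  next
    case (Suc n)
    then show ?case unfolding monom_one_Suc
      using assms(1,2,4) by (simp add: ring_hom_mult)
  qed
  have "monom P a n = monom P a 0 \<otimes>\<^bsub>P\<^esub> monom P \<one> n"
    using monom const_mult_monom[of a \<one> n] by simp
  then show ?case using monom assms(1,2,3) pow by (simp add: ring_hom_mult)
next
  case (add p q)
  then show ?case using assms(1,2) by (simp add: ring_hom_add)
qed

section \<open>Polynomial extensions of algebras over a field\<close>

locale up_algebra = UP_ring +
  fixes iota :: "'k::field \<Rightarrow> 'a"
  assumes iota_closed [simp]: "iota c \<in> carrier R"
    and iota_add: "iota (c + d) = iota c \<oplus> iota d"
    and iota_mult: "iota (c * d) = iota c \<otimes> iota d"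
    and iota_one: "iota 1 = \<one>"
    and iota_central: "a \<in> carrier R \<Longrightarrow> iota c \<otimes> a = a \<otimes> iota c"
begin

abbreviation iotaP where "iotaP \<equiv> (\<lambda>c. monom P (iota c) 0)"

lemma iota_zero: "iota 0 = \<zero>"
  using iota_add[of 0 0] R.add.l_cancel_one'[of "iota 0" "iota 0"] by (metis add_0 iota_closed)

lemma iota_pull: "a \<in> carrier R \<Longrightarrow> b \<in> carrier R \<Longrightarrow> a \<otimes> (iota c \<otimes> b) = iota c \<otimes> (a \<otimes> b)"
  by (metis R.m_assoc iota_central iota_closed)

lemma alg_autD:
  assumes "h \<in> alg_aut P iotaP"
  shows "h \<in> ring_iso P P" "h \<in> ring_hom P P" "bij_betw h (carrier P) (carrier P)"
    "h (iotaP c) = iotaP c"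
proof -
  show iso: "h \<in> ring_iso P P" using assms by (simp add: alg_aut_def)
  then show hom: "h \<in> ring_hom P P" and "bij_betw h (carrier P) (carrier P)"
    by (auto simp: ring_iso_def)
  have "h (iotaP c \<otimes>\<^bsub>P\<^esub> \<one>\<^bsub>P\<^esub>) = iotaP c \<otimes>\<^bsub>P\<^esub> h \<one>\<^bsub>P\<^esub>"
    using assms UP_one_closed unfolding alg_aut_def by blast
  then show "h (iotaP c) = iotaP c" using ring_hom_one[OF hom] by simp
qed

lemma alg_autI:
  assumes "h \<in> ring_hom P P" "bij_betw h (carrier P) (carrier P)" "\<And>c. h (iotaP c) = iotaP c"
  shows "h \<in> alg_aut P iotaP"
  using assms by (auto simp: alg_aut_def ring_iso_def ring_hom_mult)

lemma alg_aut_inverse: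
  assumes "h \<in> alg_aut P iotaP"
  shows "inv_into (carrier P) h \<in> alg_aut P iotaP"
proof (rule alg_autI)
  note h = alg_autD[OF assms]
  have "inv_into (carrier P) h \<in> ring_iso P P"
    by (rule ring_iso_set_sym[OF P.ring_axioms h(1)])
  then show "inv_into (carrier P) h \<in> ring_hom P P"
    "bij_betw (inv_into (carrier P) h) (carrier P) (carrier P)"
    by (auto simp: ring_iso_def)
  show "inv_into (carrier P) h (iotaP c) = iotaP c" for c
    using bij_betw_inv_into_left[OF h(3), of "iotaP c"] h(4)[of c] by simp
qed

text \<open>Since \<open>c\<close> and \<open>r\<close> are scalars, \<open>c t + r\<close> commutes
  with all constants, which is what evaluation at it requires.\<close>

lemma triangular_hom_exists:
  assumes "g \<in> ring_hom R R"
  shows "\<exists>H\<in>ring_hom P P. (\<forall>a\<in>carrier R. H (monom P a 0) = monom P (g a) 0)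
     \<and> H indet = monom P (iota c) 1 \<oplus>\<^bsub>P\<^esub> iotaP r"
proof -
  define s where "s = monom P (iota c) 1 \<oplus>\<^bsub>P\<^esub> iotaP r"
  note g = ring_hom_closed[OF assms] ring_hom_one[OF assms]
  have s: "s \<in> carrier P" by (simp add: s_def)
  have phi: "(\<lambda>a. monom P (g a) 0) \<in> ring_hom R P"
    using g by (intro ring_hom_memI)
      (simp_all add: const_mult ring_hom_add[OF assms] ring_hom_mult[OF assms])
  have comm: "monom P (g a) 0 \<otimes>\<^bsub>P\<^esub> s = s \<otimes>\<^bsub>P\<^esub> monom P (g a) 0" if "a \<in> carrier R" for a
  proof (rule up_eqI)
    have "iota d \<otimes> g a = g a \<otimes> iota d" for d using that g iota_central by blast
    then show "coeff P (monom P (g a) 0 \<otimes>\<^bsub>P\<^esub> s) n = coeff P (s \<otimes>\<^bsub>P\<^esub> monom P (g a) 0) n" for n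
      using that g s by (simp only: coeff_const_mult coeff_mult_const) (simp add: s_def R.l_distr R.r_distr)
  qed (use that g s in auto)
  obtain H where H: "H \<in> ring_hom P P"
    "\<And>a n. a \<in> carrier R \<Longrightarrow> H (monom P a n) = monom P (g a) 0 \<otimes>\<^bsub>P\<^esub> s [^]\<^bsub>P\<^esub> (n::nat)"
    using eval_hom_exists[OF P.ring_axioms phi s comm] by blast
  have "H (monom P a 0) = monom P (g a) 0" if "a \<in> carrier R" for a
    using H(2)[OF that, of 0] g(1)[OF that] by simp
  moreover have "H indet = s"
    using H(2)[of \<one> 1] s g by simp
  ultimately show ?thesis using H(1) unfolding s_def by blast
qed

text \<open>The automorphism determined by \<open>g\<close> and \<open>t \<mapsto> c t + r\<close> is inverted by the homomorphism
  determined by \<open>g\<inverse>\<close> and \<open>t \<mapsto> c\<inverse> t - c\<inverse> r\<close>.\<close>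

lemma triangular_aut_exists:
  assumes g: "g \<in> alg_aut R iota" and c: "c \<noteq> 0"
  shows "\<exists>H\<in>alg_aut P iotaP. (\<forall>a\<in>carrier R. H (monom P a 0) = monom P (g a) 0)
     \<and> H indet = monom P (iota c) 1 \<oplus>\<^bsub>P\<^esub> iotaP r"
proof -
  define g' where "g' = inv_into (carrier R) g"
  have g_iso: "g \<in> ring_iso R R" using g by (simp add: alg_aut_def)
  then have g'_iso: "g' \<in> ring_iso R R"
    unfolding g'_def by (rule ring_iso_set_sym[OF R.ring_axioms])
  have hom: "g \<in> ring_hom R R" "g' \<in> ring_hom R R" using g_iso g'_iso by (auto simp: ring_iso_def)
  have bij: "bij_betw g (carrier R) (carrier R)" using g_iso by (auto simp: ring_iso_def)
  have gg': "g' (g a) = a" "g (g' a) = a" "g a \<in> carrier R" "g' a \<in> carrier R"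
    if "a \<in> carrier R" for a
    using bij that hom unfolding g'_def
    by (auto simp: bij_betw_inv_into_left bij_betw_inv_into_right ring_hom_closed)
  have g_iota: "g (iota d) = iota d" for d
  proof -
    have "g (iota d \<otimes> \<one>) = iota d \<otimes> g \<one>" using g R.one_closed unfolding alg_aut_def by blast
    then show ?thesis using ring_hom_one[OF hom(1)] by simp
  qed
  then have g'_iota: "g' (iota d) = iota d" for d using gg'(1) by (metis iota_closed)
  obtain H where H: "H \<in> ring_hom P P" "\<And>a. a\<in>carrier R \<Longrightarrow> H (monom P a 0) = monom P (g a) 0"
    "H indet = monom P (iota c) 1 \<oplus>\<^bsub>P\<^esub> iotaP r"
    using triangular_hom_exists[OF hom(1), of c r] by blast
  obtain H' where H': "H' \<in> ring_hom P P" "\<And>a. a\<in>carrier R \<Longrightarrow> H' (monom P a 0) = monom P (g' a) 0"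
    "H' indet = monom P (iota (inverse c)) 1 \<oplus>\<^bsub>P\<^esub> iotaP (- (inverse c * r))"
    using triangular_hom_exists[OF hom(2), of "inverse c" "- (inverse c * r)"] by blast
  have lin: "F (monom P (iota d) 1 \<oplus>\<^bsub>P\<^esub> iotaP e) = iotaP d \<otimes>\<^bsub>P\<^esub> F indet \<oplus>\<^bsub>P\<^esub> iotaP e"
    if "F \<in> ring_hom P P" "\<And>d. F (iotaP d) = iotaP d" for F d e
  proof -
    have "monom P (iota d) 1 = iotaP d \<otimes>\<^bsub>P\<^esub> indet"
      using const_mult_monom[of "iota d" \<one> 1] by simp
    moreover have "F (iotaP d \<otimes>\<^bsub>P\<^esub> indet \<oplus>\<^bsub>P\<^esub> iotaP e) = F (iotaP d) \<otimes>\<^bsub>P\<^esub> F indet \<oplus>\<^bsub>P\<^esub> F (iotaP e)"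
      by (simp only: ring_hom_add[OF that(1)] ring_hom_mult[OF that(1)] monom_closed iota_closed
          R.one_closed UP_mult_closed)
    ultimately show ?thesis by (simp only: that(2))
  qed
  have affine: "iotaP d \<otimes>\<^bsub>P\<^esub> (monom P (iota d') 1 \<oplus>\<^bsub>P\<^esub> iotaP e') \<oplus>\<^bsub>P\<^esub> iotaP e
      = monom P (iota (d * d')) 1 \<oplus>\<^bsub>P\<^esub> iotaP (d * e' + e)" for d d' e e'
    by (simp only: P.r_distr const_mult_monom const_mult iota_mult iota_add P.a_assoc monom_add
        monom_closed iota_closed R.m_closed)
  have comp: "F (F' p) = p"
    if "F \<in> ring_hom P P" "F' \<in> ring_hom P P"
      "\<And>a. a \<in> carrier R \<Longrightarrow> F (F' (monom P a 0)) = monom P a 0" "F (F' indet) = indet" "p \<in> carrier P"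
    for F F' p
  proof -
    have "(\<lambda>p. p) \<in> ring_hom P P" by (auto intro: ring_hom_memI)
    from hom_eqI[OF ring_hom_trans[OF that(2,1)] this] show ?thesis
      using that(3-5) by simp
  qed
  have "H (H' indet) = iotaP (inverse c) \<otimes>\<^bsub>P\<^esub> (monom P (iota c) 1 \<oplus>\<^bsub>P\<^esub> iotaP r) \<oplus>\<^bsub>P\<^esub> iotaP (- (inverse c * r))"
    unfolding H'(3) by (subst lin[OF H(1)]) (simp_all only: H g_iota iota_closed)
  then have HH': "H (H' indet) = indet" unfolding affine using c by (simp add: iota_one iota_zero)
  have "H' (H indet) = iotaP c \<otimes>\<^bsub>P\<^esub> (monom P (iota (inverse c)) 1 \<oplus>\<^bsub>P\<^esub> iotaP (- (inverse c * r))) \<oplus>\<^bsub>P\<^esub> iotaP r"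
    unfolding H(3) by (subst lin[OF H'(1)]) (simp_all only: H' g'_iota iota_closed)
  moreover have "c * - (inverse c * r) + r = 0" "c * inverse c = 1" using c by (simp_all add: mult.assoc[symmetric])
  ultimately have "H' (H indet) = indet" unfolding affine by (simp only: iota_one iota_zero) simp
  with HH' have inv: "H (H' p) = p" "H' (H p) = p" if "p \<in> carrier P" for p
    using comp[OF H(1) H'(1)] comp[OF H'(1) H(1)] that by (simp_all add: H(2) H'(2) gg')
  have "bij_betw H (carrier P) (carrier P)"
    by (rule bij_betw_byWitness[of _ H'])
      (use inv ring_hom_closed[OF H(1)] ring_hom_closed[OF H'(1)] in auto)
  then have "H \<in> alg_aut P iotaP"
    using H g_iota by (intro alg_autI) auto
  then show ?thesis using H by blast
qed

end

section \<open>Automorphisms of polynomial extensions\<close>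

text \<open>In \<open>twist_unique\<close> one element \<open>a'\<close> must serve \<open>u\<close>
  and \<open>u'\<close> at once; this expresses that they induce the same twist.
  \<open>normal_generate\<close> says that \<open>A\<close> arises from scalars and nonzero normal
  elements by sums, products and passage to factors of nonzero products. It is phrased as an
  induction principle in order to be applied to the set of elements that an automorphism of
  \<open>A[t]\<close> keeps in \<open>A\<close>.\<close>

locale rigid_algebra = up_algebra R P iota
  for R (structure) and P (structure) and iota :: "'k::field \<Rightarrow> 'a" +
  assumes one_not_zero: "\<one> \<noteq> \<zero>"
    and integral: "a \<in> carrier R \<Longrightarrow> b \<in> carrier R \<Longrightarrow> a \<otimes> b = \<zero> \<Longrightarrow> a = \<zero> \<or> b = \<zero>"
    and twist_unique: "u \<in> carrier R \<Longrightarrow> u' \<in> carrier R \<Longrightarrow> u' \<noteq> \<zero> \<Longrightarrow>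
      (\<And>a. a \<in> carrier R \<Longrightarrow> \<exists>a'\<in>carrier R. u \<otimes> a = a' \<otimes> u \<and> u' \<otimes> a = a' \<otimes> u') \<Longrightarrow>
      \<exists>c. u = iota c \<otimes> u'"
    and normal_generate: "S \<subseteq> carrier R \<Longrightarrow> (\<And>c. iota c \<in> S) \<Longrightarrow>
      (\<And>a b. a \<in> S \<Longrightarrow> b \<in> S \<Longrightarrow> a \<oplus> b \<in> S) \<Longrightarrow> (\<And>a b. a \<in> S \<Longrightarrow> b \<in> S \<Longrightarrow> a \<otimes> b \<in> S) \<Longrightarrow>
      (\<And>a b. a \<in> carrier R \<Longrightarrow> b \<in> carrier R \<Longrightarrow> a \<otimes> b \<in> S \<Longrightarrow> a \<otimes> b \<noteq> \<zero> \<Longrightarrow> a \<in> S \<and> b \<in> S) \<Longrightarrow>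
      (\<And>z. z \<in> carrier R \<Longrightarrow> z \<noteq> \<zero> \<Longrightarrow>
         \<forall>a\<in>carrier R. \<exists>a'\<in>carrier R. z \<otimes> a = a' \<otimes> z \<Longrightarrow> z \<in> S) \<Longrightarrow>
      carrier R \<subseteq> S"
begin

section \<open>Degrees and the centre of the polynomial ring\<close>

lemma deg_mult_integral:
  assumes "p \<in> carrier P" "q \<in> carrier P" "p \<noteq> \<zero>\<^bsub>P\<^esub>" "q \<noteq> \<zero>\<^bsub>P\<^esub>"
  shows "deg R (p \<otimes>\<^bsub>P\<^esub> q) = deg R p + deg R q" "p \<otimes>\<^bsub>P\<^esub> q \<noteq> \<zero>\<^bsub>P\<^esub>"
proof -
  let ?m = "deg R p" and ?n = "deg R q"
  have "coeff P (p \<otimes>\<^bsub>P\<^esub> q) (?m + ?n)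
      = (\<Oplus>i\<in>{..?m + ?n}. if ?m = i then coeff P p i \<otimes> coeff P q ?n else \<zero>)"
  proof (subst coeff_mult[OF assms(1,2)], rule R.finsum_cong')
    fix i assume "i \<in> {..?m + ?n}"
    consider "i < ?m" | "i = ?m" | "i > ?m" by linarith
    then show "coeff P p i \<otimes> coeff P q (?m + ?n - i)
        = (if ?m = i then coeff P p i \<otimes> coeff P q ?n else \<zero>)"
      by cases (use assms(1,2) in \<open>auto simp: deg_aboveD\<close>)
  qed (use assms in auto)
  also have "\<dots> = coeff P p ?m \<otimes> coeff P q ?n"
    using assms by (subst R.finsum_singleton) auto
  also have "\<dots> \<noteq> \<zero>"
    using assms integral lcoeff_nonzero2 coeff_closed by blast
  finally have nz: "coeff P (p \<otimes>\<^bsub>P\<^esub> q) (?m + ?n) \<noteq> \<zero>" .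
  then show "p \<otimes>\<^bsub>P\<^esub> q \<noteq> \<zero>\<^bsub>P\<^esub>" using coeff_zero by metis
  have "?m + ?n \<le> deg R (p \<otimes>\<^bsub>P\<^esub> q)" using nz assms by (intro deg_belowI) auto
  then show "deg R (p \<otimes>\<^bsub>P\<^esub> q) = ?m + ?n" using deg_mult_ring[OF assms(1,2)] by simp
qed

lemma indet_not_const: "a \<in> carrier R \<Longrightarrow> indet \<noteq> monom P a 0"
  using one_not_zero coeff_monom[of \<one> 1 1] coeff_monom[of a 0 1] by (metis R.one_closed zero_neq_one)

text \<open>Comparison with constants shows that each coefficient commutes with \<open>R\<close>, so
  it induces the same twist as \<open>\<one>\<close>, namely \<open>a' = a\<close>, and uniqueness
  of twists applies.\<close>

lemma center_coeff:
  assumes p: "p \<in> carrier P" and "\<And>q. q \<in> carrier P \<Longrightarrow> p \<otimes>\<^bsub>P\<^esub> q = q \<otimes>\<^bsub>P\<^esub> p"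
  shows "\<exists>c. coeff P p n = iota c"
proof -
  have "\<exists>c. coeff P p n = iota c \<otimes> \<one>"
  proof (rule twist_unique)
    fix a assume a: "a \<in> carrier R"
    then have "coeff P p n \<otimes> a = a \<otimes> coeff P p n"
      using assms(2)[of "monom P a 0"] p coeff_mult_const coeff_const_mult by (metis monom_closed)
    then show "\<exists>a'\<in>carrier R. coeff P p n \<otimes> a = a' \<otimes> coeff P p n \<and> \<one> \<otimes> a = a' \<otimes> \<one>"
      using a by auto
  qed (use p one_not_zero in auto)
  then show ?thesis by simp
qed

lemma scalar_coeffs_central:
  assumes p: "p \<in> carrier P" and "\<And>n. coeff P p n = iota (c n)" and q: "q \<in> carrier P"
  shows "p \<otimes>\<^bsub>P\<^esub> q = q \<otimes>\<^bsub>P\<^esub> p"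
  using q
proof (induction rule: UP_induct)
  case (monom a n)
  have const: "p \<otimes>\<^bsub>P\<^esub> monom P a 0 = monom P a 0 \<otimes>\<^bsub>P\<^esub> p"
    using p monom assms(2)
    by (intro up_eqI) (simp_all only: coeff_const_mult coeff_mult_const iota_central monom_closed UP_mult_closed)
  have pow: "p \<otimes>\<^bsub>P\<^esub> monom P \<one> n = monom P \<one> n \<otimes>\<^bsub>P\<^esub> p" for n
  proof (induction n)
    case (Suc n)
    have "p \<otimes>\<^bsub>P\<^esub> (monom P \<one> n \<otimes>\<^bsub>P\<^esub> indet) = monom P \<one> n \<otimes>\<^bsub>P\<^esub> (p \<otimes>\<^bsub>P\<^esub> indet)"
      using p Suc by (metis P.m_assoc R.one_closed monom_closed)
    also have "\<dots> = (monom P \<one> n \<otimes>\<^bsub>P\<^esub> indet) \<otimes>\<^bsub>P\<^esub> p"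
      using p indet_central[OF p] by (metis P.m_assoc R.one_closed monom_closed)
    finally show ?case unfolding monom_one_Suc .
  qed (use p in simp)
  have "monom P a n = monom P a 0 \<otimes>\<^bsub>P\<^esub> monom P \<one> n"
    using monom const_mult_monom[of a \<one> n] by simp
  then show ?case using const pow[of n] p monom by (metis P.m_assoc R.one_closed monom_closed)
qed (use p in \<open>simp add: P.l_distr P.r_distr\<close>)

lemma central_const:
  assumes "p \<in> carrier P" "\<And>q. q \<in> carrier P \<Longrightarrow> p \<otimes>\<^bsub>P\<^esub> q = q \<otimes>\<^bsub>P\<^esub> p" "deg R p = 0"
  shows "\<exists>c. p = iotaP c"
  using center_coeff[OF assms(1,2)] deg_zero_impl_monom[OF assms(1,3)] by metis

lemma iso_central:
  assumes "h \<in> ring_iso P P" "p \<in> carrier P" "\<And>q. q \<in> carrier P \<Longrightarrow> p \<otimes>\<^bsub>P\<^esub> q = q \<otimes>\<^bsub>P\<^esub> p"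
    and "q \<in> carrier P"
  shows "h p \<otimes>\<^bsub>P\<^esub> q = q \<otimes>\<^bsub>P\<^esub> h p"
proof -
  have bij: "bij_betw h (carrier P) (carrier P)" and hom: "h \<in> ring_hom P P"
    using assms(1) by (auto simp: ring_iso_def)
  obtain q' where q': "q' \<in> carrier P" "h q' = q"
    using bij_betw_imp_surj_on[OF bij] assms(4) by (metis imageE)
  then show ?thesis
    using ring_hom_mult[OF hom assms(2) q'(1)] ring_hom_mult[OF hom q'(1) assms(2)] assms(3)[OF q'(1)]
    by simp
qed

text \<open>A factorisation of \<open>h z\<close> into a scalar polynomial and an element of
  \<open>R\<close> is pulled back along the inverse automorphism. Going back is essential: in
  \<open>h z\<close> itself nothing bounds the degree of the scalar factor, whereas \<open>z\<close>
  has degree \<open>0\<close>.\<close>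

lemma aut_normal_const:
  assumes h: "h \<in> alg_aut P iotaP" and z: "z \<in> carrier R" "z \<noteq> \<zero>"
    and normal: "\<forall>a\<in>carrier R. \<exists>a'\<in>carrier R. z \<otimes> a = a' \<otimes> z"
  shows "\<exists>w\<in>carrier R. h (monom P z 0) = monom P w 0"
proof -
  define h' where "h' = inv_into (carrier P) h"
  have h': "h' \<in> alg_aut P iotaP" unfolding h'_def by (rule alg_aut_inverse[OF h])
  note hD = alg_autD[OF h] and h'D = alg_autD[OF h']
  have hh': "h (h' p) = p" "h' (h p) = p" "h p \<in> carrier P" "h' p \<in> carrier P" if "p \<in> carrier P" for p
    using that hD(3) hD(2) h'D(2) unfolding h'_def
    by (auto simp: bij_betw_inv_into_left bij_betw_inv_into_right ring_hom_closed)
  \<comment> \<open>Normality passes to \<open>P\<close> because \<open>z\<close> can be moved past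
    each monomial separately and the replacements can be added up.\<close>
  have normalP: "\<exists>q\<in>carrier P. monom P z 0 \<otimes>\<^bsub>P\<^esub> p = q \<otimes>\<^bsub>P\<^esub> monom P z 0" if p: "p \<in> carrier P" for p
    using p
  proof (induction rule: UP_induct)
    case (monom a n)
    obtain a' where a': "a' \<in> carrier R" "z \<otimes> a = a' \<otimes> z" using normal monom by blast
    then show ?case using monom z const_mult_monom[of z a n] monom_mult[of a' z n 0]
      by (intro bexI[of _ "monom P a' n"]) auto
  next
    case (add p q)
    then obtain p' q' where "p' \<in> carrier P" "monom P z 0 \<otimes>\<^bsub>P\<^esub> p = p' \<otimes>\<^bsub>P\<^esub> monom P z 0"
      "q' \<in> carrier P" "monom P z 0 \<otimes>\<^bsub>P\<^esub> q = q' \<otimes>\<^bsub>P\<^esub> monom P z 0" by blast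
    then show ?case using add(1,2) z
      by (intro bexI[of _ "p' \<oplus>\<^bsub>P\<^esub> q'"]) (simp_all add: P.l_distr P.r_distr)
  qed
  define u where "u = h (monom P z 0)"
  have u: "u \<in> carrier P" using hh'(3) z by (simp add: u_def)
  have zP: "monom P z 0 \<in> carrier P" "monom P z 0 \<noteq> \<zero>\<^bsub>P\<^esub>"
    using z const_inj[of z \<zero>] by auto
  have u_nz: "u \<noteq> \<zero>\<^bsub>P\<^esub>"
    using zP hh'(2)[OF zP(1)] ring_hom_zero[OF h'D(2) P.ring_axioms P.ring_axioms] u_def by metis
  \<comment> \<open>Multiplication by a nonzero constant keeps the degree of \<open>u\<close>, so
    the element \<open>b\<close> with \<open>u a = b u\<close> has degree \<open>0\<close> and acts
    on every coefficient as the same \<open>a'\<close>. Degrees add for nonzero factors only, hence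
    the separate case \<open>a = 0\<close>.\<close>
  have twist: "\<exists>a'\<in>carrier R. \<forall>k. coeff P u k \<otimes> a = a' \<otimes> coeff P u k" if a: "a \<in> carrier R" for a
  proof (cases "a = \<zero>")
    case True
    then show ?thesis using u by (intro bexI[of _ \<zero>]) auto
  next
    case False
    have aP: "monom P a 0 \<in> carrier P" "monom P a 0 \<noteq> \<zero>\<^bsub>P\<^esub>" using a False const_inj[of a \<zero>] by auto
    obtain q where q: "q \<in> carrier P" "monom P z 0 \<otimes>\<^bsub>P\<^esub> h' (monom P a 0) = q \<otimes>\<^bsub>P\<^esub> monom P z 0"
      using normalP[of "h' (monom P a 0)"] hh'(4)[OF aP(1)] by blast
    define b where "b = h q"
    have b: "b \<in> carrier P" using hh'(3) q by (simp add: b_def)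
    have eq: "u \<otimes>\<^bsub>P\<^esub> monom P a 0 = b \<otimes>\<^bsub>P\<^esub> u"
      using arg_cong[OF q(2), of h] hh'(1)[OF aP(1)] unfolding b_def u_def
      by (simp only: ring_hom_mult[OF hD(2)] zP(1) q(1) hh'(4) aP(1))
    have "u \<otimes>\<^bsub>P\<^esub> monom P a 0 \<noteq> \<zero>\<^bsub>P\<^esub>" by (rule deg_mult_integral(2)[OF u aP(1) u_nz aP(2)])
    then have "b \<noteq> \<zero>\<^bsub>P\<^esub>" using eq u by auto
    then have "deg R b + deg R u = deg R u + 0"
      using deg_mult_integral(1)[OF b u _ u_nz] deg_mult_integral(1)[OF u aP(1) u_nz aP(2)] eq a by simp
    then obtain a' where a': "a' \<in> carrier R" "b = monom P a' 0" using const_iff_deg_0[OF b] by auto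
    have "coeff P u k \<otimes> a = a' \<otimes> coeff P u k" for k
      using eq a' a u coeff_mult_const coeff_const_mult by metis
    then show ?thesis using a' by blast
  qed
  define w where "w = coeff P u (deg R u)"
  have w: "w \<in> carrier R" "w \<noteq> \<zero>" using u u_nz lcoeff_nonzero2 by (auto simp: w_def)
  have "\<exists>c. coeff P u k = iota c \<otimes> w" for k
  proof (rule twist_unique)
    show "\<exists>a'\<in>carrier R. coeff P u k \<otimes> a = a' \<otimes> coeff P u k \<and> w \<otimes> a = a' \<otimes> w" if "a \<in> carrier R" for a
      using twist[OF that] unfolding w_def by blast
  qed (use u w in auto)
  then obtain c where c: "\<And>k. coeff P u k = iota (c k) \<otimes> w" by metis
  \<comment> \<open>Cutting the scalars off above the degree of \<open>u\<close> makes the support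
    of \<open>f\<close> finite without an appeal to injectivity of \<open>iota\<close>.\<close>
  define c' where "c' k = (if k \<le> deg R u then c k else 0)" for k
  have c': "coeff P u k = iota (c' k) \<otimes> w" for k
    using c deg_aboveD[OF _ u, of k] w by (auto simp: c'_def iota_zero)
  obtain f where f: "f \<in> carrier P" "\<And>k. coeff P f k = iota (c' k)"
    using ex_poly_coeff[of "\<lambda>k. iota (c' k)" "deg R u"] by (auto simp: c'_def iota_zero)
  have u_eq: "u = f \<otimes>\<^bsub>P\<^esub> monom P w 0"
    using u f w c' by (intro up_eqI) (simp_all only: coeff_mult_const monom_closed UP_mult_closed)
  have wP: "monom P w 0 \<in> carrier P" using w by simp
  define f' where "f' = h' f"
  have f': "f' \<in> carrier P" using f hh' by (simp add: f'_def)
  have f'_central: "f' \<otimes>\<^bsub>P\<^esub> q = q \<otimes>\<^bsub>P\<^esub> f'" if "q \<in> carrier P" for q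
    unfolding f'_def by (rule iso_central[OF h'D(1) f(1) scalar_coeffs_central[OF f] that])
  \<comment> \<open>The left side has degree \<open>0\<close>, so both factors have; a central
    element of degree \<open>0\<close> is a scalar.\<close>
  have z_eq: "monom P z 0 = f' \<otimes>\<^bsub>P\<^esub> h' (monom P w 0)"
    using arg_cong[OF u_eq, of h'] f wP zP(1) hh'(2)
    by (simp add: u_def f'_def ring_hom_mult[OF h'D(2)])
  have "f' \<noteq> \<zero>\<^bsub>P\<^esub>" "h' (monom P w 0) \<noteq> \<zero>\<^bsub>P\<^esub>" using z_eq zP(2) P.r_null[OF f'] P.l_null[OF hh'(4)[OF wP]] by metis+
  then have "deg R f' + deg R (h' (monom P w 0)) = 0"
    using deg_mult_integral(1)[OF f' hh'(4)[OF wP]] z_eq z by (metis deg_const)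
  then obtain d where "f' = iotaP d" using central_const[OF f' f'_central] by auto
  then have "f = iotaP d" using hD(4)[of d] hh'(1)[OF f(1)] by (simp add: f'_def)
  then show ?thesis using u_eq w const_mult[of "iota d" w] unfolding u_def by (intro bexI[of _ "iota d \<otimes> w"]) auto
qed

text \<open>The elements with constant image satisfy all closure conditions of
  \<open>normal_generate\<close>. Closure under factors is a matter of degrees: if a nonzero product
  has an image of degree \<open>0\<close>, so have its factors.\<close>

lemma aut_const:
  assumes h: "h \<in> alg_aut P iotaP" and a: "a \<in> carrier R"
  shows "\<exists>b\<in>carrier R. h (monom P a 0) = monom P b 0"
proof -
  note hD = alg_autD[OF h]
  define S where "S = {a \<in> carrier R. \<exists>b\<in>carrier R. h (monom P a 0) = monom P b 0}"
  have h0: "h p \<noteq> \<zero>\<^bsub>P\<^esub>" if "p \<in> carrier P" "p \<noteq> \<zero>\<^bsub>P\<^esub>" for p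
    using that hD(3) ring_hom_zero[OF hD(2) P.ring_axioms P.ring_axioms]
    by (metis P.zero_closed bij_betw_def inj_on_def)
  have "carrier R \<subseteq> S"
  proof (rule normal_generate)
    show "iota c \<in> S" for c using hD(4)[of c] unfolding S_def by (auto intro!: bexI[of _ "iota c"])
    show "a \<oplus> b \<in> S" if ab: "a \<in> S" "b \<in> S" for a b
    proof -
      obtain a' b' where "a' \<in> carrier R" "h (monom P a 0) = monom P a' 0"
        "b' \<in> carrier R" "h (monom P b 0) = monom P b' 0" using ab unfolding S_def by blast
      then show ?thesis using ab
        by (auto simp: S_def ring_hom_add[OF hD(2)] intro!: bexI[of _ "a' \<oplus> b'"])
    qed
    show "a \<otimes> b \<in> S" if ab: "a \<in> S" "b \<in> S" for a b
    proof -
      obtain a' b' where "a' \<in> carrier R" "h (monom P a 0) = monom P a' 0"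
        "b' \<in> carrier R" "h (monom P b 0) = monom P b' 0" using ab unfolding S_def by blast
      then show ?thesis using ab
        by (auto simp: S_def ring_hom_mult[OF hD(2)] const_mult[symmetric] intro!: bexI[of _ "a' \<otimes> b'"])
    qed
    show "a \<in> S \<and> b \<in> S" if ab: "a \<in> carrier R" "b \<in> carrier R" "a \<otimes> b \<in> S" "a \<otimes> b \<noteq> \<zero>" for a b
    proof -
      have P: "monom P a 0 \<in> carrier P" "monom P b 0 \<in> carrier P" "monom P a 0 \<noteq> \<zero>\<^bsub>P\<^esub>" "monom P b 0 \<noteq> \<zero>\<^bsub>P\<^esub>"
        using ab const_inj[of a \<zero>] const_inj[of b \<zero>] by auto
      note hP = ring_hom_closed[OF hD(2) P(1)] ring_hom_closed[OF hD(2) P(2)]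
      obtain d where d: "d \<in> carrier R" "h (monom P (a \<otimes> b) 0) = monom P d 0" using ab by (auto simp: S_def)
      have "h (monom P a 0) \<otimes>\<^bsub>P\<^esub> h (monom P b 0) = monom P d 0"
        using d ring_hom_mult[OF hD(2) P(1,2)] const_mult[OF ab(1,2)] by simp
      then have "deg R (h (monom P a 0)) + deg R (h (monom P b 0)) = 0"
        using deg_mult_integral(1)[OF hP h0[OF P(1,3)] h0[OF P(2,4)]] d by simp
      then show ?thesis using const_iff_deg_0[OF hP(1)] const_iff_deg_0[OF hP(2)] ab by (auto simp: S_def)
    qed
    show "z \<in> S" if "z \<in> carrier R" "z \<noteq> \<zero>" "\<forall>a\<in>carrier R. \<exists>a'\<in>carrier R. z \<otimes> a = a' \<otimes> z" for z
      using aut_normal_const[OF h that] that by (auto simp: S_def)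
  qed (auto simp: S_def)
  with a show ?thesis by (auto simp: S_def)
qed

text \<open>Being central, \<open>h(t)\<close> has scalar coefficients, but this does not bound its
  degree. The bound comes from the inverse \<open>h'\<close>: write \<open>h(t) = c 0 + t f1\<close>
  and pull back to \<open>t - c 0 = h'(t) h'(f1)\<close>. The left side is linear and
  \<open>h'(t)\<close> is not constant, so \<open>h'(f1)\<close>, and with it \<open>f1\<close>, is
  constant.\<close>

lemma aut_indet:
  assumes h: "h \<in> alg_aut P iotaP"
  shows "\<exists>c r. c \<noteq> 0 \<and> h indet = monom P (iota c) 1 \<oplus>\<^bsub>P\<^esub> iotaP r"
proof -
  define h' where "h' = inv_into (carrier P) h"
  have h': "h' \<in> alg_aut P iotaP" unfolding h'_def by (rule alg_aut_inverse[OF h])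
  note hD = alg_autD[OF h] and h'D = alg_autD[OF h']
  have hh': "h (h' p) = p" "h' (h p) = p" "h p \<in> carrier P" "h' p \<in> carrier P" if "p \<in> carrier P" for p
    using that hD(3) hD(2) h'D(2) unfolding h'_def
    by (auto simp: bij_betw_inv_into_left bij_betw_inv_into_right ring_hom_closed)
  define f where "f = h indet"
  have t: "indet \<in> carrier P" by simp
  have f: "f \<in> carrier P" using hh'(3)[OF t] by (simp add: f_def)
  have "f \<otimes>\<^bsub>P\<^esub> q = q \<otimes>\<^bsub>P\<^esub> f" if "q \<in> carrier P" for q
    unfolding f_def by (rule iso_central[OF hD(1) t indet_central that])
  then have "\<exists>c. coeff P f n = iota c" for n by (rule center_coeff[OF f])
  then obtain c where c: "\<And>n. coeff P f n = iota (c n)" by metis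
  \<comment> \<open>Otherwise \<open>t\<close> would be the image under \<open>h\<close> of an
    element of \<open>R\<close>, hence a constant by \<open>aut_const\<close>.\<close>
  have not_const: "h' indet \<noteq> monom P a 0" if "a \<in> carrier R" for a
  proof
    assume "h' indet = monom P a 0"
    then have "indet = h (monom P a 0)" using hh'(1)[OF t] by simp
    then show False using aut_const[OF h that] indet_not_const by auto
  qed
  have "coeff P (f \<oplus>\<^bsub>P\<^esub> iotaP (- c 0)) 0 = \<zero>"
    using f c iota_add[of "c 0" "- c 0"] by (simp add: iota_zero)
  then obtain f1 where f1: "f1 \<in> carrier P" "f \<oplus>\<^bsub>P\<^esub> iotaP (- c 0) = indet \<otimes>\<^bsub>P\<^esub> f1"
    "\<And>n. coeff P f1 n = coeff P (f \<oplus>\<^bsub>P\<^esub> iotaP (- c 0)) (Suc n)"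
    using indet_dvd[of "f \<oplus>\<^bsub>P\<^esub> iotaP (- c 0)"] f monom_closed[OF iota_closed] UP_a_closed by blast
  have eq: "indet \<oplus>\<^bsub>P\<^esub> iotaP (- c 0) = h' indet \<otimes>\<^bsub>P\<^esub> h' f1"
    using arg_cong[OF f1(2), of h'] f f1(1) hh'(2)[OF t] h'D(4)
    by (simp add: ring_hom_add[OF h'D(2)] ring_hom_mult[OF h'D(2)] f_def)
  have "coeff P (indet \<oplus>\<^bsub>P\<^esub> iotaP (- c 0)) 1 = \<one>" by simp
  then have lin_nz: "indet \<oplus>\<^bsub>P\<^esub> iotaP (- c 0) \<noteq> \<zero>\<^bsub>P\<^esub>"
    using one_not_zero coeff_zero[of 1] by metis
  have lin_deg: "deg R (indet \<oplus>\<^bsub>P\<^esub> iotaP (- c 0)) \<le> 1"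
    by (rule deg_aboveI) auto
  have "h' indet \<noteq> \<zero>\<^bsub>P\<^esub>" "h' f1 \<noteq> \<zero>\<^bsub>P\<^esub>" using eq lin_nz P.l_null[OF hh'(4)[OF f1(1)]] P.r_null[OF hh'(4)[OF t]] by metis+
  then have "deg R (h' indet) + deg R (h' f1) \<le> 1"
    using deg_mult_integral(1)[OF hh'(4)[OF t] hh'(4)[OF f1(1)]] eq lin_deg by simp
  moreover have "deg R (h' indet) \<noteq> 0" using const_iff_deg_0[OF hh'(4)[OF t]] not_const by auto
  ultimately have "deg R (h' f1) = 0" by simp
  then obtain b where "b \<in> carrier R" "h' f1 = monom P b 0" using const_iff_deg_0[OF hh'(4)[OF f1(1)]] by auto
  then obtain b' where b': "b' \<in> carrier R" "f1 = monom P b' 0" using aut_const[OF h] hh'(1)[OF f1(1)] by metis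
  have "coeff P f (Suc (Suc n)) = \<zero>" for n
    using f1(3)[of "Suc n"] b' f by simp
  then have high: "coeff P f n = \<zero>" if "n \<noteq> 0" "n \<noteq> 1" for n
    using that by (metis One_nat_def not0_implies_Suc)
  have f_eq: "f = monom P (iota (c 1)) 1 \<oplus>\<^bsub>P\<^esub> iotaP (c 0)"
    using f c high by (intro up_eqI) auto
  have "c 1 \<noteq> 0"
  proof
    assume "c 1 = 0"
    then have "f = iotaP (c 0)" using f_eq by (simp add: iota_zero)
    then have "indet = iotaP (c 0)" using hh'(2)[OF t] h'D(4)[of "c 0"] by (simp add: f_def)
    then show False using indet_not_const[of "iota (c 0)"] by simp
  qed
  then show ?thesis using f_eq unfolding f_def by blast
qed

lemma aut_triangular:
  assumes h: "h \<in> alg_aut P iotaP"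
  shows "\<exists>g\<in>alg_aut R iota. \<exists>c r. c \<noteq> 0 \<and>
      (\<forall>a\<in>carrier R. h (monom P a 0) = monom P (g a) 0) \<and>
      h indet = monom P (iota c) 1 \<oplus>\<^bsub>P\<^esub> iotaP r"
proof -
  note hD = alg_autD[OF h]
  obtain g where g: "\<And>a. a \<in> carrier R \<Longrightarrow> g a \<in> carrier R"
    "\<And>a. a \<in> carrier R \<Longrightarrow> h (monom P a 0) = monom P (g a) 0"
    using aut_const[OF h] by metis
  have g_add: "g (a \<oplus> b) = g a \<oplus> g b" if "a \<in> carrier R" "b \<in> carrier R" for a b
  proof (rule const_inj)
    have "monom P (g (a \<oplus> b)) 0 = h (monom P a 0 \<oplus>\<^bsub>P\<^esub> monom P b 0)"
      using that g(2)[of "a \<oplus> b"] by simp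
    also have "\<dots> = h (monom P a 0) \<oplus>\<^bsub>P\<^esub> h (monom P b 0)"
      using that by (intro ring_hom_add[OF hD(2)]) auto
    also have "\<dots> = monom P (g a \<oplus> g b) 0" using that g by simp
    finally show "monom P (g (a \<oplus> b)) 0 = monom P (g a \<oplus> g b) 0" .
  qed (use that g(1) in auto)
  have g_mult: "g (a \<otimes> b) = g a \<otimes> g b" if "a \<in> carrier R" "b \<in> carrier R" for a b
  proof (rule const_inj)
    have "monom P (g (a \<otimes> b)) 0 = h (monom P a 0 \<otimes>\<^bsub>P\<^esub> monom P b 0)"
      using that g(2)[of "a \<otimes> b"] const_mult[of a b] by simp
    also have "\<dots> = h (monom P a 0) \<otimes>\<^bsub>P\<^esub> h (monom P b 0)"
      using that by (intro ring_hom_mult[OF hD(2)]) auto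
    also have "\<dots> = monom P (g a \<otimes> g b) 0" using that g const_mult[of "g a" "g b"] by simp
    finally show "monom P (g (a \<otimes> b)) 0 = monom P (g a \<otimes> g b) 0" .
  qed (use that g(1) in auto)
  have g_iota: "g (iota c) = iota c" for c
    using const_inj[of "g (iota c)" "iota c"] g[of "iota c"] hD(4)[of c] by simp
  have inj: "inj_on g (carrier R)"
    using hD(3) g(2) const_inj unfolding bij_betw_def inj_on_def by (metis monom_closed)
  \<comment> \<open>Surjectivity comes from \<open>aut_const\<close> for the inverse automorphism,
    which keeps \<open>R\<close> inside \<open>R\<close> as well.\<close>
  have "\<exists>b\<in>carrier R. g b = a" if a: "a \<in> carrier R" for a
  proof -
    obtain b where b: "b \<in> carrier R" "inv_into (carrier P) h (monom P a 0) = monom P b 0"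
      using aut_const[OF alg_aut_inverse[OF h] a] by blast
    then have "h (monom P b 0) = monom P a 0"
      using bij_betw_inv_into_right[OF hD(3), of "monom P a 0"] a by simp
    then show ?thesis using b g a const_inj[of "g b" a] by auto
  qed
  then have "bij_betw g (carrier R) (carrier R)"
    using inj g(1) by (auto simp: bij_betw_def)
  moreover have "g \<in> ring_hom R R"
    using g(1) g_add g_mult g_iota[of 1] by (intro ring_hom_memI) (auto simp: iota_one)
  ultimately have "g \<in> alg_aut R iota"
    using g_mult g_iota by (auto simp: alg_aut_def ring_iso_def)
  then show ?thesis using g aut_indet[OF h] by blast
qed

end

section \<open>Locally nilpotent derivations\<close>

context UP_ring
begin

text \<open>Meant for the image \<open>S\<close> of a ring homomorphism fixing the indeterminate:
  membership of a polynomial reduces to membership of its coefficients.\<close>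

lemma mem_of_const_coeffs:
  assumes q: "q \<in> carrier P" and S: "S \<subseteq> carrier P" "\<one>\<^bsub>P\<^esub> \<in> S" "indet \<in> S"
    "\<And>p q. p \<in> S \<Longrightarrow> q \<in> S \<Longrightarrow> p \<oplus>\<^bsub>P\<^esub> q \<in> S" "\<And>p q. p \<in> S \<Longrightarrow> q \<in> S \<Longrightarrow> p \<otimes>\<^bsub>P\<^esub> q \<in> S"
    and coeffs: "\<And>n. monom P (coeff P q n) 0 \<in> S"
  shows "q \<in> S"
proof -
  have pow: "monom P \<one> n \<in> S" for n
  proof (induction n)
    case (Suc n)
    then show ?case using S(3,5) unfolding monom_one_Suc by blast
  qed (use S(2) in simp)
  have mon: "monom P (coeff P q n) n \<in> S" for n
    using S(5)[OF coeffs[of n] pow[of n]] q const_mult_monom[of "coeff P q n" \<one> n] by simp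
  have "(\<Oplus>\<^bsub>P\<^esub>i\<in>{..k}. monom P (coeff P q i) i) \<in> S" for k :: nat
  proof (induction k)
    case 0
    have "(\<Oplus>\<^bsub>P\<^esub>i\<in>{..0}. monom P (coeff P q i) i) = monom P (coeff P q 0) 0"
      using q by (subst P.finsum_0) auto
    then show ?case using mon[of 0] by simp
  next
    case (Suc k)
    have "(\<Oplus>\<^bsub>P\<^esub>i\<in>{..Suc k}. monom P (coeff P q i) i)
       = monom P (coeff P q (Suc k)) (Suc k) \<oplus>\<^bsub>P\<^esub> (\<Oplus>\<^bsub>P\<^esub>i\<in>{..k}. monom P (coeff P q i) i)"
      using q by (subst P.finsum_Suc) auto
    with Suc show ?case using S(4) mon by simp
  qed
  then show ?thesis using up_repr[OF q] by metis
qed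

end

section \<open>Exponentials of derivations\<close>

context up_algebra
begin

text \<open>The polynomials \<open>exp (t d) a\<close>, characterised by the differential equation \<open>e' = d e\<close>; in
  characteristic \<open>0\<close> they are determined by their constant coefficient \<open>a\<close>.\<close>

definition exp_poly :: "('a \<Rightarrow> 'a) \<Rightarrow> (nat \<Rightarrow> 'a) \<Rightarrow> bool" where
  "exp_poly d e \<longleftrightarrow> e \<in> carrier P \<and> (\<forall>j. iota (of_nat (Suc j)) \<otimes> coeff P e (Suc j) = d (coeff P e j))"

lemma iota_cancel:
  assumes "c \<noteq> 0" "a \<in> carrier R" "b \<in> carrier R" "iota c \<otimes> a = iota c \<otimes> b"
  shows "a = b"
proof -
  have "iota (inverse c) \<otimes> (iota c \<otimes> x) = x" if "x \<in> carrier R" for x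
    using that assms(1) iota_mult[of "inverse c" c]
    by (metis R.l_one R.m_assoc iota_closed iota_one left_inverse)
  then show ?thesis using assms(2-4) by metis
qed

lemma exp_poly_unique:
  assumes char: "\<And>m::nat. m > 0 \<Longrightarrow> (of_nat m :: 'k) \<noteq> 0"
    and "exp_poly d e" "exp_poly d f" "coeff P e 0 = coeff P f 0"
  shows "e = f"
proof (rule up_eqI)
  show "coeff P e n = coeff P f n" for n
  proof (induction n)
    case (Suc n)
    then have eq: "iota (of_nat (Suc n)) \<otimes> coeff P e (Suc n) = iota (of_nat (Suc n)) \<otimes> coeff P f (Suc n)"
      using assms(2,3) by (simp only: exp_poly_def)
    have "e \<in> carrier P" "f \<in> carrier P" using assms(2,3) by (auto simp: exp_poly_def)
    then show ?case using iota_cancel[OF char[of "Suc n"] _ _ eq] by simp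
  qed (rule assms(4))
qed (use assms(2,3) in \<open>auto simp: exp_poly_def\<close>)

context
  fixes d :: "'a \<Rightarrow> 'a"
  assumes d: "alg_derivation R iota d"
begin

lemma derivation_closed: "a \<in> carrier R \<Longrightarrow> d a \<in> carrier R"
  and derivation_add: "a \<in> carrier R \<Longrightarrow> b \<in> carrier R \<Longrightarrow> d (a \<oplus> b) = d a \<oplus> d b"
  and derivation_mult: "a \<in> carrier R \<Longrightarrow> b \<in> carrier R \<Longrightarrow> d (a \<otimes> b) = d a \<otimes> b \<oplus> a \<otimes> d b"
  and derivation_scale: "a \<in> carrier R \<Longrightarrow> d (iota c \<otimes> a) = iota c \<otimes> d a"
  using d unfolding alg_derivation_def by blast+

lemma derivation_zero: "d \<zero> = \<zero>"
  using derivation_scale[of \<zero> 0] derivation_closed[of \<zero>] by (simp add: iota_zero)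

lemma derivation_iota: "d (iota c) = \<zero>"
proof -
  have "d \<one> = d \<one> \<oplus> d \<one>"
    using derivation_mult[of \<one> \<one>] derivation_closed[of \<one>] by simp
  then have "d \<one> = \<zero>" using derivation_closed[of \<one>] R.add.l_cancel_one'[of "d \<one>" "d \<one>"] by blast
  then show ?thesis using derivation_scale[of \<one> c] by simp
qed

lemma derivation_funpow_closed: "a \<in> carrier R \<Longrightarrow> (d ^^ k) a \<in> carrier R"
  by (induction k) (auto intro: derivation_closed)

lemma derivation_funpow_scale: "a \<in> carrier R \<Longrightarrow> (d ^^ k) (iota c \<otimes> a) = iota c \<otimes> (d ^^ k) a"
  by (induction k) (auto simp: derivation_scale derivation_funpow_closed)

lemma derivation_funpow_zero: "(d ^^ k) a = \<zero> \<Longrightarrow> j \<ge> k \<Longrightarrow> (d ^^ j) a = \<zero>"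
  by (induction j) (auto simp: le_Suc_eq derivation_zero)

lemma derivation_finsum:
  assumes "\<And>i. f i \<in> carrier R"
  shows "d (\<Oplus>i\<in>{..k::nat}. f i) = (\<Oplus>i\<in>{..k}. d (f i))"
proof (induction k)
  case (Suc k)
  then show ?case using assms derivation_closed
    by (simp add: derivation_add Pi_def)
qed (use assms derivation_closed in simp)

lemma exp_poly_add:
  assumes "exp_poly d e" "exp_poly d f"
  shows "exp_poly d (e \<oplus>\<^bsub>P\<^esub> f)"
  using assms by (auto simp: exp_poly_def derivation_add R.r_distr simp del: of_nat_Suc)

text \<open>The product rule on coefficients: in the Cauchy product of index \<open>Suc m\<close>
  the factor \<open>Suc m\<close> splits as \<open>i + (Suc m - i)\<close>, one summand for the
  derivative of each factor.\<close>

lemma exp_poly_mult: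
  assumes "exp_poly d e" "exp_poly d f"
  shows "exp_poly d (e \<otimes>\<^bsub>P\<^esub> f)"
proof -
  have e: "e \<in> carrier P" and f: "f \<in> carrier P"
    and e': "\<And>j. d (coeff P e j) = iota (of_nat (Suc j)) \<otimes> coeff P e (Suc j)"
    and f': "\<And>j. d (coeff P f j) = iota (of_nat (Suc j)) \<otimes> coeff P f (Suc j)"
    using assms unfolding exp_poly_def by auto
  have "iota (of_nat (Suc m)) \<otimes> coeff P (e \<otimes>\<^bsub>P\<^esub> f) (Suc m) = d (coeff P (e \<otimes>\<^bsub>P\<^esub> f) m)" for m
  proof -
    define G where "G i = coeff P e i \<otimes> coeff P f (Suc m - i)" for i
    have G [simp]: "G i \<in> carrier R" for i using e f by (simp add: G_def)
    \<comment> \<open>Both sums extend to \<open>{..Suc m}\<close> because the added term, at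
      \<open>i = 0\<close> and at \<open>i = Suc m\<close> respectively, has scalar
      \<open>0\<close>.\<close>
    have sum1: "(\<Oplus>i\<in>{..m}. iota (of_nat (Suc i)) \<otimes> G (Suc i)) = (\<Oplus>i\<in>{..Suc m}. iota (of_nat i) \<otimes> G i)"
      by (subst R.finsum_Suc2) (auto simp: iota_zero)
    have sum2: "(\<Oplus>i\<in>{..m}. iota (of_nat (Suc m - i)) \<otimes> G i) = (\<Oplus>i\<in>{..Suc m}. iota (of_nat (Suc m - i)) \<otimes> G i)"
      by (subst R.finsum_Suc) (auto simp: iota_zero)
    have "d (coeff P (e \<otimes>\<^bsub>P\<^esub> f) m) = (\<Oplus>i\<in>{..m}. d (coeff P e i \<otimes> coeff P f (m - i)))"
      using e f by (simp only: coeff_mult) (rule derivation_finsum, simp)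
    also have "\<dots> = (\<Oplus>i\<in>{..m}. iota (of_nat (Suc i)) \<otimes> G (Suc i) \<oplus> iota (of_nat (Suc m - i)) \<otimes> G i)"
    proof (rule R.finsum_cong')
      fix i assume "i \<in> {..m}"
      then have i: "Suc m - i = Suc (m - i)" by auto
      show "d (coeff P e i \<otimes> coeff P f (m - i))
          = iota (of_nat (Suc i)) \<otimes> G (Suc i) \<oplus> iota (of_nat (Suc m - i)) \<otimes> G i"
        using e f unfolding G_def i
        by (simp only: derivation_mult coeff_closed e' f' iota_pull R.m_assoc iota_closed diff_Suc_Suc)
    qed auto
    also have "\<dots> = (\<Oplus>i\<in>{..Suc m}. iota (of_nat i) \<otimes> G i \<oplus> iota (of_nat (Suc m - i)) \<otimes> G i)"
      by (subst (1 2) R.finsum_addf) (auto simp only: sum1 sum2 intro!: R.m_closed iota_closed G)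
    also have "\<dots> = (\<Oplus>i\<in>{..Suc m}. iota (of_nat (Suc m)) \<otimes> G i)"
    proof (rule R.finsum_cong')
      fix i assume "i \<in> {..Suc m}"
      then have "(of_nat (Suc m) :: 'k) = of_nat i + of_nat (Suc m - i)"
        by (simp only: of_nat_add[symmetric]) simp
      then show "iota (of_nat i) \<otimes> G i \<oplus> iota (of_nat (Suc m - i)) \<otimes> G i = iota (of_nat (Suc m)) \<otimes> G i"
        by (simp only: iota_add R.l_distr iota_closed G)
    qed auto
    also have "\<dots> = iota (of_nat (Suc m)) \<otimes> (\<Oplus>i\<in>{..Suc m}. G i)"
      by (rule R.finsum_rdistr[symmetric]) auto
    also have "\<dots> = iota (of_nat (Suc m)) \<otimes> coeff P (e \<otimes>\<^bsub>P\<^esub> f) (Suc m)"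
      using e f by (simp only: coeff_mult G_def)
    finally show ?thesis by (rule sym)
  qed
  then show ?thesis using e f unfolding exp_poly_def by blast
qed

lemma exp_poly_iotaP: "exp_poly d (iotaP c)"
  by (auto simp: exp_poly_def derivation_iota derivation_zero)

end

end

text \<open>\<open>exp (t d)\<close> is a homomorphism because sums and products of solutions of
  \<open>e' = d e\<close> are solutions, and a solution is determined by its constant coefficient.
  Its extension \<open>H\<close> fixes \<open>t\<close> and preserves constant coefficients.
  Injectivity follows from this by dividing by \<open>t\<close>, and surjectivity by induction on
  nilpotency, so no inverse \<open>exp (- t d)\<close> has to be computed.\<close>

lemma (in rigid_algebra) locally_nilpotent_derivation_zero:
  assumes char: "\<And>m::nat. m > 0 \<Longrightarrow> (of_nat m :: 'k) \<noteq> 0"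
    and d: "alg_derivation R iota d" and nil: "locally_nilpotent R d" and a: "a \<in> carrier R"
  shows "d a = \<zero>"
proof -
  note pow_closed = derivation_funpow_closed[OF d] and pow_zero = derivation_funpow_zero[OF d]
    and pow_scale = derivation_funpow_scale[OF d]
  \<comment> \<open>Local nilpotency leaves finitely many nonzero \<open>\<delta> j a\<close>, so
    they are the coefficients of a polynomial; in characteristic \<open>0\<close> the factorials are
    invertible.\<close>
  define \<delta> where "\<delta> j a = iota (inverse (of_nat (fact j))) \<otimes> (d ^^ j) a" for j a
  have \<delta>_closed: "\<delta> j a \<in> carrier R" if "a \<in> carrier R" for j a
    using that pow_closed by (simp add: \<delta>_def)
  have "\<exists>e. exp_poly d e \<and> (\<forall>j. coeff P e j = \<delta> j a)" if a: "a \<in> carrier R" for a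
  proof -
    obtain k where "(d ^^ k) a = \<zero>" using nil a unfolding locally_nilpotent_def by blast
    then have "\<delta> j a = \<zero>" if "j > k" for j using pow_zero[of k a j] that by (simp add: \<delta>_def)
    then obtain e where e: "e \<in> carrier P" "\<And>j. coeff P e j = \<delta> j a"
      using ex_poly_coeff[of "\<lambda>j. \<delta> j a" k] \<delta>_closed[OF a] by blast
    have "iota (of_nat (Suc j)) \<otimes> \<delta> (Suc j) a = d (\<delta> j a)" for j
    proof -
      have "(of_nat (Suc j) :: 'k) * inverse (of_nat (fact (Suc j))) = inverse (of_nat (fact j))"
        using char[of "Suc j"] by (simp only: fact_Suc of_nat_mult inverse_mult_distrib) simp
      then have "iota (inverse (of_nat (fact j))) = iota (of_nat (Suc j)) \<otimes> iota (inverse (of_nat (fact (Suc j))))"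
        by (simp only: iota_mult[symmetric])
      then have "iota (of_nat (Suc j)) \<otimes> \<delta> (Suc j) a = iota (inverse (of_nat (fact j))) \<otimes> (d ^^ Suc j) a"
        unfolding \<delta>_def by (simp only: R.m_assoc iota_closed pow_closed[OF a])
      then show ?thesis unfolding \<delta>_def using derivation_scale[OF d pow_closed[OF a]] by simp
    qed
    then show ?thesis using e unfolding exp_poly_def by metis
  qed
  then obtain \<phi> where \<phi>: "\<And>a. a \<in> carrier R \<Longrightarrow> exp_poly d (\<phi> a)"
    "\<And>a j. a \<in> carrier R \<Longrightarrow> coeff P (\<phi> a) j = \<delta> j a" by metis
  have \<phi>_closed: "\<phi> a \<in> carrier P" if "a \<in> carrier R" for a
    using \<phi>(1)[OF that] by (simp add: exp_poly_def)
  have \<phi>0: "coeff P (\<phi> a) 0 = a" if "a \<in> carrier R" for a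
    using \<phi>(2)[OF that, of 0] that by (simp add: \<delta>_def iota_one)
  have \<phi>_eqI: "\<phi> a = e" if "a \<in> carrier R" "exp_poly d e" "coeff P e 0 = a" for a e
    using exp_poly_unique[OF char \<phi>(1)[OF that(1)] that(2)] that \<phi>0 by simp
  have \<phi>_iota: "\<phi> (iota c) = iotaP c" for c
    by (rule \<phi>_eqI) (simp_all add: exp_poly_iotaP[OF d])
  have \<phi>_hom: "\<phi> \<in> ring_hom R P"
  proof (rule ring_hom_memI)
    fix a b assume ab: "a \<in> carrier R" "b \<in> carrier R"
    show "\<phi> (a \<oplus> b) = \<phi> a \<oplus>\<^bsub>P\<^esub> \<phi> b"
      using ab \<phi>0 \<phi>_closed by (intro \<phi>_eqI exp_poly_add[OF d] \<phi>(1)) auto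
    show "\<phi> (a \<otimes> b) = \<phi> a \<otimes>\<^bsub>P\<^esub> \<phi> b"
      using ab \<phi>0 \<phi>_closed by (intro \<phi>_eqI exp_poly_mult[OF d] \<phi>(1)) auto
  next
    show "\<phi> \<one> = \<one>\<^bsub>P\<^esub>" using \<phi>_iota[of 1] by (simp add: iota_one)
  qed (rule \<phi>_closed)
  have t: "indet \<in> carrier P" by simp
  obtain H where H: "H \<in> ring_hom P P"
    "\<And>a n. a \<in> carrier R \<Longrightarrow> H (monom P a n) = \<phi> a \<otimes>\<^bsub>P\<^esub> indet [^]\<^bsub>P\<^esub> (n::nat)"
    using eval_hom_exists[OF P.ring_axioms \<phi>_hom t] indet_central[OF \<phi>_closed] by metis
  note H_closed = ring_hom_closed[OF H(1)]
  have H_const: "H (monom P a 0) = \<phi> a" if "a \<in> carrier R" for a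
    using H(2)[OF that, of 0] \<phi>_closed[OF that] by simp
  have H_indet: "H indet = indet"
    using H(2)[of \<one> 1] \<phi>_iota[of 1] by (simp add: iota_one)
  have H0: "coeff P (H p) 0 = coeff P p 0" if "p \<in> carrier P" for p
    using that
  proof (induction rule: UP_induct)
    case (monom a n)
    show ?case
    proof (cases n)
      case 0 then show ?thesis using monom H_const \<phi>0 by simp
    next
      case (Suc m)
      have "H (monom P a n) = (\<phi> a \<otimes>\<^bsub>P\<^esub> monom P \<one> m) \<otimes>\<^bsub>P\<^esub> indet"
        using H(2)[OF monom, of n] \<phi>_closed[OF monom] Suc
        by (simp only: indet_pow monom_one_Suc P.m_assoc monom_closed R.one_closed)
      also have "\<dots> = indet \<otimes>\<^bsub>P\<^esub> (\<phi> a \<otimes>\<^bsub>P\<^esub> monom P \<one> m)"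
        using \<phi>_closed[OF monom] by (intro indet_central[symmetric]) simp
      finally show ?thesis using coeff_indet_mult(1)[of "\<phi> a \<otimes>\<^bsub>P\<^esub> monom P \<one> m"] \<phi>_closed[OF monom] monom Suc
        by simp
    qed
  next
    case (add p q)
    then show ?case using H_closed by (simp add: ring_hom_add[OF H(1)])
  qed
  \<comment> \<open>A kernel element has constant coefficient zero, so it is \<open>t q\<close>. As
    \<open>H\<close> fixes \<open>t\<close> and \<open>P\<close> has no zero divisors,
    \<open>q\<close> is in the kernel too, with a smaller bound on its degree.\<close>
  have H_ker: "p = \<zero>\<^bsub>P\<^esub>" if "p \<in> carrier P" "deg R p \<le> N" "H p = \<zero>\<^bsub>P\<^esub>" for p N
    using that
  proof (induction N arbitrary: p)
    case 0
    then have "coeff P p 0 = \<zero>" using H0[of p] by simp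
    then show ?case using deg_zero_impl_monom[of p] 0 by (metis le_zero_eq monom_zero)
  next
    case (Suc N)
    have "coeff P p 0 = \<zero>" using H0[of p] Suc.prems by simp
    then obtain q where q: "q \<in> carrier P" "p = indet \<otimes>\<^bsub>P\<^esub> q" "\<And>n. coeff P q n = coeff P p (Suc n)"
      using indet_dvd Suc.prems(1) by blast
    have "indet \<otimes>\<^bsub>P\<^esub> H q = \<zero>\<^bsub>P\<^esub>" using Suc.prems(3) q H_indet by (simp add: ring_hom_mult[OF H(1)])
    then have "H q = \<zero>\<^bsub>P\<^esub>"
      using deg_mult_integral(2)[OF t H_closed[OF q(1)]] indet_not_const[of \<zero>] by auto
    moreover have "coeff P q n = \<zero>" if "n > N" for n
      using q(3)[of n] deg_aboveD[OF _ Suc.prems(1), of "Suc n"] Suc.prems(2) that by simp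
    then have "deg R q \<le> N" using q(1) by (rule deg_aboveI)
    ultimately have "q = \<zero>\<^bsub>P\<^esub>" using Suc.IH q(1) by blast
    then show ?case using q(2) by simp
  qed
  have inj: "inj_on H (carrier P)"
  proof -
    interpret H: ring_hom_ring P P H
      using P.ring_axioms H(1) by (simp add: ring_hom_ring_def ring_hom_ring_axioms_def)
    have "a_kernel P P H = {\<zero>\<^bsub>P\<^esub>}"
      using H_ker[OF _ order.refl] ring_hom_zero[OF H(1) P.ring_axioms P.ring_axioms] UP_zero_closed
      unfolding a_kernel_def' by blast
    then show ?thesis by (simp only: H.inj_iff_trivial_ker)
  qed
  define S where "S = H ` carrier P"
  have S: "S \<subseteq> carrier P" "\<one>\<^bsub>P\<^esub> \<in> S" "indet \<in> S"
    "\<And>p q. p \<in> S \<Longrightarrow> q \<in> S \<Longrightarrow> p \<oplus>\<^bsub>P\<^esub> q \<in> S" "\<And>p q. p \<in> S \<Longrightarrow> q \<in> S \<Longrightarrow> p \<otimes>\<^bsub>P\<^esub> q \<in> S"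
  proof -
    show "S \<subseteq> carrier P" using H_closed by (auto simp: S_def)
    show "\<one>\<^bsub>P\<^esub> \<in> S" using ring_hom_one[OF H(1)] unfolding S_def by (metis UP_one_closed imageI)
    show "indet \<in> S" using H_indet t unfolding S_def by (metis imageI)
    show "p \<oplus>\<^bsub>P\<^esub> q \<in> S" if "p \<in> S" "q \<in> S" for p q
      using that ring_hom_add[OF H(1), symmetric] UP_a_closed unfolding S_def by fastforce
    show "p \<otimes>\<^bsub>P\<^esub> q \<in> S" if "p \<in> S" "q \<in> S" for p q
      using that ring_hom_mult[OF H(1), symmetric] UP_mult_closed unfolding S_def by fastforce
  qed
  \<comment> \<open>In the step, \<open>\<phi> a - a = t q\<close>, where the coefficients of
    \<open>q\<close> are scalar multiples of \<open>d a\<close>, \<open>d (d a)\<close> and so on,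
    all killed by \<open>d ^^ k\<close>. Hence \<open>q\<close> lies in the image, and so does
    \<open>a = \<phi> a - t q\<close>.\<close>
  have const_S: "monom P a 0 \<in> S" if "a \<in> carrier R" "(d ^^ k) a = \<zero>" for a k
    using that
  proof (induction k arbitrary: a)
    case 0
    then have "H (monom P a 0) = monom P a 0" using H_const[of \<zero>] \<phi>_iota[of 0] by (simp add: iota_zero)
    then show ?case using 0 unfolding S_def by (metis imageI monom_closed)
  next
    case (Suc k)
    note \<phi>a = \<phi>_closed[OF Suc.prems(1)] and minus1 = iota_closed[of "- 1"]
    define p where "p = \<phi> a \<ominus>\<^bsub>P\<^esub> monom P a 0"
    have p: "p \<in> carrier P" "coeff P p 0 = \<zero>" "\<And>n. coeff P p (Suc n) = coeff P (\<phi> a) (Suc n)"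
      using \<phi>a Suc.prems(1) \<phi>0 by (auto simp: p_def R.minus_eq R.r_neg)
    obtain q where q: "q \<in> carrier P" "p = indet \<otimes>\<^bsub>P\<^esub> q" "\<And>n. coeff P q n = coeff P p (Suc n)"
      using indet_dvd[OF p(1,2)] by blast
    have "monom P (coeff P q n) 0 \<in> S" for n
    proof (rule Suc.IH)
      have "(d ^^ k) ((d ^^ Suc n) a) = \<zero>"
        using pow_zero[OF Suc.prems(2), of "k + Suc n"] by (simp only: funpow_add o_apply)
      then show "(d ^^ k) (coeff P q n) = \<zero>"
        using q(3) p(3) \<phi>(2)[OF Suc.prems(1)] pow_scale pow_closed[OF Suc.prems(1), of "Suc n"]
        by (simp add: \<delta>_def)
    qed (rule coeff_closed[OF q(1)])
    then have "q \<in> S" using mem_of_const_coeffs[OF q(1) S] by blast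
    then have "p \<in> S" using S(3,5) q(2) by blast
    moreover have "\<phi> a \<in> S" using H_const[OF Suc.prems(1)] Suc.prems(1) unfolding S_def
      by (metis imageI monom_closed)
    \<comment> \<open>\<open>S\<close> is known to be closed under sums and products, so subtraction
      goes through the scalar \<open>- 1\<close>.\<close>
    moreover have "iotaP (- 1) \<in> S" using H_const[OF minus1] \<phi>_iota[of "- 1"] unfolding S_def
      by (metis imageI monom_closed minus1)
    ultimately have mem: "\<phi> a \<oplus>\<^bsub>P\<^esub> iotaP (- 1) \<otimes>\<^bsub>P\<^esub> p \<in> S" using S(4,5) by blast
    have "iota (- 1) \<oplus> \<one> = \<zero>" by (metis add.left_inverse iota_add iota_one iota_zero)
    then have "iota (- 1) = \<ominus> \<one>" using R.minus_equality[of "iota (- 1)" \<one>] by simp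
    then have "iotaP (- 1) = \<ominus>\<^bsub>P\<^esub> \<one>\<^bsub>P\<^esub>" by simp
    then have "iotaP (- 1) \<otimes>\<^bsub>P\<^esub> p = \<ominus>\<^bsub>P\<^esub> p" using p(1) by (simp add: P.l_minus)
    moreover have "\<phi> a = p \<oplus>\<^bsub>P\<^esub> monom P a 0"
      using \<phi>a Suc.prems(1) by (simp add: p_def a_minus_def P.a_assoc P.l_neg)
    ultimately have "monom P a 0 = \<phi> a \<oplus>\<^bsub>P\<^esub> iotaP (- 1) \<otimes>\<^bsub>P\<^esub> p"
      using p(1) Suc.prems(1) by (metis P.a_comm P.r_neg1 UP_a_closed UP_a_inv_closed monom_closed)
    then show ?case using mem by simp
  qed
  have "monom P b 0 \<in> S" if "b \<in> carrier R" for b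
    using nil that const_S[OF that] unfolding locally_nilpotent_def by blast
  then have "carrier P \<subseteq> S" using mem_of_const_coeffs[OF _ S] coeff_closed by blast
  then have "bij_betw H (carrier P) (carrier P)" using inj S(1) unfolding bij_betw_def S_def by blast
  then have "H \<in> alg_aut P iotaP" using H(1) H_const[OF iota_closed] \<phi>_iota by (intro alg_autI) simp_all
  then obtain b where b: "b \<in> carrier R" "\<phi> a = monom P b 0" using aut_const[OF _ a] H_const[OF a] by metis
  \<comment> \<open>A constant \<open>\<phi> a\<close> has coefficient zero at \<open>t\<close>, and
    by the differential equation this coefficient is \<open>d a\<close>.\<close>
  then have "iota (of_nat (Suc 0)) \<otimes> coeff P (\<phi> a) (Suc 0) = \<zero>" by simp
  then show ?thesis using \<phi>(1)[OF a] \<phi>0[OF a] unfolding exp_poly_def by metis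
qed

section \<open>Twisted convolution and leading terms\<close>

lemma poly_mapping_sum_singles: "p = (\<Sum>u\<in>Poly_Mapping.keys p. Poly_Mapping.single u (Poly_Mapping.lookup p u))"
proof (rule poly_mapping_eqI)
  fix k
  show "Poly_Mapping.lookup p k = Poly_Mapping.lookup (\<Sum>u\<in>Poly_Mapping.keys p. Poly_Mapping.single u (Poly_Mapping.lookup p u)) k"
    by (cases "k \<in> Poly_Mapping.keys p")
      (auto simp: lookup_sum lookup_single when_def in_keys_iff sum.delta')
qed

text \<open>The case \<open>single\<close> treats exponents occurring in \<open>p\<close> only, so
  that conditions on the support of \<open>p\<close> stay available there.\<close>

lemma poly_mapping_induct [case_names zero single add]:
  fixes p :: "'a \<Rightarrow>\<^sub>0 'b::comm_monoid_add"
  assumes "Q 0"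
    and "\<And>u c. u \<in> Poly_Mapping.keys p \<Longrightarrow> Q (Poly_Mapping.single u c)"
    and "\<And>p q. Q p \<Longrightarrow> Q q \<Longrightarrow> Q (p + q)"
  shows "Q p"
proof -
  have "Q (\<Sum>u\<in>F. Poly_Mapping.single u (Poly_Mapping.lookup p u))" if "F \<subseteq> Poly_Mapping.keys p" for F
  proof -
    have "finite F" by (rule finite_subset[OF that finite_keys])
    then show ?thesis using that
      by (induction F rule: finite_induct) (auto intro!: assms)
  qed
  then show ?thesis using poly_mapping_sum_singles[of p] by (metis order.refl)
qed

text \<open>Covers both products in use: words under concatenation with weight \<open>1\<close> give
  the free algebra, exponent vectors under addition with weight \<open>\<omega>\<close> give the
  torus.\<close>

definition tw_mult :: "('m \<Rightarrow> 'm \<Rightarrow> 'm) \<Rightarrow> ('m \<Rightarrow> 'm \<Rightarrow> 'k) \<Rightarrow> ('m \<Rightarrow>\<^sub>0 'k) \<Rightarrow> ('m \<Rightarrow>\<^sub>0 'k) \<Rightarrow> ('m \<Rightarrow>\<^sub>0 'k::comm_ring_1)"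
  where "tw_mult f w p r = (\<Sum>u\<in>Poly_Mapping.keys p. \<Sum>v\<in>Poly_Mapping.keys r.
    Poly_Mapping.single (f u v) (w u v * Poly_Mapping.lookup p u * Poly_Mapping.lookup r v))"

lemma fa_mult_tw_mult: "fa_mult = tw_mult (@) (\<lambda>_ _. 1)"
  by (intro ext) (simp add: fa_mult_def tw_mult_def)

lemma tw_mult_superset:
  assumes "finite U" "finite V" "Poly_Mapping.keys p \<subseteq> U" "Poly_Mapping.keys r \<subseteq> V"
  shows "tw_mult f w p r = (\<Sum>u\<in>U. \<Sum>v\<in>V. Poly_Mapping.single (f u v) (w u v * Poly_Mapping.lookup p u * Poly_Mapping.lookup r v))"
proof -
  have "(\<Sum>v\<in>V. Poly_Mapping.single (f u v) (w u v * Poly_Mapping.lookup p u * Poly_Mapping.lookup r v))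
      = (\<Sum>v\<in>Poly_Mapping.keys r. Poly_Mapping.single (f u v) (w u v * Poly_Mapping.lookup p u * Poly_Mapping.lookup r v))" for u
    using assms by (intro sum.mono_neutral_right) (auto simp: in_keys_iff)
  then show ?thesis
    unfolding tw_mult_def using assms
    by (simp, intro sum.mono_neutral_left) (auto simp: in_keys_iff)
qed

lemma tw_mult_add_left: "tw_mult f w (p + p') r = tw_mult f w p r + tw_mult f w p' r"
proof -
  let ?U = "Poly_Mapping.keys p \<union> Poly_Mapping.keys p'"
  have "Poly_Mapping.keys (p + p') \<subseteq> ?U" by (rule Poly_Mapping.keys_add)
  then show ?thesis
    by (subst (1 2 3) tw_mult_superset[of ?U "Poly_Mapping.keys r"])
      (auto simp: lookup_add algebra_simps single_add sum.distrib)
qed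

lemma tw_mult_add_right: "tw_mult f w r (p + p') = tw_mult f w r p + tw_mult f w r p'"
proof -
  let ?U = "Poly_Mapping.keys p \<union> Poly_Mapping.keys p'"
  have "Poly_Mapping.keys (p + p') \<subseteq> ?U" by (rule Poly_Mapping.keys_add)
  then show ?thesis
    by (subst (1 2 3) tw_mult_superset[of "Poly_Mapping.keys r" ?U])
      (auto simp: lookup_add algebra_simps single_add sum.distrib)
qed

lemma tw_mult_zero [simp]: "tw_mult f w 0 r = 0" "tw_mult f w r 0 = 0"
  by (simp_all add: tw_mult_def)

lemma tw_mult_single:
  "tw_mult f w (Poly_Mapping.single u a) (Poly_Mapping.single v b) = Poly_Mapping.single (f u v) (w u v * a * b)"
  by (subst tw_mult_superset[of "{u}" "{v}"]) auto

lemma tw_mult_minus_left: "tw_mult f w (- p) r = - tw_mult f w p r"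
  using tw_mult_add_left[of f w p "- p" r] by (simp add: eq_neg_iff_add_eq_0 add.commute)

lemma tw_mult_minus_right: "tw_mult f w r (- p) = - tw_mult f w r p"
  using tw_mult_add_right[of f w r p "- p"] by (simp add: eq_neg_iff_add_eq_0 add.commute)

lemma tw_mult_diff_left: "tw_mult f w (p - p') r = tw_mult f w p r - tw_mult f w p' r"
  using tw_mult_add_left[of f w p "- p'" r] by (simp add: tw_mult_minus_left)

lemma tw_mult_diff_right: "tw_mult f w r (p - p') = tw_mult f w r p - tw_mult f w r p'"
  using tw_mult_add_right[of f w r p "- p'"] by (simp add: tw_mult_minus_right)

lemma tw_mult_sum_right: "tw_mult f w r (sum g S) = (\<Sum>i\<in>S. tw_mult f w r (g i))"
  by (induction S rule: infinite_finite_induct) (auto simp: tw_mult_add_right)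

text \<open>The condition on \<open>w\<close> is the 2-cocycle identity: both bracketings of three
  monomials carry the same weight. Additivity in each factor does the rest.\<close>

lemma tw_mult_assoc:
  assumes f: "\<And>u v x. f (f u v) x = f u (f v x)"
    and w: "\<And>u v x. w u v * w (f u v) x = w v x * w u (f v x)"
  shows "tw_mult f w (tw_mult f w p r) s = tw_mult f w p (tw_mult f w r s)"
proof (induction p rule: poly_mapping_induct)
  case (single u a)
  show ?case
  proof (induction r rule: poly_mapping_induct)
    case (single v b)
    show ?case
    proof (induction s rule: poly_mapping_induct)
      case (single x c)
      have "w (f u v) x * (w u v * a * b) * c = (w u v * w (f u v) x) * (a * b * c)"
        by (simp add: mult_ac)
      also have "\<dots> = w u (f v x) * a * (w v x * b * c)"
        unfolding w by (simp add: mult_ac)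
      finally show ?case by (simp add: tw_mult_single f)
    qed (simp_all add: tw_mult_add_right)
  qed (simp_all add: tw_mult_add_left tw_mult_add_right)
qed (simp_all add: tw_mult_add_left)

lemma keys_tw_mult:
  "Poly_Mapping.keys (tw_mult f w p r) \<subseteq> (\<lambda>(u, v). f u v) ` (Poly_Mapping.keys p \<times> Poly_Mapping.keys r)"
proof
  fix k assume "k \<in> Poly_Mapping.keys (tw_mult f w p r)"
  then have "(\<Sum>u\<in>Poly_Mapping.keys p. \<Sum>v\<in>Poly_Mapping.keys r.
      Poly_Mapping.lookup (Poly_Mapping.single (f u v) (w u v * Poly_Mapping.lookup p u * Poly_Mapping.lookup r v)) k) \<noteq> 0"
    by (simp add: in_keys_iff tw_mult_def lookup_sum)
  then obtain u where u: "u \<in> Poly_Mapping.keys p" "(\<Sum>v\<in>Poly_Mapping.keys r.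
      Poly_Mapping.lookup (Poly_Mapping.single (f u v) (w u v * Poly_Mapping.lookup p u * Poly_Mapping.lookup r v)) k) \<noteq> 0"
    by (meson sum.neutral)
  then obtain v where "v \<in> Poly_Mapping.keys r"
      "Poly_Mapping.lookup (Poly_Mapping.single (f u v) (w u v * Poly_Mapping.lookup p u * Poly_Mapping.lookup r v)) k \<noteq> 0"
    by (meson sum.neutral)
  then show "k \<in> (\<lambda>(u, v). f u v) ` (Poly_Mapping.keys p \<times> Poly_Mapping.keys r)"
    using u(1) by (force simp: lookup_single when_def split: if_splits)
qed

lemma lookup_tw_mult_unique:
  assumes "u0 \<in> Poly_Mapping.keys p" "v0 \<in> Poly_Mapping.keys r"
    and uniq: "\<And>u v. u \<in> Poly_Mapping.keys p \<Longrightarrow> v \<in> Poly_Mapping.keys r \<Longrightarrow> f u v = f u0 v0 \<Longrightarrow> u = u0 \<and> v = v0"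
  shows "Poly_Mapping.lookup (tw_mult f w p r) (f u0 v0) = w u0 v0 * Poly_Mapping.lookup p u0 * Poly_Mapping.lookup r v0"
proof -
  have "Poly_Mapping.lookup (tw_mult f w p r) (f u0 v0)
     = (\<Sum>u\<in>Poly_Mapping.keys p. \<Sum>v\<in>Poly_Mapping.keys r.
        if u = u0 then (if v = v0 then w u0 v0 * Poly_Mapping.lookup p u0 * Poly_Mapping.lookup r v0 else 0) else 0)"
    unfolding tw_mult_def lookup_sum
    by (intro sum.cong refl) (use uniq in \<open>auto simp: lookup_single when_def\<close>)
  also have "\<dots> = (\<Sum>u\<in>Poly_Mapping.keys p. if u = u0 then w u0 v0 * Poly_Mapping.lookup p u0 * Poly_Mapping.lookup r v0 else 0)"
    using assms(2) by (intro sum.cong refl) auto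
  also have "\<dots> = w u0 v0 * Poly_Mapping.lookup p u0 * Poly_Mapping.lookup r v0" using assms(1) by simp
  finally show ?thesis .
qed

text \<open>Linearity suffices once one constant \<open>c\<close> serves all pairs of monomials. The
  neutral exponent \<open>e\<close> turns \<open>Poly_Mapping.single e c\<close> into the scalar
  \<open>c\<close>.\<close>

lemma tw_mult_commute:
  assumes "\<And>u v. f u v = f v u" "\<And>u v. u \<in> Poly_Mapping.keys p \<Longrightarrow> v \<in> Poly_Mapping.keys r \<Longrightarrow> w u v = c * w v u"
    and "\<And>v. f e v = v" "\<And>v. w e v = 1"
  shows "tw_mult f w p r = tw_mult f w (Poly_Mapping.single e c) (tw_mult f w r p)"
proof -
  have "tw_mult f w (Poly_Mapping.single e c) (tw_mult f w r p)
     = (\<Sum>v\<in>Poly_Mapping.keys r. \<Sum>u\<in>Poly_Mapping.keys p. Poly_Mapping.single (f u v) (c * w v u * Poly_Mapping.lookup p u * Poly_Mapping.lookup r v))"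
    by (subst (2) tw_mult_def)
      (simp add: tw_mult_sum_right tw_mult_single assms(3,4) assms(1)[symmetric] mult_ac)
  also have "\<dots> = tw_mult f w p r"
    unfolding tw_mult_def by (subst sum.swap) (intro sum.cong refl, use assms(2) in \<open>simp add: assms(1)\<close>)
  finally show ?thesis by simp
qed

section \<open>Leading exponents of twisted products\<close>

definition lm :: "('m::linorder \<Rightarrow>\<^sub>0 'k::zero) \<Rightarrow> 'm" where
  "lm p = Max (Poly_Mapping.keys p)"

lemma lm_in_keys: "p \<noteq> 0 \<Longrightarrow> lm p \<in> Poly_Mapping.keys p"
  unfolding lm_def by (intro Max_in) auto

lemma lm_ge: "u \<in> Poly_Mapping.keys p \<Longrightarrow> u \<le> lm p"
  unfolding lm_def by (intro Max_ge) auto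

lemma lm_eqI: "u \<in> Poly_Mapping.keys p \<Longrightarrow> (\<And>v. v \<in> Poly_Mapping.keys p \<Longrightarrow> v \<le> u) \<Longrightarrow> lm p = u"
  unfolding lm_def by (intro Max_eqI) auto

text \<open>In an ordered group the sum of the two maxima is attained by no other pair of exponents,
  so nothing can cancel the leading term.\<close>

lemma tw_mult_lm:
  fixes p r :: "'m::linordered_ab_group_add \<Rightarrow>\<^sub>0 'k::idom"
  assumes "p \<noteq> 0" "r \<noteq> 0" "\<And>u v. w u v \<noteq> 0"
  shows "tw_mult (+) w p r \<noteq> 0" "lm (tw_mult (+) w p r) = lm p + lm r"
    "Poly_Mapping.lookup (tw_mult (+) w p r) (lm p + lm r) = w (lm p) (lm r) * Poly_Mapping.lookup p (lm p) * Poly_Mapping.lookup r (lm r)"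
proof -
  show eq: "Poly_Mapping.lookup (tw_mult (+) w p r) (lm p + lm r) = w (lm p) (lm r) * Poly_Mapping.lookup p (lm p) * Poly_Mapping.lookup r (lm r)"
  proof (rule lookup_tw_mult_unique)
    fix u v assume uv: "u \<in> Poly_Mapping.keys p" "v \<in> Poly_Mapping.keys r" "u + v = lm p + lm r"
    then have "u \<le> lm p" "v \<le> lm r" by (auto intro: lm_ge)
    then show "u = lm p \<and> v = lm r"
      using uv(3) by (metis add_le_less_mono add_less_le_mono less_irrefl order.not_eq_order_implies_strict)
  qed (use assms lm_in_keys in auto)
  have "Poly_Mapping.lookup p (lm p) \<noteq> 0" "Poly_Mapping.lookup r (lm r) \<noteq> 0" using lm_in_keys assms by (auto simp: in_keys_iff[symmetric])
  then have "Poly_Mapping.lookup (tw_mult (+) w p r) (lm p + lm r) \<noteq> 0" using eq assms(3) by simp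
  then have mem: "lm p + lm r \<in> Poly_Mapping.keys (tw_mult (+) w p r)" by (simp add: in_keys_iff)
  then show "tw_mult (+) w p r \<noteq> 0" by auto
  show "lm (tw_mult (+) w p r) = lm p + lm r"
    using mem keys_tw_mult[of "(+)" w p r] by (intro lm_eqI) (auto intro!: add_mono lm_ge)
qed

section \<open>The quantum torus\<close>

locale qweyl =
  fixes n :: nat and q :: "nat \<Rightarrow> 'k::field" and lam :: "nat \<Rightarrow> nat \<Rightarrow> 'k"
  assumes q_nz: "i \<in> {1..n} \<Longrightarrow> q i \<noteq> 0"
    and lam_nz: "i \<in> {1..n} \<Longrightarrow> j \<in> {1..n} \<Longrightarrow> lam i j \<noteq> 0"
    and lam_inv: "i \<in> {1..n} \<Longrightarrow> j \<in> {1..n} \<Longrightarrow> lam i j = inverse (lam j i)"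
    and q_not_root: "k \<in> {1..n} \<Longrightarrow> (m::nat) \<ge> 1 \<Longrightarrow> q k ^ m \<noteq> 1"
begin

text \<open>The quantum torus with basis \<open>x\<^sup>a z\<^sup>b\<close>: the exponent of \<open>x\<^sub>i\<close> is stored at the index
  \<open>2 * i + 1\<close> and that of \<open>z\<^sub>i\<close> at \<open>2 * i\<close>.\<close>

definition xe :: "(nat \<Rightarrow>\<^sub>0 int) \<Rightarrow> nat \<Rightarrow> int" where "xe u i = Poly_Mapping.lookup u (2*i+1)"
definition ze :: "(nat \<Rightarrow>\<^sub>0 int) \<Rightarrow> nat \<Rightarrow> int" where "ze u i = Poly_Mapping.lookup u (2*i)"

definition lamu :: "nat \<Rightarrow> nat \<Rightarrow> 'k" where "lamu i j = (if i < j then lam i j else 1)"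

text \<open>A bicharacter with value \<open>q i\<close> on \<open>(ex i, ez i)\<close>, value
  \<open>lam i j\<close> on \<open>(ex i, ex j)\<close> for \<open>i < j\<close>, and
  \<open>1\<close> on all other pairs of these vectors. Thus each of the commutations
  \<open>x_i z_i = q_i z_i x_i\<close> and \<open>x_i x_j = lam i j x_j x_i\<close> is recorded in
  one order of the pair only.\<close>

definition \<omega> :: "(nat \<Rightarrow>\<^sub>0 int) \<Rightarrow> (nat \<Rightarrow>\<^sub>0 int) \<Rightarrow> 'k" where
  "\<omega> u v = (\<Prod>i\<in>{1..n}. q i powi (xe u i * ze v i))
     * (\<Prod>i\<in>{1..n}. \<Prod>j\<in>{1..n}. lamu i j powi (xe u i * xe v j))"

abbreviation tm (infixl "\<star>" 70) where "p \<star> r \<equiv> tw_mult (+) \<omega> p r"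

definition sc :: "'k \<Rightarrow> ((nat \<Rightarrow>\<^sub>0 int) \<Rightarrow>\<^sub>0 'k)" where "sc c = Poly_Mapping.single 0 c"
definition ex :: "nat \<Rightarrow> (nat \<Rightarrow>\<^sub>0 int)" where "ex i = Poly_Mapping.single (2*i+1) 1"
definition ez :: "nat \<Rightarrow> (nat \<Rightarrow>\<^sub>0 int)" where "ez i = Poly_Mapping.single (2*i) 1"

lemma lamu_nz: "i \<in> {1..n} \<Longrightarrow> j \<in> {1..n} \<Longrightarrow> lamu i j \<noteq> 0"
  using lam_nz by (simp add: lamu_def)

lemma exponent_add: "xe (u + v) i = xe u i + xe v i" "ze (u + v) i = ze u i + ze v i"
  by (simp_all add: xe_def ze_def lookup_add)

lemma exponent_zero: "xe 0 i = 0" "ze 0 i = 0"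
  by (simp_all add: xe_def ze_def)

lemma exponent_ex: "xe (ex i) j = (if i = j then 1 else 0)" "ze (ex i) j = 0"
proof -
  have "2*i+1 \<noteq> 2*j" by presburger
  then show "ze (ex i) j = 0" by (simp add: ze_def ex_def lookup_single when_def)
qed (simp add: xe_def ex_def lookup_single when_def)

lemma exponent_ez: "xe (ez i) j = 0" "ze (ez i) j = (if i = j then 1 else 0)"
proof -
  have "2*i \<noteq> 2*j+1" by presburger
  then show "xe (ez i) j = 0" by (simp add: xe_def ez_def lookup_single when_def)
qed (simp add: ze_def ez_def lookup_single when_def)

lemma \<omega>_add_left: "\<omega> (u + u') v = \<omega> u v * \<omega> u' v"
proof -
  have "(\<Prod>i\<in>{1..n}. q i powi (xe (u + u') i * ze v i))
      = (\<Prod>i\<in>{1..n}. q i powi (xe u i * ze v i)) * (\<Prod>i\<in>{1..n}. q i powi (xe u' i * ze v i))"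
    unfolding prod.distrib[symmetric] using q_nz
    by (intro prod.cong refl) (auto simp: exponent_add distrib_right power_int_add)
  moreover have "(\<Prod>i\<in>{1..n}. \<Prod>j\<in>{1..n}. lamu i j powi (xe (u + u') i * xe v j))
      = (\<Prod>i\<in>{1..n}. \<Prod>j\<in>{1..n}. lamu i j powi (xe u i * xe v j)) * (\<Prod>i\<in>{1..n}. \<Prod>j\<in>{1..n}. lamu i j powi (xe u' i * xe v j))"
    unfolding prod.distrib[symmetric] using lamu_nz
    by (intro prod.cong refl) (auto simp: exponent_add distrib_right power_int_add)
  ultimately show ?thesis by (simp only: \<omega>_def mult_ac)
qed

lemma \<omega>_add_right: "\<omega> v (u + u') = \<omega> v u * \<omega> v u'"
proof -
  have "(\<Prod>i\<in>{1..n}. q i powi (xe v i * ze (u + u') i))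
      = (\<Prod>i\<in>{1..n}. q i powi (xe v i * ze u i)) * (\<Prod>i\<in>{1..n}. q i powi (xe v i * ze u' i))"
    unfolding prod.distrib[symmetric] using q_nz
    by (intro prod.cong refl) (auto simp: exponent_add distrib_left power_int_add)
  moreover have "(\<Prod>i\<in>{1..n}. \<Prod>j\<in>{1..n}. lamu i j powi (xe v i * xe (u + u') j))
      = (\<Prod>i\<in>{1..n}. \<Prod>j\<in>{1..n}. lamu i j powi (xe v i * xe u j)) * (\<Prod>i\<in>{1..n}. \<Prod>j\<in>{1..n}. lamu i j powi (xe v i * xe u' j))"
    unfolding prod.distrib[symmetric] using lamu_nz
    by (intro prod.cong refl) (auto simp: exponent_add distrib_left power_int_add)
  ultimately show ?thesis by (simp only: \<omega>_def mult_ac)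
qed

lemma \<omega>_nz: "\<omega> u v \<noteq> 0"
  using q_nz lamu_nz by (auto simp: \<omega>_def)

lemma \<omega>_zero [simp]: "\<omega> 0 v = 1" "\<omega> v 0 = 1"
  by (simp_all add: \<omega>_def exponent_zero)

lemma \<omega>_minus_left: "\<omega> (- u) v = inverse (\<omega> u v)"
  using \<omega>_add_left[of u "- u" v] \<omega>_nz[of u v] by (simp add: field_simps)

lemma \<omega>_minus_right: "\<omega> v (- u) = inverse (\<omega> v u)"
  using \<omega>_add_right[of v u "- u"] \<omega>_nz[of v u] by (simp add: field_simps)

lemma \<omega>_diff_left: "\<omega> (u - u') v = \<omega> u v / \<omega> u' v"
  using \<omega>_add_left[of u "- u'" v] by (simp add: \<omega>_minus_left divide_inverse)

lemma \<omega>_diff_right: "\<omega> v (u - u') = \<omega> v u / \<omega> v u'"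
  using \<omega>_add_right[of v u "- u'"] by (simp add: \<omega>_minus_right divide_inverse)

lemma \<omega>_ez_left: "\<omega> (ez i) v = 1"
  by (simp add: \<omega>_def exponent_ez)

lemma \<omega>_ez_right:
  assumes "j \<in> {1..n}"
  shows "\<omega> u (ez j) = q j powi xe u j"
proof -
  have "(\<Prod>i\<in>{1..n}. q i powi (xe u i * ze (ez j) i)) = (\<Prod>i\<in>{1..n}. if j = i then q i powi xe u i else 1)"
    by (intro prod.cong) (auto simp: exponent_ez)
  then show ?thesis using assms unfolding \<omega>_def by (simp add: exponent_ez(1))
qed

lemma \<omega>_ex_left:
  assumes "i \<in> {1..n}"
  shows "\<omega> (ex i) v = q i powi ze v i * (\<Prod>j\<in>{1..n}. lamu i j powi xe v j)"
proof -
  have "(\<Prod>k\<in>{1..n}. q k powi (xe (ex i) k * ze v k)) = (\<Prod>k\<in>{1..n}. if i = k then q k powi ze v k else 1)"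
    by (intro prod.cong) (auto simp: exponent_ex)
  moreover have "(\<Prod>k\<in>{1..n}. \<Prod>j\<in>{1..n}. lamu k j powi (xe (ex i) k * xe v j))
     = (\<Prod>k\<in>{1..n}. if i = k then (\<Prod>j\<in>{1..n}. lamu k j powi xe v j) else 1)"
    by (intro prod.cong) (auto simp: exponent_ex)
  ultimately show ?thesis unfolding \<omega>_def using assms by simp
qed

lemma \<omega>_ex_right:
  assumes "j \<in> {1..n}"
  shows "\<omega> u (ex j) = (\<Prod>i\<in>{1..n}. lamu i j powi xe u i)"
proof -
  have "(\<Prod>k\<in>{1..n}. lamu i k powi (xe u i * xe (ex j) k))
     = (\<Prod>k\<in>{1..n}. if j = k then lamu i k powi xe u i else 1)" for i
    by (intro prod.cong) (auto simp: exponent_ex)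
  then show ?thesis unfolding \<omega>_def using assms by (simp add: exponent_ex)
qed

lemma \<omega>_ex_ex:
  assumes "i \<in> {1..n}" "j \<in> {1..n}"
  shows "\<omega> (ex i) (ex j) = (if i < j then lam i j else 1)"
proof -
  have "\<omega> (ex i) (ex j) = (\<Prod>k\<in>{1..n}. if i = k then lamu k j else 1)"
    unfolding \<omega>_ex_right[OF assms(2)] exponent_ex by (intro prod.cong) auto
  then show ?thesis using assms by (simp add: lamu_def)
qed

lemma \<omega>_ex_ez: "j \<in> {1..n} \<Longrightarrow> \<omega> (ex i) (ez j) = (if i = j then q i else 1)"
  by (simp add: \<omega>_ez_right exponent_ex)

lemma tm_assoc: "(p \<star> r) \<star> s = p \<star> (r \<star> s)"
  by (rule tw_mult_assoc) (simp_all add: add.assoc \<omega>_add_left \<omega>_add_right)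

lemma sc_mult: "sc c \<star> sc d = sc (c * d)"
  by (simp add: sc_def tw_mult_single)

lemma sc_central: "p \<star> sc c = sc c \<star> p"
  by (induction p rule: poly_mapping_induct)
    (simp_all add: sc_def tw_mult_single tw_mult_add_right tw_mult_add_left mult.commute)

lemma sc_left_commute: "p \<star> (sc c \<star> r) = sc c \<star> (p \<star> r)"
  by (metis tm_assoc sc_central)

lemma sc_add: "sc (c + d) = sc c + sc d"
  by (simp add: sc_def single_add)

lemma sc_single: "sc c \<star> Poly_Mapping.single u a = Poly_Mapping.single u (c * a)"
  by (simp add: sc_def tw_mult_single)

lemma sc_1: "sc 1 \<star> p = p"
  by (induction p rule: poly_mapping_induct) (simp_all add: sc_single tw_mult_add_right)

lemma lookup_sc_mult: "Poly_Mapping.lookup (sc c \<star> p) u = c * Poly_Mapping.lookup p u"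
  by (induction p rule: poly_mapping_induct)
    (auto simp: sc_single lookup_single when_def tw_mult_add_right lookup_add distrib_left)

lemmas tm_lm = tw_mult_lm[where w = \<omega>, OF _ _ \<omega>_nz]

lemma tm_commute:
  assumes "\<And>u v. u \<in> Poly_Mapping.keys p \<Longrightarrow> v \<in> Poly_Mapping.keys r \<Longrightarrow> \<omega> u v = c * \<omega> v u"
  shows "p \<star> r = sc c \<star> (r \<star> p)"
  unfolding sc_def by (rule tw_mult_commute) (auto simp: add.commute assms)

section \<open>Images of the generators in the torus\<close>

definition gz :: "nat \<Rightarrow> ((nat \<Rightarrow>\<^sub>0 int) \<Rightarrow>\<^sub>0 'k)" where "gz i = Poly_Mapping.single (ez i) 1"

fun \<phi>g :: "gen \<Rightarrow> ((nat \<Rightarrow>\<^sub>0 int) \<Rightarrow>\<^sub>0 'k)" where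
  "\<phi>g (X i) = Poly_Mapping.single (ex i) 1"
| "\<phi>g (Y i) = sc (inverse (q i - 1)) \<star> (Poly_Mapping.single (ez i - ex i) 1 - Poly_Mapping.single (- ex i) 1)"

fun lmg :: "gen \<Rightarrow> (nat \<Rightarrow>\<^sub>0 int)" where
  "lmg (X i) = ex i"
| "lmg (Y i) = ez i - ex i"

lemma q_ne_1: "i \<in> {1..n} \<Longrightarrow> q i - 1 \<noteq> 0"
  using q_not_root[of i 1] by simp

text \<open>Exponents are compared at the smallest index where they differ. Positivity of
  \<open>ez i\<close> makes \<open>ez i - ex i\<close>, and not \<open>- ex i\<close>, the leading
  exponent of the image of \<open>y_i\<close>.\<close>

lemma ez_pos: "ez i > 0"
  unfolding ez_def less_poly_mapping.rep_eq less_fun_def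
  by (rule exI[of _ "2*i"]) (auto simp: lookup_single when_def)

lemma gens_cases:
  assumes "g \<in> gens n"
  obtains i where "i \<in> {1..n}" "g = X i" | i where "i \<in> {1..n}" "g = Y i"
  using assms by (auto simp: gens_def)

lemma \<phi>g_lm:
  assumes "g \<in> gens n"
  shows "\<phi>g g \<noteq> 0" "lm (\<phi>g g) = lmg g"
proof -
  have "lmg g \<in> Poly_Mapping.keys (\<phi>g g) \<and> (\<forall>v\<in>Poly_Mapping.keys (\<phi>g g). v \<le> lmg g)"
    using assms
  proof (cases rule: gens_cases)
    case (1 i)
    then show ?thesis by simp
  next
    case (2 i)
    have ne: "ez i - ex i \<noteq> - ex i" using ez_pos[of i] by auto
    have le: "- ex i \<le> ez i - ex i" using ez_pos[of i] by (simp add: less_imp_le)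
    show ?thesis using 2 q_ne_1[OF 2(1)] ne le
      by (auto simp: in_keys_iff lookup_sc_mult lookup_minus lookup_single when_def split: if_splits)
  qed
  then show "\<phi>g g \<noteq> 0" "lm (\<phi>g g) = lmg g" by (auto intro!: lm_eqI)
qed

lemma keys_\<phi>g_Y: "Poly_Mapping.keys (\<phi>g (Y i)) \<subseteq> {ez i - ex i, - ex i}"
  by (auto simp: in_keys_iff lookup_sc_mult lookup_minus lookup_single when_def split: if_splits)

lemma \<phi>g_YX:
  assumes i: "i \<in> {1..n}"
  shows "\<phi>g (Y i) \<star> \<phi>g (X i) = sc (inverse (q i - 1)) \<star> (gz i - sc 1)"
  using i by (simp add: tm_assoc tw_mult_diff_left tw_mult_single \<omega>_diff_left \<omega>_minus_left
      \<omega>_ez_left \<omega>_ex_ex gz_def sc_def)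

lemma \<phi>g_XY:
  assumes i: "i \<in> {1..n}"
  shows "\<phi>g (X i) \<star> \<phi>g (Y i) = sc (inverse (q i - 1)) \<star> (sc (q i) \<star> gz i - sc 1)"
  using i unfolding \<phi>g.simps sc_left_commute
  by (simp add: tw_mult_diff_right tw_mult_single \<omega>_diff_right \<omega>_minus_right \<omega>_ex_ez \<omega>_ex_ex gz_def sc_def)

lemma \<phi>g_rel:
  assumes i: "i \<in> {1..n}"
  shows "\<phi>g (X i) \<star> \<phi>g (Y i) = sc (q i) \<star> (\<phi>g (Y i) \<star> \<phi>g (X i)) + sc 1"
proof -
  let ?c = "inverse (q i - 1)"
  \<comment> \<open>The terms in \<open>gz i\<close> cancel, and the scalar that remains is
    \<open>q i * ?c - ?c\<close>, which is \<open>1\<close> by the choice of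
    \<open>?c\<close>.\<close>
  have "q i * ?c - ?c = (q i - 1) * ?c" by (simp add: left_diff_distrib)
  then have "sc 1 = sc (q i * ?c) - sc ?c"
    using q_ne_1[OF i] by (simp add: sc_def flip: single_diff)
  then show ?thesis unfolding \<phi>g_XY[OF i] \<phi>g_YX[OF i] gz_def sc_single tw_mult_diff_right sc_mult
    by (simp add: mult.commute)
qed

text \<open>The two monomials in the image of \<open>y_j\<close> differ by \<open>ez j\<close>,
  which commutes with everything of another index. So one scalar serves both monomials, and it is
  determined by the \<open>ex\<close> parts.\<close>

lemma \<phi>g_commute:
  assumes "i \<in> {1..n}" "j \<in> {1..n}" "i < j"
  shows "\<phi>g (X i) \<star> \<phi>g (X j) = sc (lam i j) \<star> (\<phi>g (X j) \<star> \<phi>g (X i))"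
    "\<phi>g (Y j) \<star> \<phi>g (Y i) = sc (lam j i) \<star> (\<phi>g (Y i) \<star> \<phi>g (Y j))"
    "\<phi>g (X i) \<star> \<phi>g (Y j) = sc (lam j i) \<star> (\<phi>g (Y j) \<star> \<phi>g (X i))"
    "\<phi>g (X j) \<star> \<phi>g (Y i) = sc (lam i j) \<star> (\<phi>g (Y i) \<star> \<phi>g (X j))"
proof -
  note w = \<omega>_diff_left \<omega>_diff_right \<omega>_minus_left \<omega>_minus_right \<omega>_ez_left \<omega>_ex_ez \<omega>_ex_ex
  note nz = lam_nz[OF assms(1,2)] lam_nz[OF assms(2,1)]
  note kY = keys_\<phi>g_Y[THEN subsetD]
  show "\<phi>g (X i) \<star> \<phi>g (X j) = sc (lam i j) \<star> (\<phi>g (X j) \<star> \<phi>g (X i))"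
    by (rule tm_commute) (use assms nz in \<open>simp add: w\<close>)
  show "\<phi>g (Y j) \<star> \<phi>g (Y i) = sc (lam j i) \<star> (\<phi>g (Y i) \<star> \<phi>g (Y j))"
    by (rule tm_commute, drule kY, drule kY)
      (use assms nz in \<open>auto simp: w lam_inv[OF assms(2,1)] simp del: \<phi>g.simps\<close>)
  show "\<phi>g (X i) \<star> \<phi>g (Y j) = sc (lam j i) \<star> (\<phi>g (Y j) \<star> \<phi>g (X i))"
  proof (rule tm_commute)
    fix u v assume "u \<in> Poly_Mapping.keys (\<phi>g (X i))" "v \<in> Poly_Mapping.keys (\<phi>g (Y j))"
    then have "u = ex i" "v = ez j - ex j \<or> v = - ex j" using kY[of v j] by auto
    then show "\<omega> u v = lam j i * \<omega> v u"
      using assms nz by (auto simp: w lam_inv[OF assms(2,1)] divide_inverse)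
  qed
  show "\<phi>g (X j) \<star> \<phi>g (Y i) = sc (lam i j) \<star> (\<phi>g (Y i) \<star> \<phi>g (X j))"
  proof (rule tm_commute)
    fix u v assume "u \<in> Poly_Mapping.keys (\<phi>g (X j))" "v \<in> Poly_Mapping.keys (\<phi>g (Y i))"
    then have "u = ex j" "v = ez i - ex i \<or> v = - ex i" using kY[of v i] by auto
    then show "\<omega> u v = lam i j * \<omega> v u"
      using assms nz by (auto simp: w lam_inv[OF assms(2,1)] divide_inverse)
  qed
qed

text \<open>A single monomial, \<open>gz i\<close> passes generators of another index freely and
  passes \<open>x_i\<close> and \<open>y_i\<close> at the cost of \<open>inverse (q i)\<close> and
  \<open>q i\<close>. This is the source of normality.\<close>

lemma gz_commute:
  assumes "i \<in> {1..n}" "g \<in> gens n"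
  shows "\<exists>c. gz i \<star> \<phi>g g = sc c \<star> (\<phi>g g \<star> gz i)"
proof -
  note w = \<omega>_diff_left \<omega>_diff_right \<omega>_minus_left \<omega>_minus_right \<omega>_ez_left \<omega>_ex_ez[OF assms(1)]
  have *: "gz i \<star> \<phi>g g = sc c \<star> (\<phi>g g \<star> gz i)"
    if "\<And>v. v \<in> Poly_Mapping.keys (\<phi>g g) \<Longrightarrow> \<omega> (ez i) v = c * \<omega> v (ez i)" for c
    by (rule tm_commute) (use that in \<open>simp add: gz_def\<close>)
  show ?thesis using assms(2)
  proof (cases rule: gens_cases)
    case (1 j)
    then show ?thesis using q_nz[of j]
      by (intro exI[of _ "if i = j then inverse (q j) else 1"] *) (auto simp: w)
  next
    case (2 j)
    have "v = ez j - ex j \<or> v = - ex j" if "v \<in> Poly_Mapping.keys (\<phi>g g)" for v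
      using that keys_\<phi>g_Y[of j] 2 by blast
    then show ?thesis using q_nz[of j] 2(1)
      by (intro exI[of _ "if i = j then q j else 1"] *) (fastforce simp: w)
  qed
qed

end

section \<open>The embedding into the quantum torus\<close>

lemma fa_mult_single:
  "fa_mult (Poly_Mapping.single u a) (Poly_Mapping.single v b) = Poly_Mapping.single (u @ v) (a * b)"
  by (simp add: fa_mult_tw_mult tw_mult_single)

lemma fa_mult_add_left: "fa_mult (p + p') r = fa_mult p r + fa_mult p' r"
  and fa_mult_add_right: "fa_mult r (p + p') = fa_mult r p + fa_mult r p'"
  and fa_mult_diff_left: "fa_mult (p - p') r = fa_mult p r - fa_mult p' r"
  and fa_mult_diff_right: "fa_mult r (p - p') = fa_mult r p - fa_mult r p'"
  and fa_mult_zero: "fa_mult 0 r = 0" "fa_mult r 0 = 0"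
  by (simp_all add: fa_mult_tw_mult tw_mult_add_left tw_mult_add_right tw_mult_diff_left tw_mult_diff_right)

lemma fa_mult_assoc: "fa_mult (fa_mult p r) s = fa_mult p (fa_mult r s)"
  unfolding fa_mult_tw_mult by (rule tw_mult_assoc) simp_all

lemma fa_sc_mult_single: "fa_mult (fa_sc c) (Poly_Mapping.single u a) = Poly_Mapping.single u (c * a)"
  by (simp add: fa_sc_def fa_mult_single)

lemma fa_one_mult: "fa_mult (Poly_Mapping.single [] 1) p = p" "fa_mult p (Poly_Mapping.single [] 1) = p"
  by (induction p rule: poly_mapping_induct)
    (simp_all add: fa_mult_zero fa_mult_single fa_mult_add_left fa_mult_add_right)

lemma free_alg_simps [simp]:
  "mult (free_alg n) = fa_mult" "one (free_alg n) = Poly_Mapping.single [] 1"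
  "zero (free_alg n) = 0" "add (free_alg n) = (+)"
  by (simp_all add: free_alg_def)

lemma mem_free_alg: "p \<in> carrier (free_alg n) \<longleftrightarrow> (\<forall>w\<in>Poly_Mapping.keys p. set w \<subseteq> gens n)"
  by (simp add: free_alg_def)

lemma free_alg_single: "set w \<subseteq> gens n \<Longrightarrow> Poly_Mapping.single w c \<in> carrier (free_alg n)"
  by (simp add: mem_free_alg)

lemma free_alg_zero: "0 \<in> carrier (free_alg n)"
  by (simp add: mem_free_alg)

lemma free_alg_add: "p \<in> carrier (free_alg n) \<Longrightarrow> r \<in> carrier (free_alg n) \<Longrightarrow> p + r \<in> carrier (free_alg n)"
  using Poly_Mapping.keys_add[of p r] by (auto simp: mem_free_alg)

lemma free_alg_mult: "p \<in> carrier (free_alg n) \<Longrightarrow> r \<in> carrier (free_alg n) \<Longrightarrow> fa_mult p r \<in> carrier (free_alg n)"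
  using keys_tw_mult[of "(@)" "\<lambda>_ _. 1" p r] by (fastforce simp: mem_free_alg fa_mult_tw_mult)

lemma free_alg_uminus: "p \<in> carrier (free_alg n) \<Longrightarrow> - p \<in> carrier (free_alg n)"
  by (simp add: mem_free_alg in_keys_iff)

lemma free_alg_diff: "p \<in> carrier (free_alg n) \<Longrightarrow> r \<in> carrier (free_alg n) \<Longrightarrow> p - r \<in> carrier (free_alg n)"
  using free_alg_add[of p n "- r"] free_alg_uminus[of r n] by simp

lemma free_alg_fa_sc: "fa_sc c \<in> carrier (free_alg n)"
  by (simp add: fa_sc_def free_alg_single)

lemma free_alg_induct [consumes 1, case_names single add]:
  assumes "p \<in> carrier (free_alg n)"
    and "\<And>w c. set w \<subseteq> gens n \<Longrightarrow> Q (Poly_Mapping.single w c)"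
    and "\<And>p r. p \<in> carrier (free_alg n) \<Longrightarrow> r \<in> carrier (free_alg n) \<Longrightarrow> Q p \<Longrightarrow> Q r \<Longrightarrow> Q (p + r)"
  shows "Q p"
proof -
  have "p \<in> carrier (free_alg n) \<and> Q p"
  proof (induction p rule: poly_mapping_induct)
    case zero
    then show ?case using assms(2)[of "[]" 0] by (simp add: free_alg_zero)
  next
    case (single u c)
    then show ?case using assms(1,2) by (auto simp: mem_free_alg)
  next
    case (add p r)
    then show ?case using assms(3) free_alg_add by blast
  qed
  then show ?thesis ..
qed

lemma free_alg_ring: "ring (free_alg n :: 'k::comm_ring_1 fa ring)"
proof (intro ringI abelian_groupI monoidI)
  fix x :: "'k fa" assume "x \<in> carrier (free_alg n)"
  then show "\<exists>y\<in>carrier (free_alg n). y \<oplus>\<^bsub>free_alg n\<^esub> x = \<zero>\<^bsub>free_alg n\<^esub>"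
    by (intro bexI[of _ "- x"]) (auto intro: free_alg_uminus)
qed (auto simp: free_alg_add free_alg_mult free_alg_zero free_alg_single fa_mult_assoc fa_one_mult
    fa_mult_add_left fa_mult_add_right add_ac)

lemma free_alg_minus:
  fixes p :: "'k::comm_ring_1 fa"
  assumes "p \<in> carrier (free_alg n)" "r \<in> carrier (free_alg n)"
  shows "p \<ominus>\<^bsub>free_alg n\<^esub> r = p - r"
proof -
  interpret F: ring "free_alg n :: 'k fa ring" by (rule free_alg_ring)
  have "\<ominus>\<^bsub>free_alg n\<^esub> r = - r" using assms free_alg_uminus by (intro F.minus_equality) auto
  then show ?thesis by (simp add: a_minus_def)
qed

section \<open>The homomorphism from the free algebra to the torus\<close>

context qweyl
begin

abbreviation F :: "'k fa ring" where "F \<equiv> free_alg n"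

fun \<phi>w :: "gen list \<Rightarrow> ((nat \<Rightarrow>\<^sub>0 int) \<Rightarrow>\<^sub>0 'k)" where
  "\<phi>w [] = sc 1"
| "\<phi>w (g # w) = \<phi>g g \<star> \<phi>w w"

lemma \<phi>w_append: "\<phi>w (u @ v) = \<phi>w u \<star> \<phi>w v"
  by (induction u) (simp_all add: sc_1 tm_assoc)

definition \<phi> :: "'k fa \<Rightarrow> ((nat \<Rightarrow>\<^sub>0 int) \<Rightarrow>\<^sub>0 'k)" where
  "\<phi> p = (\<Sum>w\<in>Poly_Mapping.keys p. sc (Poly_Mapping.lookup p w) \<star> \<phi>w w)"

lemma sc_0: "sc 0 = 0" by (simp add: sc_def)

lemma \<phi>_superset:
  "finite U \<Longrightarrow> Poly_Mapping.keys p \<subseteq> U \<Longrightarrow> \<phi> p = (\<Sum>w\<in>U. sc (Poly_Mapping.lookup p w) \<star> \<phi>w w)"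
  unfolding \<phi>_def by (intro sum.mono_neutral_left) (auto simp: in_keys_iff sc_0)

lemma \<phi>_add: "\<phi> (p + r) = \<phi> p + \<phi> r"
proof -
  let ?U = "Poly_Mapping.keys p \<union> Poly_Mapping.keys r"
  have "Poly_Mapping.keys (p + r) \<subseteq> ?U" by (rule Poly_Mapping.keys_add)
  then show ?thesis
    by (subst (1 2 3) \<phi>_superset[of ?U]) (auto simp: lookup_add sc_add tw_mult_add_left sum.distrib)
qed

lemma \<phi>_zero: "\<phi> 0 = 0"
  by (simp add: \<phi>_def)

lemma \<phi>_uminus: "\<phi> (- p) = - \<phi> p"
  using \<phi>_add[of p "- p"] by (simp add: \<phi>_zero eq_neg_iff_add_eq_0 add.commute)

lemma \<phi>_diff: "\<phi> (p - r) = \<phi> p - \<phi> r"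
  using \<phi>_add[of p "- r"] by (simp add: \<phi>_uminus)

lemma \<phi>_single: "\<phi> (Poly_Mapping.single w c) = sc c \<star> \<phi>w w"
  by (subst \<phi>_superset[of "{w}"]) auto

lemma \<phi>_fa_sc: "\<phi> (fa_sc c) = sc c"
  by (simp add: fa_sc_def \<phi>_single sc_mult)

lemma \<phi>_mult: "\<phi> (fa_mult p r) = \<phi> p \<star> \<phi> r"
proof (induction p rule: poly_mapping_induct)
  case (single u a)
  show ?case
  proof (induction r rule: poly_mapping_induct)
    case (single v b)
    have "sc (a * b) \<star> (\<phi>w u \<star> \<phi>w v) = sc a \<star> (sc b \<star> (\<phi>w u \<star> \<phi>w v))"
      by (simp add: tm_assoc[symmetric] sc_mult)
    also have "sc b \<star> (\<phi>w u \<star> \<phi>w v) = \<phi>w u \<star> (sc b \<star> \<phi>w v)" by (rule sc_left_commute[symmetric])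
    finally show ?case by (simp add: fa_mult_single \<phi>_single \<phi>w_append tm_assoc)
  qed (simp_all add: \<phi>_zero fa_mult_zero fa_mult_add_right \<phi>_add tw_mult_add_right)
qed (simp_all add: \<phi>_zero fa_mult_zero fa_mult_add_left \<phi>_add tw_mult_add_left)

section \<open>The defining ideal and congruence modulo it\<close>

abbreviation I where "I \<equiv> genideal F (qwa_rels n q lam)"

lemma gens_iff: "X i \<in> gens n \<longleftrightarrow> i \<in> {1..n}" "Y i \<in> gens n \<longleftrightarrow> i \<in> {1..n}"
  by (auto simp: gens_def)

lemma fa_gen_carrier: "i \<in> {1..n} \<Longrightarrow> fa_x i \<in> carrier F" "i \<in> {1..n} \<Longrightarrow> fa_y i \<in> carrier F"
  by (simp_all add: fa_x_def fa_y_def fa_gen_def free_alg_single gens_iff)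

lemma \<phi>_gen: "\<phi> (fa_x i) = \<phi>g (X i)" "\<phi> (fa_y i) = \<phi>g (Y i)"
  by (simp_all add: fa_x_def fa_y_def fa_gen_def \<phi>_single sc_1 sc_central del: \<phi>g.simps)

lemma rels_carrier: "qwa_rels n q lam \<subseteq> carrier F"
  unfolding qwa_rels_def
  by (auto intro!: free_alg_diff free_alg_mult free_alg_fa_sc fa_gen_carrier)

lemma rels_\<phi>: "p \<in> qwa_rels n q lam \<Longrightarrow> \<phi> p = 0"
  unfolding qwa_rels_def
  by (elim UnE CollectE exE conjE)
    (simp_all add: \<phi>_diff \<phi>_mult \<phi>_gen \<phi>_fa_sc \<phi>g_commute \<phi>g_rel del: \<phi>g.simps)

lemma F_ring: "ring F" by (rule free_alg_ring)

lemma I_ideal: "ideal I F"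
  by (rule ring.genideal_ideal[OF F_ring rels_carrier])

lemma I_\<phi>: "p \<in> I \<Longrightarrow> \<phi> p = 0"
proof -
  have "ideal {p \<in> carrier F. \<phi> p = 0} F"
  proof (rule idealI[OF F_ring])
    interpret F: ring F by (rule F_ring)
    show "subgroup {p \<in> carrier F. \<phi> p = 0} (add_monoid F)"
    proof (rule F.add.subgroupI)
      show "\<ominus>\<^bsub>F\<^esub> a \<in> {p \<in> carrier F. \<phi> p = 0}" if "a \<in> {p \<in> carrier F. \<phi> p = 0}" for a
      proof -
        have "\<ominus>\<^bsub>F\<^esub> a = - a" using that free_alg_uminus by (intro F.minus_equality) auto
        then show ?thesis using that by (simp add: \<phi>_uminus free_alg_uminus)
      qed
      show "{p \<in> carrier F. \<phi> p = 0} \<noteq> {}" using free_alg_zero \<phi>_zero by auto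
    qed (auto simp: \<phi>_add free_alg_add)
  qed (auto simp: \<phi>_mult free_alg_mult)
  then have "I \<subseteq> {p \<in> carrier F. \<phi> p = 0}"
    using rels_\<phi> rels_carrier by (intro ring.genideal_minimal[OF F_ring]) auto
  then show "p \<in> I \<Longrightarrow> \<phi> p = 0" by blast
qed

lemma I_add: "p \<in> I \<Longrightarrow> r \<in> I \<Longrightarrow> p + r \<in> I"
  using additive_subgroup.a_closed[OF ideal.axioms(1)[OF I_ideal], of p r] by simp

lemma I_zero: "0 \<in> I"
  using additive_subgroup.zero_closed[OF ideal.axioms(1)[OF I_ideal]] by simp

lemma I_mult_left: "p \<in> I \<Longrightarrow> r \<in> carrier F \<Longrightarrow> fa_mult r p \<in> I"
  using ideal.I_l_closed[OF I_ideal, of p r] by simp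

lemma I_mult_right: "p \<in> I \<Longrightarrow> r \<in> carrier F \<Longrightarrow> fa_mult p r \<in> I"
  using ideal.I_r_closed[OF I_ideal, of p r] by simp

lemma fa_sc_minus_one: "fa_mult (fa_sc (- 1)) p = - p"
  by (induction p rule: poly_mapping_induct)
    (simp_all add: fa_mult_zero fa_sc_mult_single fa_mult_add_right single_uminus)

lemma I_uminus: "p \<in> I \<Longrightarrow> - p \<in> I"
  using I_mult_left[of p "fa_sc (- 1)"] by (simp add: fa_sc_minus_one free_alg_fa_sc)

text \<open>Straightening is carried out on representatives in the free algebra rather than on
  cosets. Multipliers have to lie in \<open>F\<close>, since \<open>I\<close> is an ideal of
  \<open>F\<close>.\<close>

definition cg :: "'k fa \<Rightarrow> 'k fa \<Rightarrow> bool" (infix "\<approx>" 50) where "p \<approx> r \<longleftrightarrow> p - r \<in> I"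

lemma cg_refl: "p \<approx> p" by (simp add: cg_def I_zero)

lemma cg_sym: "p \<approx> r \<Longrightarrow> r \<approx> p"
  unfolding cg_def using I_uminus by fastforce

lemma cg_trans [trans]: "p \<approx> r \<Longrightarrow> r \<approx> s \<Longrightarrow> p \<approx> s"
  unfolding cg_def using I_add[of "p - r" "r - s"] by simp

lemma cg_add: "p \<approx> r \<Longrightarrow> p' \<approx> r' \<Longrightarrow> p + p' \<approx> r + r'"
  unfolding cg_def using I_add[of "p - r" "p' - r'"] by (simp add: algebra_simps)

lemma cg_mult_left: "p \<approx> r \<Longrightarrow> s \<in> carrier F \<Longrightarrow> fa_mult s p \<approx> fa_mult s r"
  unfolding cg_def using I_mult_left[of "p - r" s] by (simp add: fa_mult_diff_right)

lemma cg_mult_right: "p \<approx> r \<Longrightarrow> s \<in> carrier F \<Longrightarrow> fa_mult p s \<approx> fa_mult r s"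
  unfolding cg_def using I_mult_right[of "p - r" s] by (simp add: fa_mult_diff_left)

lemma cg_scale: "p \<approx> r \<Longrightarrow> fa_mult (fa_sc c) p \<approx> fa_mult (fa_sc c) r"
  using cg_mult_left free_alg_fa_sc by blast

lemma cg_context:
  assumes "Poly_Mapping.single u 1 \<approx> r" "set v \<subseteq> gens n" "set w \<subseteq> gens n"
  shows "Poly_Mapping.single (v @ u @ w) 1 \<approx> fa_mult (Poly_Mapping.single v 1) (fa_mult r (Poly_Mapping.single w 1))"
  using cg_mult_left[OF cg_mult_right[OF assms(1) free_alg_single[OF assms(3), of 1]] free_alg_single[OF assms(2), of 1]]
  by (simp add: fa_mult_single)

section \<open>Straightening words into ordered monomials\<close>

fun idx :: "gen \<Rightarrow> nat" where "idx (X i) = i" | "idx (Y i) = i"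

text \<open>For each pair of generators the relations give one of the two orders; the other follows
  on dividing by the scalar, which is why \<open>c \<noteq> 0\<close> is recorded.\<close>

lemma swap:
  assumes "g \<in> gens n" "h \<in> gens n" "idx g \<noteq> idx h"
  shows "\<exists>c. c \<noteq> 0 \<and> Poly_Mapping.single [g, h] 1 \<approx> Poly_Mapping.single [h, g] c"
proof -
  define R where "R g h \<longleftrightarrow> (\<exists>c. c \<noteq> 0 \<and> Poly_Mapping.single [g, h] 1 \<approx> Poly_Mapping.single [h, g] c)" for g h
  have sym: "R h g" if gh: "R g h" for g h
  proof -
    obtain c where c: "c \<noteq> 0" "Poly_Mapping.single [g, h] 1 \<approx> Poly_Mapping.single [h, g] c"
      using gh unfolding R_def by blast
    have "Poly_Mapping.single [h, g] 1 \<approx> Poly_Mapping.single [g, h] (inverse c)"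
      using cg_scale[OF cg_sym[OF c(2)], of "inverse c"] c(1) by (simp add: fa_sc_mult_single)
    then show ?thesis unfolding R_def using c(1) by (metis inverse_zero_imp_zero)
  qed
  have rels: "R (X i) (X j)" "R (Y j) (Y i)" "R (X i) (Y j)" "R (X j) (Y i)"
    if ij: "i \<in> {1..n}" "j \<in> {1..n}" "i < j" for i j
  proof -
    note S = ring.genideal_self[OF F_ring rels_carrier, THEN subsetD]
    note nz = lam_nz[OF ij(1,2)] lam_nz[OF ij(2,1)]
    have "fa_mult (fa_x i) (fa_x j) - fa_mult (fa_sc (lam i j)) (fa_mult (fa_x j) (fa_x i)) \<in> I"
      by (rule S) (use ij in \<open>auto simp: qwa_rels_def\<close>)
    then show "R (X i) (X j)" using nz unfolding R_def cg_def
      by (intro exI[of _ "lam i j"]) (simp add: fa_x_def fa_gen_def fa_mult_single fa_sc_mult_single)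
    have "fa_mult (fa_y j) (fa_y i) - fa_mult (fa_sc (lam j i)) (fa_mult (fa_y i) (fa_y j)) \<in> I"
      by (rule S) (use ij in \<open>auto simp: qwa_rels_def\<close>)
    then show "R (Y j) (Y i)" using nz unfolding R_def cg_def
      by (intro exI[of _ "lam j i"]) (simp add: fa_y_def fa_gen_def fa_mult_single fa_sc_mult_single)
    have "fa_mult (fa_x i) (fa_y j) - fa_mult (fa_sc (lam j i)) (fa_mult (fa_y j) (fa_x i)) \<in> I"
      by (rule S) (use ij in \<open>auto simp: qwa_rels_def\<close>)
    then show "R (X i) (Y j)" using nz unfolding R_def cg_def
      by (intro exI[of _ "lam j i"]) (simp add: fa_x_def fa_y_def fa_gen_def fa_mult_single fa_sc_mult_single)
    have "fa_mult (fa_x j) (fa_y i) - fa_mult (fa_sc (lam i j)) (fa_mult (fa_y i) (fa_x j)) \<in> I"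
      by (rule S) (use ij in \<open>auto simp: qwa_rels_def\<close>)
    then show "R (X j) (Y i)" using nz unfolding R_def cg_def
      by (intro exI[of _ "lam i j"]) (simp add: fa_x_def fa_y_def fa_gen_def fa_mult_single fa_sc_mult_single)
  qed
  have "R g h"
    using assms(1)
  proof (cases rule: gens_cases)
    case (1 i)
    note g = 1
    show ?thesis using assms(2)
    proof (cases rule: gens_cases)
      case (1 j)
      then show ?thesis using g assms(3) rels(1)[of i j] rels(1)[of j i, THEN sym] by (cases "i < j") auto
    next
      case (2 j)
      then show ?thesis using g assms(3) rels(3)[of i j] rels(4)[of j i] by (cases "i < j") auto
    qed
  next
    case (2 i)
    note g = 2
    show ?thesis using assms(2)
    proof (cases rule: gens_cases)
      case (1 j)
      then show ?thesis using g assms(3) rels(4)[of i j, THEN sym] rels(3)[of j i, THEN sym] by (cases "i < j") auto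
    next
      case (2 j)
      then show ?thesis using g assms(3) rels(2)[of i j, THEN sym] rels(2)[of j i] by (cases "i < j") auto
    qed
  qed
  then show ?thesis unfolding R_def .
qed

lemma swap_word:
  assumes "g \<in> gens n" "set w \<subseteq> gens n" "\<And>h. h \<in> set w \<Longrightarrow> idx h \<noteq> idx g"
  shows "\<exists>c. Poly_Mapping.single (g # w) 1 \<approx> Poly_Mapping.single (w @ [g]) c"
  using assms(2,3)
proof (induction w)
  case Nil
  then show ?case using cg_refl by auto
next
  case (Cons h w)
  obtain c where c: "Poly_Mapping.single (g # w) 1 \<approx> Poly_Mapping.single (w @ [g]) c" using Cons by auto
  obtain d where d: "Poly_Mapping.single [g, h] 1 \<approx> Poly_Mapping.single [h, g] d"
    using swap[of g h] assms(1) Cons.prems(1) Cons.prems(2)[of h] by auto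
  have "Poly_Mapping.single (g # h # w) 1 \<approx> Poly_Mapping.single (h # g # w) d"
    using cg_context[OF d, of "[]" w] Cons.prems by (simp add: fa_mult_single)
  also have "Poly_Mapping.single (h # g # w) d = fa_mult (Poly_Mapping.single [h] d) (Poly_Mapping.single (g # w) 1)"
    by (simp add: fa_mult_single)
  also have "\<dots> \<approx> fa_mult (Poly_Mapping.single [h] d) (Poly_Mapping.single (w @ [g]) c)"
    using Cons.prems by (intro cg_mult_left c free_alg_single) auto
  also have "\<dots> = Poly_Mapping.single ((h # w) @ [g]) (d * c)" by (simp add: fa_mult_single)
  finally show ?case by blast
qed

text \<open>Moving \<open>x\<close> across one \<open>y\<close> at a time yields a multiple of
  \<open>y^b x\<close> and a multiple of \<open>y^(b-1)\<close>. The clause for \<open>b = 0\<close>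
  serves the induction: truncated subtraction would otherwise leave a stray
  \<open>y\<close>.\<close>

lemma X_Ypow:
  assumes i: "i \<in> {1..n}"
  shows "\<exists>c d. (b = 0 \<longrightarrow> d = 0) \<and> Poly_Mapping.single (X i # replicate b (Y i)) 1
     \<approx> Poly_Mapping.single (replicate b (Y i) @ [X i]) c + Poly_Mapping.single (replicate (b - 1) (Y i)) d"
proof (induction b)
  case 0
  show ?case using cg_refl[of "Poly_Mapping.single [X i] 1"] by (intro exI[of _ 1] exI[of _ 0]) simp
next
  case (Suc b)
  obtain c d where IH: "Poly_Mapping.single (X i # replicate b (Y i)) 1
     \<approx> Poly_Mapping.single (replicate b (Y i) @ [X i]) c + Poly_Mapping.single (replicate (b - 1) (Y i)) d" and d: "b = 0 \<longrightarrow> d = 0"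
    using Suc by blast
  have "fa_mult (fa_x i) (fa_y i) - fa_mult (fa_sc (q i)) (fa_mult (fa_y i) (fa_x i)) - fa_sc 1 \<in> I"
    by (rule ring.genideal_self[OF F_ring rels_carrier, THEN subsetD]) (use i in \<open>auto simp: qwa_rels_def\<close>)
  then have rel: "Poly_Mapping.single [X i, Y i] 1 \<approx> Poly_Mapping.single [Y i, X i] (q i) + Poly_Mapping.single [] 1"
    by (simp add: cg_def fa_x_def fa_y_def fa_gen_def fa_mult_single fa_sc_mult_single diff_diff_eq)
       (simp add: fa_sc_def)
  have "Poly_Mapping.single (X i # replicate (Suc b) (Y i)) 1
     \<approx> Poly_Mapping.single (Y i # X i # replicate b (Y i)) (q i) + Poly_Mapping.single (replicate b (Y i)) 1"
    using cg_context[OF rel, of "[]" "replicate b (Y i)"] i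
    by (simp add: fa_mult_single fa_mult_add_left fa_mult_add_right gens_iff set_replicate_conv_if)
  also have "Poly_Mapping.single (Y i # X i # replicate b (Y i)) (q i)
     = fa_mult (Poly_Mapping.single [Y i] (q i)) (Poly_Mapping.single (X i # replicate b (Y i)) 1)"
    by (simp add: fa_mult_single)
  also have "fa_mult (Poly_Mapping.single [Y i] (q i)) (Poly_Mapping.single (X i # replicate b (Y i)) 1) + Poly_Mapping.single (replicate b (Y i)) 1
     \<approx> fa_mult (Poly_Mapping.single [Y i] (q i)) (Poly_Mapping.single (replicate b (Y i) @ [X i]) c
          + Poly_Mapping.single (replicate (b - 1) (Y i)) d) + Poly_Mapping.single (replicate b (Y i)) 1"
    using i by (intro cg_add cg_refl cg_mult_left IH free_alg_single) (simp add: gens_iff)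
  also have "\<dots> = Poly_Mapping.single (replicate (Suc b) (Y i) @ [X i]) (q i * c)
      + (Poly_Mapping.single (Y i # replicate (b - 1) (Y i)) (q i * d) + Poly_Mapping.single (replicate b (Y i)) 1)"
    by (simp add: fa_mult_single fa_mult_add_right add.assoc)
  also have "Poly_Mapping.single (Y i # replicate (b - 1) (Y i)) (q i * d) + Poly_Mapping.single (replicate b (Y i)) 1
      = Poly_Mapping.single (replicate b (Y i)) (q i * d + 1)"
    using d by (cases b) (simp_all add: single_add)
  finally show ?case by (intro exI[of _ "q i * c"] exI[of _ "q i * d + 1"]) simp
qed

text \<open>The pair holds the exponent of \<open>x_i\<close> first, while in the word the letters
  \<open>y_i\<close> come first, so that a \<open>y_i\<close> arriving from the left needs no
  rewriting.\<close>

definition blk :: "(nat \<Rightarrow> nat \<times> nat) \<Rightarrow> nat \<Rightarrow> gen list" where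
  "blk f i = replicate (snd (f i)) (Y i) @ replicate (fst (f i)) (X i)"

definition pbw :: "(nat \<Rightarrow> nat \<times> nat) \<Rightarrow> gen list" where
  "pbw f = concat (map (blk f) [1..<Suc n])"

definition reducible :: "'k fa set" where
  "reducible = {p. \<exists>r. Poly_Mapping.keys r \<subseteq> range pbw \<and> p \<approx> r}"

lemma set_blk: "i \<in> {1..n} \<Longrightarrow> set (blk f i) \<subseteq> gens n" "h \<in> set (blk f i) \<Longrightarrow> idx h = i"
  by (auto simp: blk_def gens_iff split: if_splits)

lemma set_concat_blk:
  assumes "h \<in> set (concat (map (blk f) [a..<b]))" "1 \<le> a" "b \<le> Suc n"
  shows "h \<in> gens n" "idx h \<in> {a..<b}"
proof -
  obtain i where i: "i \<in> {a..<b}" "h \<in> set (blk f i)" using assms(1) by auto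
  then show "h \<in> gens n" using set_blk(1)[of i f] assms(2,3) by auto
  show "idx h \<in> {a..<b}" using i set_blk(2) by blast
qed

lemma pbw_gens: "set (pbw f) \<subseteq> gens n"
  using set_concat_blk(1)[of _ f 1 "Suc n"] unfolding pbw_def by blast

lemma pbw_split:
  assumes "j \<in> {1..n}"
  shows "pbw f = concat (map (blk f) [1..<j]) @ blk f j @ concat (map (blk f) [Suc j..<Suc n])"
proof -
  have e: "j + (Suc n - j) = Suc n" using assms by simp
  have "[1..<Suc n] = [1..<j] @ [j..<Suc n]"
    using upt_add_eq_append[of 1 j "Suc n - j"] assms unfolding e by (simp del: upt_Suc)
  moreover have "[j..<Suc n] = j # [Suc j..<Suc n]"
    using assms by (intro upt_conv_Cons) simp
  ultimately show ?thesis by (simp add: pbw_def del: upt_Suc)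
qed

lemma pbw_update:
  assumes "j \<in> {1..n}"
  shows "pbw (f(j := (a, b))) = concat (map (blk f) [1..<j]) @ (replicate b (Y j) @ replicate a (X j))
    @ concat (map (blk f) [Suc j..<Suc n])"
proof -
  have "map (blk (f(j := (a, b)))) [1..<j] = map (blk f) [1..<j]"
    "map (blk (f(j := (a, b)))) [Suc j..<Suc n] = map (blk f) [Suc j..<Suc n]"
    by (auto simp: blk_def)
  moreover have "blk (f(j := (a, b))) j = replicate b (Y j) @ replicate a (X j)" by (simp add: blk_def)
  ultimately show ?thesis unfolding pbw_split[OF assms, of "f(j := (a, b))"] by (simp only:)
qed

lemma reducible_I: "Poly_Mapping.keys r \<subseteq> range pbw \<Longrightarrow> p \<approx> r \<Longrightarrow> p \<in> reducible"
  unfolding reducible_def by blast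

lemma reducible_E:
  assumes "p \<in> reducible"
  obtains r where "Poly_Mapping.keys r \<subseteq> range pbw" "p \<approx> r"
  using assms unfolding reducible_def by blast

lemma reducible_cg:
  assumes "p \<approx> r" "r \<in> reducible" shows "p \<in> reducible"
  using assms(2)
proof (rule reducible_E)
  fix s assume "Poly_Mapping.keys s \<subseteq> range pbw" "r \<approx> s"
  then show ?thesis by (intro reducible_I[of s] cg_trans[OF assms(1)])
qed

lemma reducible_add:
  assumes "p \<in> reducible" "p' \<in> reducible" shows "p + p' \<in> reducible"
proof -
  obtain r where r: "Poly_Mapping.keys r \<subseteq> range pbw" "p \<approx> r" using assms(1) by (rule reducible_E)
  obtain r' where r': "Poly_Mapping.keys r' \<subseteq> range pbw" "p' \<approx> r'" using assms(2) by (rule reducible_E)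
  have "Poly_Mapping.keys (r + r') \<subseteq> range pbw"
    using Poly_Mapping.keys_add[of r r'] r(1) r'(1) by (meson Un_least order_trans)
  then show ?thesis by (rule reducible_I[OF _ cg_add[OF r(2) r'(2)]])
qed

lemma reducible_pbw: "Poly_Mapping.single (pbw f) c \<in> reducible"
  by (rule reducible_I[OF _ cg_refl]) simp

lemma reducible_scale:
  assumes "p \<in> reducible" shows "fa_mult (fa_sc c) p \<in> reducible"
proof -
  obtain r where r: "Poly_Mapping.keys r \<subseteq> range pbw" "p \<approx> r" using assms by (rule reducible_E)
  have "Poly_Mapping.keys (fa_mult (fa_sc c) r) \<subseteq> Poly_Mapping.keys r"
    using keys_tw_mult[of "(@)" "\<lambda>_ _. 1" "fa_sc c" r] by (auto simp: fa_mult_tw_mult fa_sc_def split: if_splits)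
  then have "Poly_Mapping.keys (fa_mult (fa_sc c) r) \<subseteq> range pbw" using r(1) by (rule order_trans)
  then show ?thesis by (rule reducible_I[OF _ cg_scale[OF r(2)]])
qed

text \<open>\<open>g\<close> crosses the blocks of smaller index at the cost of a scalar. In its own
  block a \<open>y\<close> lengthens the power; an \<open>x\<close> has to cross the power of
  \<open>y\<close>, which by \<open>X_Ypow\<close> leaves two ordered monomials.\<close>

lemma reducible_gen_pbw:
  assumes g: "g \<in> gens n"
  shows "Poly_Mapping.single (g # pbw f) 1 \<in> reducible"
proof -
  define j where "j = idx g"
  have j: "j \<in> {1..n}" using g by (cases rule: gens_cases) (auto simp: j_def)
  define L where "L = concat (map (blk f) [1..<j])"
  define Rr where "Rr = concat (map (blk f) [Suc j..<Suc n])"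
  have L: "set L \<subseteq> gens n" "\<And>h. h \<in> set L \<Longrightarrow> idx h \<noteq> idx g"
  proof -
    show "set L \<subseteq> gens n" using set_concat_blk(1)[of _ f 1 j] j unfolding L_def by auto
    show "idx h \<noteq> idx g" if "h \<in> set L" for h
      using set_concat_blk(2)[of h f 1 j] j that unfolding L_def j_def[symmetric] by auto
  qed
  have Rr: "set Rr \<subseteq> gens n"
    using set_concat_blk(1)[of _ f "Suc j" "Suc n"] unfolding Rr_def by auto
  obtain a b where ab: "f j = (a, b)" by (cases "f j")
  have f_eq: "pbw f = L @ (replicate b (Y j) @ replicate a (X j)) @ Rr"
    using pbw_update[OF j, of f a b] ab by (simp add: L_def Rr_def fun_upd_idem)
  have upd: "L @ (replicate b' (Y j) @ replicate a' (X j)) @ Rr = pbw (f(j := (a', b')))" for a' b'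
    using pbw_update[OF j, of f a' b'] by (simp add: L_def Rr_def)
  obtain c where c: "Poly_Mapping.single (g # L) 1 \<approx> Poly_Mapping.single (L @ [g]) c"
    using swap_word[OF g L] by blast
  have tail: "set (replicate b (Y j) @ replicate a (X j) @ Rr) \<subseteq> gens n"
    using Rr j by (auto simp: gens_iff split: if_splits)
  have "Poly_Mapping.single (g # pbw f) 1
      \<approx> Poly_Mapping.single (L @ [g] @ replicate b (Y j) @ replicate a (X j) @ Rr) c"
    using cg_context[OF c _ tail, of "[]"] unfolding f_eq by (simp add: fa_mult_single)
  also have "\<dots> = fa_mult (fa_sc c) (Poly_Mapping.single (L @ [g] @ replicate b (Y j) @ replicate a (X j) @ Rr) 1)"
    by (simp add: fa_sc_mult_single)
  finally have eq: "Poly_Mapping.single (g # pbw f) 1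
     \<approx> fa_mult (fa_sc c) (Poly_Mapping.single (L @ [g] @ replicate b (Y j) @ replicate a (X j) @ Rr) 1)" .
  have "Poly_Mapping.single (L @ [g] @ replicate b (Y j) @ replicate a (X j) @ Rr) 1 \<in> reducible"
    using g
  proof (cases rule: gens_cases)
    case (2 i)
    then have "L @ [g] @ replicate b (Y j) @ replicate a (X j) @ Rr = pbw (f(j := (a, Suc b)))"
      using upd[of "Suc b" a] by (simp add: j_def)
    then show ?thesis using reducible_pbw by (simp only:)
  next
    case (1 i)
    then have g_eq: "g = X j" by (simp add: j_def)
    obtain c d where cd: "Poly_Mapping.single (X j # replicate b (Y j)) 1
     \<approx> Poly_Mapping.single (replicate b (Y j) @ [X j]) c + Poly_Mapping.single (replicate (b - 1) (Y j)) d"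
      using X_Ypow[OF j] by blast
    have "set (replicate a (X j) @ Rr) \<subseteq> gens n" using tail by auto
    from cg_context[OF cd L(1) this]
    have "Poly_Mapping.single (L @ [g] @ replicate b (Y j) @ replicate a (X j) @ Rr) 1
      \<approx> Poly_Mapping.single (L @ (replicate b (Y j) @ replicate (Suc a) (X j)) @ Rr) c
        + Poly_Mapping.single (L @ (replicate (b - 1) (Y j) @ replicate a (X j)) @ Rr) d"
      by (simp add: g_eq fa_mult_single fa_mult_add_left fa_mult_add_right)
    then show ?thesis unfolding upd by (rule reducible_cg[OF _ reducible_add[OF reducible_pbw reducible_pbw]])
  qed
  then show ?thesis by (rule reducible_cg[OF eq reducible_scale])
qed

text \<open>A word is read from its end: each further letter multiplies a combination of ordered
  monomials from the left, and \<open>reducible_gen_pbw\<close> handles the terms.\<close>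

lemma free_alg_reducible:
  assumes "p \<in> carrier F"
  shows "p \<in> reducible"
proof -
  have word: "Poly_Mapping.single w 1 \<in> reducible" if "set w \<subseteq> gens n" for w
    using that
  proof (induction w)
    case Nil
    have "pbw (\<lambda>_. (0, 0)) = []" by (simp add: pbw_def blk_def concat_eq_Nil_conv del: upt_Suc)
    then show ?case using reducible_pbw[of "\<lambda>_. (0, 0)" 1] by (simp only:)
  next
    case (Cons g w)
    have "Poly_Mapping.single w 1 \<in> reducible" using Cons by simp
    then obtain r where r: "Poly_Mapping.keys r \<subseteq> range pbw" "Poly_Mapping.single w 1 \<approx> r" by (rule reducible_E)
    have "fa_mult (Poly_Mapping.single [g] 1) r \<in> reducible"
    proof (induction r rule: poly_mapping_induct)
      case zero
      show ?case unfolding fa_mult_zero by (rule reducible_I[OF _ cg_refl]) simp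
    next
      case (single u c)
      then obtain f where "u = pbw f" using r(1) by blast
      then show ?case using reducible_scale[OF reducible_gen_pbw[of g f], of c] Cons.prems
        by (simp add: fa_mult_single fa_sc_mult_single)
    next
      case (add p r)
      then show ?case by (simp add: fa_mult_add_right reducible_add)
    qed
    moreover have "Poly_Mapping.single (g # w) 1 \<approx> fa_mult (Poly_Mapping.single [g] 1) r"
      using cg_mult_left[OF r(2), of "Poly_Mapping.single [g] 1"] Cons.prems
      by (simp add: fa_mult_single free_alg_single)
    ultimately show ?case by (rule reducible_cg[rotated])
  qed
  show ?thesis
    using assms
  proof (induction rule: free_alg_induct)
    case (single w c)
    then show ?case using reducible_scale[OF word, of w c] by (simp add: fa_sc_mult_single)
  qed (rule reducible_add)
qed

section \<open>Leading exponents of words and independence of the ordered monomials\<close>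

fun lmw :: "gen list \<Rightarrow> (nat \<Rightarrow>\<^sub>0 int)" where
  "lmw [] = 0" | "lmw (g # w) = lmg g + lmw w"

lemma lmw_append: "lmw (u @ v) = lmw u + lmw v"
  by (induction u) (simp_all add: add.assoc)

lemma \<phi>w_lm:
  assumes "set w \<subseteq> gens n"
  shows "\<phi>w w \<noteq> 0" "lm (\<phi>w w) = lmw w"
proof -
  have "\<phi>w w \<noteq> 0 \<and> lm (\<phi>w w) = lmw w"
    using assms
  proof (induction w)
    case Nil
    have "Poly_Mapping.keys (sc 1) = {0}" by (simp add: sc_def)
    then show ?case by (auto simp: lm_def)
  next
    case (Cons g w)
    then show ?case using tm_lm(1,2)[of "\<phi>g g" "\<phi>w w"] \<phi>g_lm[of g] by simp
  qed
  then show "\<phi>w w \<noteq> 0" "lm (\<phi>w w) = lmw w" by auto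
qed

lemma exponent_diff: "xe (u - v) i = xe u i - xe v i" "ze (u - v) i = ze u i - ze v i"
  by (simp_all add: xe_def ze_def lookup_minus)

lemma lmw_replicate:
  "xe (lmw (replicate k (X i))) j = (if i = j then int k else 0)" "ze (lmw (replicate k (X i))) j = 0"
  "xe (lmw (replicate k (Y i))) j = (if i = j then - int k else 0)" "ze (lmw (replicate k (Y i))) j = (if i = j then int k else 0)"
  by (induction k) (simp_all add: exponent_zero exponent_add exponent_diff exponent_ex exponent_ez)

text \<open>Each \<open>y_i\<close> contributes \<open>ez i - ex i\<close>, so a block with
  \<open>a\<close> letters \<open>x_i\<close> and \<open>b\<close> letters \<open>y_i\<close> has
  \<open>z\<close>-exponent \<open>b\<close> and \<open>x\<close>-exponent
  \<open>a - b\<close>.\<close>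

lemma lmw_concat_blk:
  "ze (lmw (concat (map (blk f) [1..<Suc k]))) j = (if j \<in> {1..k} then int (snd (f j)) else 0)"
  "xe (lmw (concat (map (blk f) [1..<Suc k]))) j = (if j \<in> {1..k} then int (fst (f j)) - int (snd (f j)) else 0)"
proof (induction k)
  case 0
  { case 1 show ?case by (simp add: exponent_zero) }
  { case 2 show ?case by (simp add: exponent_zero) }
next
  case (Suc k)
  have upt: "[1..<Suc (Suc k)] = [1..<Suc k] @ [Suc k]" by simp
  { case 1 show ?case unfolding upt using Suc by (auto simp: lmw_append exponent_add blk_def lmw_replicate simp del: upt_Suc) }
  { case 2 show ?case unfolding upt using Suc by (auto simp: lmw_append exponent_add blk_def lmw_replicate simp del: upt_Suc) }
qed

text \<open>The numbers \<open>b\<close> and \<open>a - b\<close> determine the pair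
  \<open>(a, b)\<close> at each index from \<open>1\<close> to \<open>n\<close>. Elsewhere
  \<open>f\<close> is not determined, so the conclusion is about words and not about
  functions.\<close>

lemma lmw_pbw_inj:
  assumes "lmw (pbw f) = lmw (pbw f')"
  shows "pbw f = pbw f'"
proof -
  have "f i = f' i" if "i \<in> {1..n}" for i
    using lmw_concat_blk(1)[of f n i] lmw_concat_blk(1)[of f' n i]
      lmw_concat_blk(2)[of f n i] lmw_concat_blk(2)[of f' n i] assms that
    unfolding pbw_def by (simp add: prod_eq_iff)
  then have "map (blk f) [1..<Suc n] = map (blk f') [1..<Suc n]"
    by (auto simp: blk_def)
  then show ?thesis unfolding pbw_def by metis
qed

text \<open>Leading exponents of distinct ordered monomials differ, so exactly one word of
  \<open>r\<close> reaches the maximum \<open>M\<close>, and its term in \<open>\<phi> r\<close> at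
  \<open>M\<close> cannot be cancelled.\<close>

lemma pbw_independent:
  assumes "Poly_Mapping.keys r \<subseteq> range pbw" "\<phi> r = 0"
  shows "r = 0"
proof (rule ccontr)
  assume "r \<noteq> 0"
  define M where "M = Max (lmw ` Poly_Mapping.keys r)"
  have "M \<in> lmw ` Poly_Mapping.keys r" unfolding M_def using \<open>r \<noteq> 0\<close> by (intro Max_in) auto
  then obtain w0 where w0: "w0 \<in> Poly_Mapping.keys r" "lmw w0 = M" by blast
  have zero: "Poly_Mapping.lookup (sc (Poly_Mapping.lookup r w) \<star> \<phi>w w) M = 0"
    if w: "w \<in> Poly_Mapping.keys r" "w \<noteq> w0" for w
  proof -
    obtain f f0 where f: "w = pbw f" "w0 = pbw f0" using w w0 assms(1) by blast
    then have "lmw w \<noteq> M" using lmw_pbw_inj[of f f0] w w0 by auto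
    moreover have "lmw w \<le> M" unfolding M_def using w by (intro Max_ge) auto
    ultimately have "lmw w < M" by simp
    then have "M \<notin> Poly_Mapping.keys (\<phi>w w)"
      using lm_ge[of M "\<phi>w w"] \<phi>w_lm(2)[of w] pbw_gens[of f] f by auto
    then show ?thesis by (simp add: lookup_sc_mult in_keys_iff)
  qed
  have "Poly_Mapping.lookup (\<phi> r) M = (\<Sum>w\<in>Poly_Mapping.keys r. if w = w0 then Poly_Mapping.lookup (sc (Poly_Mapping.lookup r w0) \<star> \<phi>w w0) M else 0)"
    unfolding \<phi>_def lookup_sum by (intro sum.cong refl) (auto simp: zero)
  also have "\<dots> = Poly_Mapping.lookup r w0 * Poly_Mapping.lookup (\<phi>w w0) M"
    using w0 by (simp add: lookup_sc_mult)
  also have "\<dots> \<noteq> 0"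
  proof -
    obtain f0 where "w0 = pbw f0" using w0 assms(1) by blast
    then have "M \<in> Poly_Mapping.keys (\<phi>w w0)"
      using lm_in_keys \<phi>w_lm[of w0] pbw_gens[of f0] w0 by metis
    then show ?thesis using w0 by (simp add: in_keys_iff)
  qed
  finally show False using assms(2) by simp
qed

text \<open>Spanning replaces \<open>p\<close> by a combination of ordered monomials, which vanishes
  by independence of their images. From here on equality in the quotient can be tested in the
  torus.\<close>

lemma I_iff_\<phi>: "p \<in> carrier F \<Longrightarrow> p \<in> I \<longleftrightarrow> \<phi> p = 0"
proof
  assume p: "p \<in> carrier F" "\<phi> p = 0"
  obtain r where r: "Poly_Mapping.keys r \<subseteq> range pbw" "p \<approx> r" using free_alg_reducible[OF p(1)] by (rule reducible_E)
  then have "\<phi> (p - r) = 0" using I_\<phi> by (simp add: cg_def)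
  then have "r = 0" using p(2) r(1) by (intro pbw_independent) (simp_all add: \<phi>_diff)
  then show "p \<in> I" using r(2) by (simp add: cg_def)
qed (rule I_\<phi>)

end

section \<open>Rigidity of the multiparameter quantum Weyl algebra\<close>

context qweyl
begin

abbreviation A where "A \<equiv> qwa n q lam"

definition cl :: "'k fa \<Rightarrow> 'k fa set" where "cl p = I +>\<^bsub>F\<^esub> p"

lemma A_ring: "ring A"
  unfolding qwa_def by (rule ideal.quotient_is_ring[OF I_ideal])

lemma cl_hom: "cl \<in> ring_hom F A"
  using ideal.rcos_ring_hom[OF I_ideal] unfolding qwa_def cl_def[abs_def] .

lemma carrier_A: "carrier A = cl ` carrier F"
  by (auto simp: qwa_def FactRing_def A_RCOSETS_def' cl_def)

lemma cl_eq_iff: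
  assumes p: "p \<in> carrier F" and r: "r \<in> carrier F"
  shows "cl p = cl r \<longleftrightarrow> \<phi> p = \<phi> r"
proof -
  interpret I: ideal I F by (rule I_ideal)
  have "cl p = cl r \<longleftrightarrow> p \<in> cl r"
    using I.a_rcos_self[OF p] I.a_repr_independence[of p I r] r I.a_subgroup unfolding cl_def by blast
  also have "\<dots> \<longleftrightarrow> p - r \<in> I"
    using I.a_rcos_module[OF r p] free_alg_minus[OF p r] unfolding cl_def a_minus_def by simp
  also have "\<dots> \<longleftrightarrow> \<phi> p = \<phi> r"
    using I_iff_\<phi>[OF free_alg_diff[OF p r]] by (simp add: \<phi>_diff)
  finally show ?thesis .
qed

lemma A_mult: "p \<in> carrier F \<Longrightarrow> r \<in> carrier F \<Longrightarrow> cl p \<otimes>\<^bsub>A\<^esub> cl r = cl (fa_mult p r)"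
  using ring_hom_mult[OF cl_hom, of p r] by simp

lemma A_add: "p \<in> carrier F \<Longrightarrow> r \<in> carrier F \<Longrightarrow> cl p \<oplus>\<^bsub>A\<^esub> cl r = cl (p + r)"
  using ring_hom_add[OF cl_hom, of p r] by simp

lemma A_one: "\<one>\<^bsub>A\<^esub> = cl (Poly_Mapping.single [] 1)"
  using ring_hom_one[OF cl_hom] by simp

lemma A_zero: "\<zero>\<^bsub>A\<^esub> = cl 0"
  using ring_hom_zero[OF cl_hom F_ring A_ring] by simp

lemma cl_zero_iff: "p \<in> carrier F \<Longrightarrow> cl p = \<zero>\<^bsub>A\<^esub> \<longleftrightarrow> \<phi> p = 0"
  unfolding A_zero by (simp add: cl_eq_iff free_alg_zero \<phi>_zero)

lemma cl_closed: "p \<in> carrier F \<Longrightarrow> cl p \<in> carrier A"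
  by (auto simp: carrier_A)

lemma qwa_sc_cl: "qwa_sc n q lam c = cl (fa_sc c)"
  by (simp add: qwa_sc_def cl_def)

text \<open>The indices from \<open>2\<close> to \<open>2*n+1\<close> are those of
  \<open>z_i\<close> and \<open>x_i\<close> with \<open>1 \<le> i \<le> n\<close>. As
  \<open>\<omega>\<close> does not see other indices, these must be known to be zero before
  \<open>\<omega>\<close> can identify a leading exponent.\<close>

lemma supported_word:
  assumes "set w \<subseteq> gens n" "u \<in> Poly_Mapping.keys (\<phi>w w)" "k \<notin> {2..2*n+1}"
  shows "Poly_Mapping.lookup u k = 0"
  using assms(1,2)
proof (induction w arbitrary: u)
  case Nil
  then show ?case by (simp add: sc_def)
next
  case (Cons g w)
  obtain v v' where v: "u = v + v'" "v \<in> Poly_Mapping.keys (\<phi>g g)" "v' \<in> Poly_Mapping.keys (\<phi>w w)"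
    using Cons.prems(2) keys_tw_mult[of "(+)" \<omega> "\<phi>g g" "\<phi>w w"] by auto
  have sup: "Poly_Mapping.lookup (ex i) k = 0 \<and> Poly_Mapping.lookup (ez i) k = 0" if "i \<in> {1..n}" for i
    using that assms(3) by (auto simp: ex_def ez_def lookup_single when_def)
  have "Poly_Mapping.lookup v k = 0"
    using Cons.prems(1) v(2) sup
    by (auto simp: gens_def lookup_minus dest!: subsetD[OF keys_\<phi>g_Y] simp del: \<phi>g.simps(2))
  then show ?case using Cons v by (simp add: lookup_add)
qed

lemma supported:
  assumes "p \<in> carrier F" "u \<in> Poly_Mapping.keys (\<phi> p)" "k \<notin> {2..2*n+1}"
  shows "Poly_Mapping.lookup u k = 0"
  using assms(1,2)
proof (induction arbitrary: u rule: free_alg_induct)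
  case (single w c)
  then have "u \<in> Poly_Mapping.keys (\<phi>w w)" by (auto simp: \<phi>_single in_keys_iff lookup_sc_mult)
  then show ?case using supported_word[OF single(1) _ assms(3)] by blast
next
  case (add p r)
  then show ?case using Poly_Mapping.keys_add[of "\<phi> p" "\<phi> r"] by (auto simp: \<phi>_add)
qed

section \<open>Twists and leading exponents\<close>

lemma q_powi_inj:
  assumes "i \<in> {1..n}" "q i powi a = q i powi b"
  shows "a = b"
proof -
  have pos: "m = 0" if "q i powi int m = 1" for m
    using that q_not_root[OF assms(1), of m] by (cases "m = 0") (auto simp: power_int_of_nat)
  have *: "q i powi (a - b) = 1" "q i powi (b - a) = 1"
    using assms(2) q_nz[OF assms(1)] by (simp_all add: power_int_diff)
  show ?thesis
  proof (cases "a \<ge> b")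
    case True
    then show ?thesis using pos[of "nat (a - b)"] *(1) by simp
  next
    case False
    then show ?thesis using pos[of "nat (b - a)"] *(2) by simp
  qed
qed

text \<open>The commutation bicharacter of the torus is nondegenerate because the \<open>q\<^sub>i\<close> are not roots of
  unity, so leading terms of twisted-commuting elements are determined by the twist.\<close>

lemma twist_lm:
  assumes u: "u \<noteq> 0" "u' \<noteq> 0" "p \<noteq> 0"
    and eq: "u \<star> p = p' \<star> u" "u' \<star> p = p' \<star> u'"
  shows "\<omega> (lm u) (lm p) * \<omega> (lm p) (lm u') = \<omega> (lm u') (lm p) * \<omega> (lm p) (lm u)"
proof -
  have p': "p' \<noteq> 0" using tm_lm(1)[OF u(1,3)] eq(1) by auto
  have lm_p': "lm p' = lm p" using tm_lm(2)[OF u(1,3)] tm_lm(2)[OF p' u(1)] eq(1) by simp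
  have lc: "Poly_Mapping.lookup v (lm v) \<noteq> 0" if "v \<noteq> 0" for v :: "(nat \<Rightarrow>\<^sub>0 int) \<Rightarrow>\<^sub>0 'k"
    using lm_in_keys[OF that] by (simp add: in_keys_iff)
  have *: "\<omega> (lm v) (lm p) * Poly_Mapping.lookup p (lm p) = \<omega> (lm p) (lm v) * Poly_Mapping.lookup p' (lm p)"
    if v: "v \<noteq> 0" "v \<star> p = p' \<star> v" for v
    using tm_lm(3)[OF v(1) u(3)] tm_lm(3)[OF p' v(1)] v(2) lc[OF v(1)] lm_p' by (simp add: add.commute)
  \<comment> \<open>Multiplying the two identities crosswise leaves the leading coefficients of
    \<open>p\<close> and \<open>p'\<close> as a common nonzero factor.\<close>
  have "(\<omega> (lm u) (lm p) * Poly_Mapping.lookup p (lm p)) * (\<omega> (lm p) (lm u') * Poly_Mapping.lookup p' (lm p))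
      = (\<omega> (lm p) (lm u) * Poly_Mapping.lookup p' (lm p)) * (\<omega> (lm u') (lm p) * Poly_Mapping.lookup p (lm p))"
    unfolding *[OF u(1) eq(1)] *[OF u(2) eq(2), symmetric] ..
  moreover have "Poly_Mapping.lookup p (lm p) * Poly_Mapping.lookup p' (lm p) \<noteq> 0"
    using lc[OF u(3)] lc[OF p'] lm_p' by simp
  ultimately show ?thesis by (simp add: field_simps)
qed

lemma gz_lm: "gz i \<noteq> 0" "lm (gz i) = ez i"
proof -
  have k: "Poly_Mapping.keys (gz i) = {ez i}" by (simp add: gz_def)
  then show "gz i \<noteq> 0" by auto
  show "lm (gz i) = ez i" using k by (simp add: lm_def)
qed

text \<open>Tested on \<open>gz i\<close>, the twist gives \<open>q i\<close> to the power of the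
  \<open>x\<close>-exponent, since \<open>\<omega>\<close> is trivial with \<open>ez i\<close> on
  the left. Once these agree, the factors from \<open>lam\<close> cancel in the test on
  \<open>x_i\<close>, leaving \<open>q i\<close> to the power of the
  \<open>z\<close>-exponent.\<close>

lemma twist_lm_eq:
  assumes u: "u \<noteq> 0" "u' \<noteq> 0"
    and sup: "\<And>v k. v \<in> Poly_Mapping.keys u \<union> Poly_Mapping.keys u' \<Longrightarrow> k \<notin> {2..2*n+1} \<Longrightarrow> Poly_Mapping.lookup v k = 0"
    and x: "\<And>i. i \<in> {1..n} \<Longrightarrow> \<exists>p'. u \<star> \<phi>g (X i) = p' \<star> u \<and> u' \<star> \<phi>g (X i) = p' \<star> u'"
    and z: "\<And>i. i \<in> {1..n} \<Longrightarrow> \<exists>p'. u \<star> gz i = p' \<star> u \<and> u' \<star> gz i = p' \<star> u'"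
  shows "lm u = lm u'"
proof -
  have xe: "xe (lm u) i = xe (lm u') i" if i: "i \<in> {1..n}" for i
  proof -
    obtain p' where p': "u \<star> gz i = p' \<star> u" "u' \<star> gz i = p' \<star> u'" using z[OF i] by blast
    have "q i powi xe (lm u) i = q i powi xe (lm u') i"
      using twist_lm[OF u gz_lm(1) p'] unfolding gz_lm(2) \<omega>_ez_left \<omega>_ez_right[OF i] by simp
    then show ?thesis by (rule q_powi_inj[OF i])
  qed
  have ze: "ze (lm u) i = ze (lm u') i" if i: "i \<in> {1..n}" for i
  proof -
    have g: "X i \<in> gens n" using i by (simp add: gens_iff)
    obtain p' where "u \<star> \<phi>g (X i) = p' \<star> u" "u' \<star> \<phi>g (X i) = p' \<star> u'" using x[OF i] by blast
    from twist_lm[OF u \<phi>g_lm(1)[OF g] this]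
    have e: "\<omega> (lm u) (ex i) * \<omega> (ex i) (lm u') = \<omega> (lm u') (ex i) * \<omega> (ex i) (lm u)"
      unfolding \<phi>g_lm(2)[OF g] by simp
    have "\<omega> (lm u) (ex i) = \<omega> (lm u') (ex i)"
      unfolding \<omega>_ex_right[OF i] by (intro prod.cong) (simp_all add: xe)
    then have "\<omega> (ex i) (lm u') = \<omega> (ex i) (lm u)" using e \<omega>_nz[of "lm u'" "ex i"] by simp
    moreover have L: "(\<Prod>j\<in>{1..n}. lamu i j powi xe (lm u) j) = (\<Prod>j\<in>{1..n}. lamu i j powi xe (lm u') j)"
      by (intro prod.cong) (simp_all add: xe)
    moreover have nz: "(\<Prod>j\<in>{1..n}. lamu i j powi xe (lm u') j) \<noteq> 0"
      using lamu_nz[OF i] by auto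
    ultimately have "q i powi ze (lm u') i = q i powi ze (lm u) i"
      unfolding \<omega>_ex_left[OF i] L by (simp only: mult_right_cancel[OF nz])
    then have "q i powi ze (lm u) i = q i powi ze (lm u') i" by (rule sym)
    then show ?thesis by (rule q_powi_inj[OF i])
  qed
  show ?thesis
  proof (rule poly_mapping_eqI)
    fix k
    show "Poly_Mapping.lookup (lm u) k = Poly_Mapping.lookup (lm u') k"
    proof (cases "k \<in> {2..2*n+1}")
      case False
      then show ?thesis using sup lm_in_keys[OF u(1)] lm_in_keys[OF u(2)] by simp
    next
      case True
      then have i: "k div 2 \<in> {1..n}" by auto
      show ?thesis
      proof (cases "even k")
        case True
        then show ?thesis using ze[OF i] by (simp add: ze_def)
      next
        case False
        then show ?thesis using xe[OF i] by (simp add: xe_def)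
      qed
    qed
  qed
qed

text \<open>Subtracting a multiple of \<open>u'\<close> removes the leading term of
  \<open>u\<close>. The difference twists as \<open>u'\<close> does, so if nonzero it has the
  leading exponent of \<open>u'\<close>, exactly where its coefficient has been made zero.\<close>

lemma twist_unique_torus:
  assumes u: "u' \<noteq> 0"
    and sup: "\<And>v k. v \<in> Poly_Mapping.keys u \<union> Poly_Mapping.keys u' \<Longrightarrow> k \<notin> {2..2*n+1} \<Longrightarrow> Poly_Mapping.lookup v k = 0"
    and x: "\<And>i. i \<in> {1..n} \<Longrightarrow> \<exists>p'. u \<star> \<phi>g (X i) = p' \<star> u \<and> u' \<star> \<phi>g (X i) = p' \<star> u'"
    and z: "\<And>i. i \<in> {1..n} \<Longrightarrow> \<exists>p'. u \<star> gz i = p' \<star> u \<and> u' \<star> gz i = p' \<star> u'"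
  shows "\<exists>c. u = sc c \<star> u'"
proof (cases "u = 0")
  case True
  then show ?thesis using sc_0 by (intro exI[of _ 0]) simp
next
  case False
  have lm_eq: "lm u = lm u'" by (rule twist_lm_eq[OF False u sup x z])
  define c where "c = Poly_Mapping.lookup u (lm u) / Poly_Mapping.lookup u' (lm u')"
  define v where "v = u - sc c \<star> u'"
  have lookup_v: "Poly_Mapping.lookup v k = Poly_Mapping.lookup u k - c * Poly_Mapping.lookup u' k" for k
    by (simp add: v_def lookup_minus lookup_sc_mult)
  have keys_v: "Poly_Mapping.keys v \<subseteq> Poly_Mapping.keys u \<union> Poly_Mapping.keys u'"
    by (auto simp: in_keys_iff lookup_v)
  have tw: "v \<star> p = p' \<star> v" if "u \<star> p = p' \<star> u" "u' \<star> p = p' \<star> u'" for p p'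
    using that by (simp add: v_def tw_mult_diff_left tw_mult_diff_right tm_assoc sc_left_commute)
  have "v = 0"
  proof (rule ccontr)
    assume v: "v \<noteq> 0"
    have "lm v = lm u'"
    proof (rule twist_lm_eq[OF v u])
      show "Poly_Mapping.lookup w k = 0" if "w \<in> Poly_Mapping.keys v \<union> Poly_Mapping.keys u'" "k \<notin> {2..2*n+1}" for w k
        using sup[of w k] that keys_v by blast
      show "\<exists>p'. v \<star> \<phi>g (X i) = p' \<star> v \<and> u' \<star> \<phi>g (X i) = p' \<star> u'" if "i \<in> {1..n}" for i
        using x[OF that] tw by blast
      show "\<exists>p'. v \<star> gz i = p' \<star> v \<and> u' \<star> gz i = p' \<star> u'" if "i \<in> {1..n}" for i
        using z[OF that] tw by blast
    qed
    moreover have "Poly_Mapping.lookup u' (lm u') \<noteq> 0" using lm_in_keys[OF u] by (simp add: in_keys_iff)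
    then have "Poly_Mapping.lookup v (lm u') = 0" by (simp add: lookup_v c_def lm_eq)
    ultimately show False using lm_in_keys[OF v] by (simp add: in_keys_iff)
  qed
  then show ?thesis by (auto simp: v_def)
qed

section \<open>Normality of the elements \<open>z_i\<close> and verification of the rigidity
  conditions\<close>

definition fz :: "nat \<Rightarrow> 'k fa" where
  "fz i = fa_mult (fa_sc (q i - 1)) (fa_mult (fa_y i) (fa_x i)) + fa_sc 1"

lemma fz_carrier: "i \<in> {1..n} \<Longrightarrow> fz i \<in> carrier F"
  by (simp add: fz_def free_alg_add free_alg_mult free_alg_fa_sc fa_gen_carrier)

lemma \<phi>_fz: "i \<in> {1..n} \<Longrightarrow> \<phi> (fz i) = gz i"
proof -
  assume i: "i \<in> {1..n}"
  have "\<phi> (fz i) = sc (q i - 1) \<star> (sc (inverse (q i - 1)) \<star> (gz i - sc 1)) + sc 1"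
    by (simp only: fz_def \<phi>_add \<phi>_mult \<phi>_fa_sc \<phi>_gen \<phi>g_YX[OF i])
  also have "\<dots> = gz i"
    using q_ne_1[OF i] by (simp only: tm_assoc[symmetric] sc_mult) (simp add: sc_1)
  finally show ?thesis .
qed

text \<open>Crossing a word costs a scalar that depends on the word, so \<open>r\<close> is obtained
  by rescaling the terms of \<open>p\<close> one by one.\<close>

lemma gz_normal:
  assumes "i \<in> {1..n}" "p \<in> carrier F"
  shows "\<exists>r\<in>carrier F. gz i \<star> \<phi> p = \<phi> r \<star> gz i"
  using assms(2)
proof (induction rule: free_alg_induct)
  case (single w c)
  have "\<exists>d. gz i \<star> \<phi>w w = sc d \<star> (\<phi>w w \<star> gz i)"
    using single
  proof (induction w)
    case Nil
    show ?case by (intro exI[of _ 1]) (simp add: sc_1 sc_central)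
  next
    case (Cons g w)
    obtain d where d: "gz i \<star> \<phi>w w = sc d \<star> (\<phi>w w \<star> gz i)" using Cons by auto
    obtain e where e: "gz i \<star> \<phi>g g = sc e \<star> (\<phi>g g \<star> gz i)" using gz_commute[OF assms(1), of g] Cons.prems by auto
    have "gz i \<star> \<phi>w (g # w) = (gz i \<star> \<phi>g g) \<star> \<phi>w w" by (simp add: tm_assoc del: \<phi>g.simps)
    also have "\<dots> = sc e \<star> (\<phi>g g \<star> (gz i \<star> \<phi>w w))" by (simp only: e tm_assoc)
    also have "\<dots> = sc e \<star> (sc d \<star> (\<phi>g g \<star> (\<phi>w w \<star> gz i)))" by (simp only: d sc_left_commute[of "\<phi>g g"])
    also have "\<dots> = sc (e * d) \<star> (\<phi>w (g # w) \<star> gz i)"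
      by (simp add: tm_assoc sc_mult[symmetric] del: \<phi>g.simps)
    finally show ?case by blast
  qed
  then obtain d where d: "gz i \<star> \<phi>w w = sc d \<star> (\<phi>w w \<star> gz i)" by blast
  have "gz i \<star> \<phi> (Poly_Mapping.single w c) = sc c \<star> (gz i \<star> \<phi>w w)"
    unfolding \<phi>_single by (rule sc_left_commute)
  also have "\<dots> = (sc (c * d) \<star> \<phi>w w) \<star> gz i" unfolding d by (simp add: tm_assoc sc_mult[symmetric])
  finally have "gz i \<star> \<phi> (Poly_Mapping.single w c) = \<phi> (Poly_Mapping.single w (c * d)) \<star> gz i"
    by (simp only: \<phi>_single)
  then show ?case using free_alg_single[OF single] by blast
next
  case (add p r)
  then obtain p' r' where pr: "p' \<in> carrier F" "gz i \<star> \<phi> p = \<phi> p' \<star> gz i" "r' \<in> carrier F" "gz i \<star> \<phi> r = \<phi> r' \<star> gz i"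
    by blast
  then have "gz i \<star> \<phi> (p + r) = \<phi> (p' + r') \<star> gz i" by (simp add: \<phi>_add tw_mult_add_left tw_mult_add_right)
  then show ?case using free_alg_add[OF pr(1,3)] by blast
qed

text \<open>Goals 1 to 5 are the algebra structure, goals 6 to 9 the conditions of
  \<open>rigid_algebra\<close> in the order of its axioms.\<close>

lemma qwa_rigid: "rigid_algebra A (qwa_sc n q lam)"
proof -
  interpret A: ring A by (rule A_ring)
  note [simp] = qwa_sc_cl free_alg_fa_sc cl_closed free_alg_mult free_alg_add
  have obt: "\<exists>p\<in>carrier F. a = cl p" if "a \<in> carrier A" for a using that by (auto simp: carrier_A)
  show ?thesis
  proof (unfold_locales, goal_cases)
    case (1 c)
    then show ?case by simp
  next
    case (2 c d)
    then show ?case using A_add[OF free_alg_fa_sc free_alg_fa_sc, of c d] by (simp add: fa_sc_def single_add)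
  next
    case (3 c d)
    then show ?case using A_mult[OF free_alg_fa_sc free_alg_fa_sc, of c d] by (simp add: fa_sc_def fa_mult_single)
  next
    case 4
    then show ?case by (simp add: A_one fa_sc_def)
  next
    case (5 a c)
    then obtain p where p: "p \<in> carrier F" "a = cl p" using obt by blast
    then show ?case by (simp add: A_mult cl_eq_iff \<phi>_mult \<phi>_fa_sc sc_central)
  next
    case 6
    have "\<phi> (Poly_Mapping.single [] 1) \<noteq> 0" using \<phi>w_lm(1)[of "[]"] by (simp add: \<phi>_single sc_1)
    then show ?case unfolding A_one by (simp add: cl_zero_iff free_alg_single)
  next
    case (7 a b)
    then obtain p r where p: "p \<in> carrier F" "a = cl p" and r: "r \<in> carrier F" "b = cl r" using obt by meson
    then show ?case using 7(3) tm_lm(1)[of "\<phi> p" "\<phi> r"] by (auto simp: A_mult cl_zero_iff \<phi>_mult)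
  next
    case (8 u u')
    obtain p p' where p: "p \<in> carrier F" "u = cl p" and p': "p' \<in> carrier F" "u' = cl p'" using obt 8(1,2) by meson
    have tw: "\<exists>s. \<phi> p \<star> \<phi> a = s \<star> \<phi> p \<and> \<phi> p' \<star> \<phi> a = s \<star> \<phi> p'" if a: "a \<in> carrier F" for a
    proof -
      obtain b where "b \<in> carrier A" "u \<otimes>\<^bsub>A\<^esub> cl a = b \<otimes>\<^bsub>A\<^esub> u" "u' \<otimes>\<^bsub>A\<^esub> cl a = b \<otimes>\<^bsub>A\<^esub> u'"
        using 8(4)[OF cl_closed[OF a]] by blast
      moreover then obtain s where "s \<in> carrier F" "b = cl s" using obt by blast
      ultimately show ?thesis using a p p' by (intro exI[of _ "\<phi> s"]) (simp add: A_mult cl_eq_iff \<phi>_mult)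
    qed
    \<comment> \<open>The test elements \<open>x_i\<close> and \<open>z_i\<close> of the torus are
      images of elements of the algebra, so the hypothesis on \<open>u\<close> and \<open>u'\<close>
      applies to them.\<close>
    have "\<exists>c. \<phi> p = sc c \<star> \<phi> p'"
    proof (rule twist_unique_torus)
      show "\<phi> p' \<noteq> 0" using 8(3) p' by (simp add: cl_zero_iff)
      show "Poly_Mapping.lookup v k = 0"
        if "v \<in> Poly_Mapping.keys (\<phi> p) \<union> Poly_Mapping.keys (\<phi> p')" "k \<notin> {2..2*n+1}" for v k
        using that supported[OF p(1)] supported[OF p'(1)] by blast
      show "\<exists>s. \<phi> p \<star> \<phi>g (X i) = s \<star> \<phi> p \<and> \<phi> p' \<star> \<phi>g (X i) = s \<star> \<phi> p'" if "i \<in> {1..n}" for i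
        using tw[OF fa_gen_carrier(1)[OF that]] unfolding \<phi>_gen .
      show "\<exists>s. \<phi> p \<star> gz i = s \<star> \<phi> p \<and> \<phi> p' \<star> gz i = s \<star> \<phi> p'" if "i \<in> {1..n}" for i
        using tw[OF fz_carrier[OF that]] unfolding \<phi>_fz[OF that] .
    qed
    then obtain c where "\<phi> p = sc c \<star> \<phi> p'" by blast
    then show ?case using p p' by (intro exI[of _ c]) (simp add: A_mult cl_eq_iff \<phi>_mult \<phi>_fa_sc)
  next
    case (9 S)
    have gen: "cl (fa_x i) \<in> S" "cl (fa_y i) \<in> S" if i: "i \<in> {1..n}" for i
    proof -
      note fx = fa_gen_carrier(1)[OF i] and fy = fa_gen_carrier(2)[OF i] and fzi = fz_carrier[OF i]
      have "cl (fz i) \<in> S"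
      proof (rule 9(6))
        show "cl (fz i) \<in> carrier A" using fzi by simp
        show "cl (fz i) \<noteq> \<zero>\<^bsub>A\<^esub>" using gz_lm(1) by (simp add: cl_zero_iff fzi \<phi>_fz[OF i])
        show "\<forall>a\<in>carrier A. \<exists>a'\<in>carrier A. cl (fz i) \<otimes>\<^bsub>A\<^esub> a = a' \<otimes>\<^bsub>A\<^esub> cl (fz i)"
        proof
          fix a assume "a \<in> carrier A"
          then obtain p where p: "p \<in> carrier F" "a = cl p" using obt by blast
          obtain r where r: "r \<in> carrier F" "gz i \<star> \<phi> p = \<phi> r \<star> gz i" using gz_normal[OF i p(1)] by blast
          then show "\<exists>a'\<in>carrier A. cl (fz i) \<otimes>\<^bsub>A\<^esub> a = a' \<otimes>\<^bsub>A\<^esub> cl (fz i)"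
            using p fzi by (intro bexI[of _ "cl r"]) (simp_all add: A_mult cl_eq_iff \<phi>_mult \<phi>_fz[OF i])
        qed
      qed
      \<comment> \<open>Scalars and sums turn \<open>z_i\<close> into
        \<open>(z_i - 1) / (q_i - 1) = y_i x_i\<close>. This product is nonzero, so closure under
        factors yields both generators.\<close>
      then have "cl (fa_sc (inverse (q i - 1))) \<otimes>\<^bsub>A\<^esub> (cl (fz i) \<oplus>\<^bsub>A\<^esub> cl (fa_sc (- 1))) \<in> S"
        using 9(2)[of "inverse (q i - 1)"] 9(2)[of "- 1"] 9(3,4) by simp
      moreover have "cl (fa_sc (inverse (q i - 1))) \<otimes>\<^bsub>A\<^esub> (cl (fz i) \<oplus>\<^bsub>A\<^esub> cl (fa_sc (- 1))) = cl (fa_y i) \<otimes>\<^bsub>A\<^esub> cl (fa_x i)"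
      proof -
        have "gz i + sc (- 1) = gz i - sc 1" by (simp add: sc_def single_uminus)
        then show ?thesis using fx fy fzi
          by (simp add: A_mult A_add cl_eq_iff \<phi>_mult \<phi>_add \<phi>_fa_sc \<phi>_fz[OF i] \<phi>_gen \<phi>g_YX[OF i] del: \<phi>g.simps)
      qed
      moreover have "cl (fa_y i) \<otimes>\<^bsub>A\<^esub> cl (fa_x i) \<noteq> \<zero>\<^bsub>A\<^esub>"
        using fx fy tm_lm(1)[OF \<phi>g_lm(1)[of "Y i"] \<phi>g_lm(1)[of "X i"]] i
        by (simp add: A_mult cl_zero_iff \<phi>_mult \<phi>_gen gens_iff del: \<phi>g.simps)
      ultimately show "cl (fa_x i) \<in> S" "cl (fa_y i) \<in> S"
        using 9(5)[of "cl (fa_y i)" "cl (fa_x i)"] fx fy by auto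
    qed
    have word: "cl (Poly_Mapping.single w 1) \<in> S" if "set w \<subseteq> gens n" for w
      using that
    proof (induction w)
      case Nil
      then show ?case using 9(2)[of 1] by (simp add: fa_sc_def)
    next
      case (Cons g w)
      have "cl (Poly_Mapping.single [g] 1) \<in> S"
      proof -
        have "g \<in> gens n" using Cons.prems by simp
        then show ?thesis using gen by (cases rule: gens_cases) (auto simp: fa_x_def fa_y_def fa_gen_def)
      qed
      then have "cl (Poly_Mapping.single [g] 1) \<otimes>\<^bsub>A\<^esub> cl (Poly_Mapping.single w 1) \<in> S"
        using Cons 9(4) by simp
      then show ?case using Cons.prems by (simp add: A_mult free_alg_single fa_mult_single)
    qed
    have "cl p \<in> S" if "p \<in> carrier F" for p
      using that
    proof (induction rule: free_alg_induct)
      case (single w c)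
      have "cl (fa_sc c) \<otimes>\<^bsub>A\<^esub> cl (Poly_Mapping.single w 1) \<in> S"
        using 9(2)[of c] 9(4) word[OF single] by simp
      then show ?case using single by (simp add: A_mult free_alg_single fa_sc_mult_single)
    next
      case (add p r)
      then show ?case using 9(3)[of "cl p" "cl r"] by (simp add: A_add)
    qed
    then show ?case by (auto simp: carrier_A)
  qed
qed

end

theorem theorem2p5:
  fixes n :: nat and q :: "nat \<Rightarrow> 'k::field" and lam :: "nat \<Rightarrow> nat \<Rightarrow> 'k"
  defines "A \<equiv> qwa n q lam"
      and "\<iota> \<equiv> qwa_sc n q lam"
      and "P \<equiv> UP (qwa n q lam)"
  defines "\<iota>P \<equiv> (\<lambda>c. monom P (\<iota> c) 0)"
      and "t \<equiv> monom P \<one>\<^bsub>A\<^esub> 1"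
  assumes n1: "n \<ge> 1"
      and q_nz: "\<forall>i\<in>{1..n}. q i \<noteq> 0"
      and lam_nz: "\<forall>i\<in>{1..n}. \<forall>j\<in>{1..n}. lam i j \<noteq> 0"
      and lam_inv: "\<forall>i\<in>{1..n}. \<forall>j\<in>{1..n}. lam i j = inverse (lam j i)"
      and lam_diag: "\<forall>i\<in>{1..n}. lam i i = 1"
      and q_not_root: "\<forall>k\<in>{1..n}. \<forall>m::nat. m \<ge> 1 \<longrightarrow> q k ^ m \<noteq> 1"
  shows "(\<forall>h\<in>alg_aut P \<iota>P. \<exists>g\<in>alg_aut A \<iota>. \<exists>c r. c \<noteq> 0 \<and>
             (\<forall>a\<in>carrier A. h (monom P a 0) = monom P (g a) 0) \<and>
             h t = monom P (\<iota> c) 1 \<oplus>\<^bsub>P\<^esub> monom P (\<iota> r) 0)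
       \<and> (\<forall>g\<in>alg_aut A \<iota>. \<forall>c r. c \<noteq> 0 \<longrightarrow> (\<exists>h\<in>alg_aut P \<iota>P.
             (\<forall>a\<in>carrier A. h (monom P a 0) = monom P (g a) 0) \<and>
             h t = monom P (\<iota> c) 1 \<oplus>\<^bsub>P\<^esub> monom P (\<iota> r) 0))
       \<and> (CHAR('k) = 0 \<longrightarrow>
             (\<forall>d. alg_derivation A \<iota> d \<and> locally_nilpotent A d \<longrightarrow>
                  (\<forall>a\<in>carrier A. d a = \<zero>\<^bsub>A\<^esub>)))"
proof -
  interpret Q: qweyl n q lam
    using q_nz lam_nz lam_inv q_not_root by unfold_locales blast+
  interpret rigid_algebra A P \<iota>
    unfolding A_def P_def \<iota>_def by (rule Q.qwa_rigid)
  have "d a = \<zero>\<^bsub>A\<^esub>" if "CHAR('k) = 0" "alg_derivation A \<iota> d" "locally_nilpotent A d" "a \<in> carrier A" for d a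
    using that by (intro locally_nilpotent_derivation_zero) (auto simp: of_nat_eq_0_iff_char_dvd)
  then show ?thesis
    unfolding \<iota>P_def t_def by (intro conjI ballI allI impI aut_triangular triangular_aut_exists) auto
qed

end
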